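(* Let $k$ be a perfect field with $\operatorname{char}k\neq2,3$ and let $A$ be a $G_k$-group isomorphic to $D_{12}$. Let $u,v\in k^*$ with $K_1=k(\sqrt u)$ and $K_2=k(\sqrt v)$. Then $A$ is isomorphic as a $G_k$-group to a subgroup of $\operatorname{GL}_2(\overline k)$ stable under the $G_k$-action if and only if $(u,-3v)$ is trivial in $\operatorname{Br}_2(k)$.
   Context: $G_k=\operatorname{Gal}(\overline k/k)$ acts on $\operatorname{GL}_2(\overline k)$ entrywise. A $G_k$-group is a finite group with an action of $G_k$ by group automorphisms factoring through a finite quotient. Write $A=\langle U,V\mid U^2=V^6=1,\ VU=UV^5\rangle$. $K_1$ is the fixed field of the kernel of the induced $G_k$-action on the abelianization $A/\langle V^2\rangle\simeq V_4$, and $K_2$ that of the induced action on the characteristic cyclic subgroup $\langle V\rangle$ of order 6. $(a,b)\in\operatorname{Br}_2(k)$ is the class of the quaternion algebra with $i^2=a$, $j^2=b$, $ij=-ji$. *)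

theory Defs
  imports
    "HOL-Analysis.Cartesian_Space"
    "HOL-Algebra.Algebra"
    "HOL-Algebra.Algebraic_Closure_Type"
begin

section \<open>The field \<open>k\<close>, its algebraic closure and its Galois group\<close>

text \<open>
  The base field \<open>k\<close> is a type \<open>'a\<close> of class \<open>field\<close> and \<open>'a alg_closure\<close> is its algebraic
  closure; \<open>k\<close> is identified with the subfield \<open>range to_ac\<close>.
\<close>

definition perfect_field :: "'a::field itself \<Rightarrow> bool" where
  "perfect_field _ \<longleftrightarrow>
     (\<forall>p::'a poly. Factorial_Ring.irreducible p \<longrightarrow> rsquarefree (map_poly to_ac p))"

abbreviation closure_ring :: "'a::field alg_closure ring" where
  "closure_ring \<equiv> ring_of_type_algebra"

definition abs_galois_group :: "('a::field alg_closure \<Rightarrow> 'a alg_closure) monoid" where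
  "abs_galois_group =
     \<lparr>carrier = {\<sigma> \<in> ring_iso closure_ring closure_ring. \<forall>x. \<sigma> (to_ac x) = to_ac x},
      monoid.mult = (\<circ>),
      one = id\<rparr>"

definition fixed_field ::
  "('a::field alg_closure \<Rightarrow> 'a alg_closure) set \<Rightarrow> 'a alg_closure set" where
  "fixed_field S = {x. \<forall>\<sigma>\<in>S. \<sigma> x = x}"

definition adjoin_sqrt :: "'a::field \<Rightarrow> 'a alg_closure set" where
  "adjoin_sqrt u = generate_field closure_ring (range to_ac \<union> {w. w ^ 2 = to_ac u})"

text \<open>
  Normality is expressed by stability under the Galois group. Separability is not required here,
  since it is automatic over a perfect field.
\<close>

definition finite_galois_subextension :: "'a::field alg_closure set \<Rightarrow> bool" where
  "finite_galois_subextension L \<longleftrightarrow>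
     subfield L closure_ring \<and> range to_ac \<subseteq> L \<and>
     ring.finite_dimension closure_ring (range to_ac) L \<and>
     (\<forall>\<sigma>\<in>carrier abs_galois_group. \<sigma> ` L = L)"


section \<open>Groups with Galois action\<close>

text \<open>
  ``Factoring through a finite quotient'' is meant in the sense of the profinite group
  \<open>G\<^sub>k\<close>: the action factors through restriction to \<open>Gal(L/k)\<close> for a finite
  Galois extension \<open>L/k\<close>. (Every abstract action on a finite group factors through some finite
  quotient of the abstract group.)
\<close>

definition galois_group_action ::
  "('b, 'c) monoid_scheme \<Rightarrow>
   (('a::field alg_closure \<Rightarrow> 'a alg_closure) \<Rightarrow> 'b \<Rightarrow> 'b) \<Rightarrow> bool" where
  "galois_group_action A \<phi> \<longleftrightarrow>
     group A \<and> finite (carrier A) \<and>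
     \<phi> \<in> hom abs_galois_group (AutoGroup A) \<and>
     (\<exists>L. finite_galois_subextension L \<and>
        (\<forall>\<sigma>\<in>carrier abs_galois_group. \<forall>\<tau>\<in>carrier abs_galois_group.
           (\<forall>x\<in>L. \<sigma> x = \<tau> x) \<longrightarrow> \<phi> \<sigma> = \<phi> \<tau>))"

definition kernel_on_quotient ::
  "('b, 'c) monoid_scheme \<Rightarrow> (('a::field alg_closure \<Rightarrow> 'a alg_closure) \<Rightarrow> 'b \<Rightarrow> 'b) \<Rightarrow>
   'b set \<Rightarrow> ('a alg_closure \<Rightarrow> 'a alg_closure) set" where
  "kernel_on_quotient A \<phi> N =
     kernel abs_galois_group (AutoGroup (A Mod N)) (\<lambda>\<sigma>. \<lambda>C\<in>carrier (A Mod N). \<phi> \<sigma> ` C)"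

definition kernel_on_subgroup ::
  "('b, 'c) monoid_scheme \<Rightarrow> (('a::field alg_closure \<Rightarrow> 'a alg_closure) \<Rightarrow> 'b \<Rightarrow> 'b) \<Rightarrow>
   'b set \<Rightarrow> ('a alg_closure \<Rightarrow> 'a alg_closure) set" where
  "kernel_on_subgroup A \<phi> H =
     kernel abs_galois_group (AutoGroup (A\<lparr>carrier := H\<rparr>)) (\<lambda>\<sigma>. restrict (\<phi> \<sigma>) H)"

definition GL2 :: "('d::field ^ 2 ^ 2) monoid" where
  "GL2 = \<lparr>carrier = {M. invertible M}, monoid.mult = (**), one = mat 1\<rparr>"

definition embeds_stably_in_GL2 ::
  "('b, 'c) monoid_scheme \<Rightarrow>
   (('a::field alg_closure \<Rightarrow> 'a alg_closure) \<Rightarrow> 'b \<Rightarrow> 'b) \<Rightarrow> bool" where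
  "embeds_stably_in_GL2 A \<phi> \<longleftrightarrow>
     (\<exists>B :: ('a alg_closure ^ 2 ^ 2) set.
        subgroup B GL2 \<and>
        (\<forall>\<sigma>\<in>carrier abs_galois_group. map_matrix \<sigma> ` B \<subseteq> B) \<and>
        (\<exists>f\<in>iso A (GL2\<lparr>carrier := B\<rparr>).
           \<forall>\<sigma>\<in>carrier abs_galois_group. \<forall>x\<in>carrier A. f (\<phi> \<sigma> x) = map_matrix \<sigma> (f x)))"


section \<open>The dihedral group of order 12\<close>

text \<open>
  The symmetries \<open>x \<mapsto> \<plusminus>x + c\<close> of the regular hexagon with vertices \<open>\<int>/6\<int>\<close>.
\<close>

definition D12 :: "(int \<Rightarrow> int) monoid" where
  "D12 = BijGroup {0..<6}
     \<lparr>carrier := {(\<lambda>x\<in>{0..<6}. (s * x + c) mod 6) | s c. s \<in> {1, -1} \<and> c \<in> {0..<6}}\<rparr>"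

text \<open>
  For \<open>A \<cong> D12\<close>, generators \<open>U\<close>, \<open>V\<close> satisfying these relations present \<open>A\<close>: the group
  \<open>\<langle>U, V | U\<^sup>2 = V\<^sup>6 = 1, VU = UV\<^sup>5\<rangle>\<close> has order at most 12, so its surjection onto
  \<open>A\<close> is an isomorphism.
\<close>

definition dihedral_generators :: "('b, 'c) monoid_scheme \<Rightarrow> 'b \<Rightarrow> 'b \<Rightarrow> bool" where
  "dihedral_generators A U V \<longleftrightarrow>
     U \<in> carrier A \<and> V \<in> carrier A \<and> generate A {U, V} = carrier A \<and>
     U [^]\<^bsub>A\<^esub> (2::nat) = \<one>\<^bsub>A\<^esub> \<and> V [^]\<^bsub>A\<^esub> (6::nat) = \<one>\<^bsub>A\<^esub> \<and>
     V \<otimes>\<^bsub>A\<^esub> U = U \<otimes>\<^bsub>A\<^esub> (V [^]\<^bsub>A\<^esub> (5::nat))"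


section \<open>Quaternion algebras and Brauer equivalence\<close>

text \<open>
  Not necessarily commutative \<open>k\<close>-algebras are represented by the record type \<open>module\<close>,
  whose scalars are elements of the type \<open>'a\<close>.
\<close>

definition base_algebra :: "('a::field, 'a) module" where
  "base_algebra = \<lparr>carrier = UNIV, monoid.mult = (*), one = 1, ring.zero = 0, add = (+), module.smult = (*)\<rparr>"

text \<open>\<open>(x\<^sub>0, x\<^sub>1, x\<^sub>2, x\<^sub>3)\<close> stands for \<open>x\<^sub>0 + x\<^sub>1 i + x\<^sub>2 j + x\<^sub>3 ij\<close>.\<close>

definition quaternion_algebra :: "'a::field \<Rightarrow> 'a \<Rightarrow> ('a, 'a \<times> 'a \<times> 'a \<times> 'a) module" where
  "quaternion_algebra a b =
     \<lparr>carrier = UNIV,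
      monoid.mult = (\<lambda>(x0, x1, x2, x3) (y0, y1, y2, y3).
        (x0 * y0 + a * x1 * y1 + b * x2 * y2 - a * b * x3 * y3,
         x0 * y1 + x1 * y0 - b * x2 * y3 + b * x3 * y2,
         x0 * y2 + x2 * y0 + a * x1 * y3 - a * x3 * y1,
         x0 * y3 + x3 * y0 + x1 * y2 - x2 * y1)),
      one = (1, 0, 0, 0),
      ring.zero = (0, 0, 0, 0),
      add = (\<lambda>(x0, x1, x2, x3) (y0, y1, y2, y3). (x0 + y0, x1 + y1, x2 + y2, x3 + y3)),
      module.smult = (\<lambda>c (x0, x1, x2, x3). (c * x0, c * x1, c * x2, c * x3))\<rparr>"

lemma quaternion_algebra_relations:
  fixes a b :: "'a::field" and i j :: "'a \<times> 'a \<times> 'a \<times> 'a"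
  assumes "Q = quaternion_algebra a b" and "i = (0, 1, 0, 0)" and "j = (0, 0, 1, 0)"
  shows "i \<otimes>\<^bsub>Q\<^esub> i = a \<odot>\<^bsub>Q\<^esub> \<one>\<^bsub>Q\<^esub>"
    and "j \<otimes>\<^bsub>Q\<^esub> j = b \<odot>\<^bsub>Q\<^esub> \<one>\<^bsub>Q\<^esub>"
    and "i \<otimes>\<^bsub>Q\<^esub> j = (0, 0, 0, 1)"
    and "j \<otimes>\<^bsub>Q\<^esub> i = (- 1) \<odot>\<^bsub>Q\<^esub> (i \<otimes>\<^bsub>Q\<^esub> j)"
  using assms by (simp_all add: quaternion_algebra_def)

lemma quaternion_algebra_assoc:
  fixes a b :: "'a::field"
  shows "(x \<otimes>\<^bsub>quaternion_algebra a b\<^esub> y) \<otimes>\<^bsub>quaternion_algebra a b\<^esub> z =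
         x \<otimes>\<^bsub>quaternion_algebra a b\<^esub> (y \<otimes>\<^bsub>quaternion_algebra a b\<^esub> z)"
  by (cases x; cases y; cases z) (simp add: quaternion_algebra_def algebra_simps)

definition matrix_algebra :: "nat \<Rightarrow> ('a, 'b) module \<Rightarrow> ('a, nat \<times> nat \<Rightarrow> 'b) module" where
  "matrix_algebra n M =
     (let I = {..<n} \<times> {..<n} in
      \<lparr>carrier = I \<rightarrow>\<^sub>E carrier M,
       monoid.mult = (\<lambda>S T. restrict (\<lambda>(i, j). \<Oplus>\<^bsub>M\<^esub>l\<in>{..<n}. S (i, l) \<otimes>\<^bsub>M\<^esub> T (l, j)) I),
       one = restrict (\<lambda>(i, j). if i = j then \<one>\<^bsub>M\<^esub> else \<zero>\<^bsub>M\<^esub>) I,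
       ring.zero = (\<lambda>_\<in>I. \<zero>\<^bsub>M\<^esub>),
       add = (\<lambda>S T. \<lambda>p\<in>I. S p \<oplus>\<^bsub>M\<^esub> T p),
       module.smult = (\<lambda>c S. \<lambda>p\<in>I. c \<odot>\<^bsub>M\<^esub> S p)\<rparr>)"

definition algebra_isomorphic :: "('a, 'b) module \<Rightarrow> ('a, 'c) module \<Rightarrow> bool" where
  "algebra_isomorphic M N \<longleftrightarrow>
     (\<exists>f\<in>ring_iso M N. \<forall>c. \<forall>x\<in>carrier M. f (c \<odot>\<^bsub>M\<^esub> x) = c \<odot>\<^bsub>N\<^esub> f x)"

text \<open>
  Central simple \<open>k\<close>-algebras \<open>M\<close>, \<open>N\<close> have the same Brauer class iff
  \<open>M \<otimes>\<^sub>k Mat\<^sub>m(k) \<simeq> N \<otimes>\<^sub>k Mat\<^sub>n(k)\<close> for some \<open>m, n \<ge> 1\<close>, where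
  \<open>M \<otimes>\<^sub>k Mat\<^sub>m(k) = Mat\<^sub>m(M)\<close>. The trivial class is that of \<open>k\<close>.
\<close>

definition brauer_equivalent :: "('a, 'b) module \<Rightarrow> ('a, 'c) module \<Rightarrow> bool" where
  "brauer_equivalent M N \<longleftrightarrow>
     (\<exists>m\<ge>1. \<exists>n\<ge>1. algebra_isomorphic (matrix_algebra m M) (matrix_algebra n N))"

definition quaternion_class_trivial :: "'a::field \<Rightarrow> 'a \<Rightarrow> bool" where
  "quaternion_class_trivial a b \<longleftrightarrow> brauer_equivalent (quaternion_algebra a b) base_algebra"

end

theory Submission
  imports Defs
begin

text \<open>
  Let \<open>M\<close>, \<open>N\<close> be the images of \<open>V\<close>, \<open>U\<close> under a faithful representation. Then \<open>M\<^sup>2 = M - 1\<close>, so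
  \<open>D = 2 M - 1\<close> satisfies \<open>D\<^sup>2 = - 3\<close> and anticommutes with \<open>N\<close>. An element \<open>\<sigma>\<close> acts by
  \<open>D \<mapsto> \<plusminus> D\<close>, with the sign by which it acts on \<open>\<surd>v\<close>, and by \<open>N \<mapsto> N M\<^sup>c\<close>, where \<open>(- 1)\<^sup>c\<close>
  is the sign by which it acts on \<open>\<surd>u\<close>. Hence \<open>\<surd>v D\<close> is a rational matrix of square \<open>- 3 v\<close>.
  A resolvent \<open>S\<close> of the conjugates of \<open>N\<close> (Hilbert 90) is rational and anticommutes with \<open>D\<close>; since
  \<open>M\<^sup>3 = - 1\<close>, the matrix \<open>\<surd>u N S N S N / S\<^sup>2\<close> is rational too. Its square is \<open>u\<close> and it
  anticommutes with \<open>D\<close>, so \<open>(u, - 3 v)\<close> splits. Conversely, a rational pair of anticommuting matrices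
  \<open>E\<close>, \<open>D'\<close> of squares \<open>u\<close> and \<open>- 3 v\<close> gives \<open>M = (1 + D' / \<surd>v) / 2\<close>. For a Hilbert 90
  resolvent \<open>\<beta>\<close> with \<open>\<sigma> \<beta> = \<beta> M\<^sup>2\<^sup>c\<close>, the matrix \<open>N = E \<beta>\<^sup>2 / (\<surd>u det \<beta>)\<close> completes the
  representation.
\<close>

section \<open>Extension of automorphisms\<close>

text \<open>The exponents c form a 1-cocycle with values in Z/6, twisted by the sign on \<surd>v.
  Its parity is the character of \<surd>u, so the difficulty lies in its part modulo 3. The word
  \<open>N S N S N\<close> removes that part: \<open>M\<close> is inverted whenever it passes
  \<open>N\<close> or \<open>S\<close>, each inserted \<open>M ^ c\<close> crosses an even number of
  letters on its way to the right end, and the three copies add up to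
  \<open>M ^ (3 * c) = (- 1) ^ c\<close>. Without the rational separators \<open>S\<close>, the word
  \<open>N N N\<close> would keep a factor \<open>M ^ c\<close>. In the other direction the obvious
  twist, \<sigma> \<beta> = \<beta> \<open>M ^ c\<close>, leads to
  \<open>(E * \<beta>) ^ 2 = u * det \<beta>\<close>, whose square root need not be a rational
  multiple of \<surd>u. With the doubled twist and \<open>\<beta> ^ 2\<close> the square is
  \<open>u * (det \<beta>) ^ 2\<close>; the exponents 4c from \<open>\<beta> ^ 2\<close> and 3c from
  the sign of \<surd>u add up to 7c, which is c modulo 6. The two directions meet in the norm
  equation \<open>u = a ^ 2 - w * b ^ 2\<close> with \<open>w = - 3 * v\<close>. It is equivalent to
  the splitting of the quaternion algebra, and it replaces Brauer classes by explicit
  matrices.\<close>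

lemma mem_abs_galois_group:
  fixes \<sigma> :: "'a::field alg_closure \<Rightarrow> 'a alg_closure"
  shows "\<sigma> \<in> carrier abs_galois_group \<longleftrightarrow>
    bij \<sigma> \<and> (\<forall>x y. \<sigma> (x + y) = \<sigma> x + \<sigma> y) \<and> (\<forall>x y. \<sigma> (x * y) = \<sigma> x * \<sigma> y) \<and> \<sigma> 1 = 1 \<and>
    (\<forall>x. \<sigma> (to_ac x) = to_ac x)"
  by (auto simp: abs_galois_group_def ring_iso_def ring_hom_def ring_of_type_algebra_def)

lemma degree_diff_less_same_lead_coeff:
  fixes p q :: "'b::comm_ring poly"
  assumes "Polynomial.degree q = Polynomial.degree p" "Polynomial.lead_coeff q = Polynomial.lead_coeff p"
    and "p - q \<noteq> 0"
  shows "Polynomial.degree (p - q) < Polynomial.degree p"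
proof -
  have "Polynomial.degree (p - q) \<le> Polynomial.degree p"
    using assms(1) by (intro degree_diff_le) auto
  moreover have "Polynomial.degree (p - q) \<noteq> Polynomial.degree p"
  proof
    assume *: "Polynomial.degree (p - q) = Polynomial.degree p"
    have "Polynomial.coeff (p - q) (Polynomial.degree p) = 0" using assms(1,2) by simp
    then have "Polynomial.lead_coeff (p - q) = 0" by (simp only: *)
    then have "p - q = 0" by (simp only: leading_coeff_0_iff)
    with assms(3) show False by contradiction
  qed
  ultimately show ?thesis by simp
qed

text \<open>
  Partial homomorphisms over \<open>k\<close> are represented by their graphs, so that Zorn's lemma applies to
  inclusion.
\<close>

definition k_subring_rel :: "('a::field alg_closure \<times> 'a alg_closure) set \<Rightarrow> bool" where
  "k_subring_rel G \<longleftrightarrow>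
     (\<forall>a. (to_ac a, to_ac a) \<in> G) \<and>
     (\<forall>x x' y y'. (x, x') \<in> G \<longrightarrow> (y, y') \<in> G \<longrightarrow> (x + y, x' + y') \<in> G \<and> (x * y, x' * y') \<in> G) \<and>
     (\<forall>y. (0, y) \<in> G \<longrightarrow> y = 0)"

context
  fixes G :: "('a::field alg_closure \<times> 'a alg_closure) set"
  assumes G: "k_subring_rel G"
begin

lemma rel_to_ac: "(to_ac a, to_ac a) \<in> G"
  and rel_add: "(x, x') \<in> G \<Longrightarrow> (y, y') \<in> G \<Longrightarrow> (x + y, x' + y') \<in> G"
  and rel_mult: "(x, x') \<in> G \<Longrightarrow> (y, y') \<in> G \<Longrightarrow> (x * y, x' * y') \<in> G"
  and rel_zeroD: "(0, z) \<in> G \<Longrightarrow> z = 0"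
  using G by (auto simp: k_subring_rel_def)

lemma rel_0: "(0, 0) \<in> G" and rel_1: "(1, 1) \<in> G"
  using rel_to_ac[of 0] rel_to_ac[of 1] by auto

lemma rel_minus: "(x, x') \<in> G \<Longrightarrow> (- x, - x') \<in> G"
  using rel_mult[of x x' "to_ac (- 1)" "to_ac (- 1)"] rel_to_ac[of "- 1"] by auto

lemma rel_diff: "(x, x') \<in> G \<Longrightarrow> (y, y') \<in> G \<Longrightarrow> (x - y, x' - y') \<in> G"
  using rel_add[OF _ rel_minus] by fastforce

text \<open>Subtraction transfers single-valuedness from 0, where \<open>k_subring_rel\<close>
  demands it, to every point.\<close>

lemma rel_unique: "(x, y) \<in> G \<Longrightarrow> (x, z) \<in> G \<Longrightarrow> y = z"
  using rel_diff[of x y x z] rel_zeroD by fastforce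

lemma rel_sum: "(\<And>i. i \<in> I \<Longrightarrow> (f i, g i) \<in> G) \<Longrightarrow> (sum f I, sum g I) \<in> G"
  by (induction I rule: infinite_finite_induct) (auto intro: rel_0 rel_add)

lemma rel_poly: "(\<And>i. (Polynomial.coeff p i, Polynomial.coeff q i) \<in> G) \<Longrightarrow> (x, y) \<in> G \<Longrightarrow>
    (poly p x, poly q y) \<in> G"
proof (induction p q rule: poly_induct2)
  case 0
  then show ?case by (simp add: rel_0)
next
  case (pCons a p b q)
  have "(a, b) \<in> G" using pCons.prems(1)[of 0] by simp
  moreover have "(Polynomial.coeff p i, Polynomial.coeff q i) \<in> G" for i
    using pCons.prems(1)[of "Suc i"] by simp
  ultimately show ?case using pCons by (auto intro!: rel_add rel_mult)
qed

text \<open>The domain of \<open>G\<close> is only required to be a ring, but its elements are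
  algebraic over k: a polynomial relation for \<open>c\<close> with nonzero constant term exhibits
  \<open>inverse c\<close> as a polynomial in \<open>c\<close> over k.\<close>

lemma rel_inverse:
  assumes "(c, c') \<in> G" "c \<noteq> 0"
  shows "\<exists>z. (inverse c, z) \<in> G"
proof -
  obtain p where p: "p \<noteq> 0" "poly (map_poly to_ac p) c = 0"
    using alg_closure_algebraic by blast
  have "\<exists>z. (inverse c, z) \<in> G" if "p \<noteq> 0" "poly (map_poly to_ac p) c = 0" for p :: "'a poly"
    using that
  proof (induction p)
    case 0
    then show ?case by simp
  next
    case (pCons a p)
    show ?case
    proof (cases "a = 0")
      \<comment> \<open>A zero constant term is removed by dividing the relation by
        \<open>c\<close>.\<close>
      case True
      then show ?thesis using pCons assms by (auto simp: map_poly_pCons)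
    next
      case False
      let ?r = "map_poly to_ac p"
      have "to_ac a + c * poly ?r c = 0"
        using pCons.prems by (simp add: map_poly_pCons)
      then have "c * poly ?r c = - to_ac a" by (simp add: eq_neg_iff_add_eq_0 add.commute)
      then have "to_ac (- inverse a) * (c * poly ?r c) = 1" using False by simp
      then have "c * (to_ac (- inverse a) * poly ?r c) = 1" by (simp only: mult.left_commute)
      then have "inverse c = to_ac (- inverse a) * poly ?r c"
        by (rule inverse_unique)
      moreover have "(to_ac (- inverse a) * poly ?r c, to_ac (- inverse a) * poly ?r c') \<in> G"
        using assms by (intro rel_mult rel_to_ac rel_poly) (auto simp: coeff_map_poly rel_to_ac)
      ultimately show ?thesis by metis
    qed
  qed
  then show ?thesis using p by blast
qed

text \<open>\<open>q\<close> is an image of \<open>p\<close> under the partial homomorphism applied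
  to the coefficients, so this is the graph of the extension of \<open>G\<close> that sends
  \<open>x\<close> to \<open>y\<close>; it is a homomorphism only for suitable
  \<open>y\<close>.\<close>

definition adjoin_rel :: "'a alg_closure \<Rightarrow> 'a alg_closure \<Rightarrow> ('a alg_closure \<times> 'a alg_closure) set" where
  "adjoin_rel x y = {(poly p x, poly q y) | p q. \<forall>i. (Polynomial.coeff p i, Polynomial.coeff q i) \<in> G}"

text \<open>The element \<open>y\<close> is a root of the image of the minimal polynomial of
  \<open>x\<close> over the domain of \<open>G\<close>. The one condition with content is that p(x)
  = 0 forces q(y) = 0 for related \<open>p\<close> and \<open>q\<close>; it follows by division by
  the minimal polynomial, carried out on both sides at once.\<close>

lemma k_subring_rel_adjoin:
  "\<exists>y. k_subring_rel (adjoin_rel x y)"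
proof -
  define R where "R p q \<longleftrightarrow> (\<forall>i. (Polynomial.coeff p i, Polynomial.coeff q i) \<in> G)" for p q
  have R_add: "R (p + p') (q + q')" and R_diff: "R (p - p') (q - q')" and R_mult: "R (p * p') (q * q')"
    if "R p q" "R p' q'" for p q p' q'
    using that by (auto simp: R_def coeff_mult intro!: rel_add rel_diff rel_mult rel_sum)
  have R_const: "R [:a:] [:b:]" and R_monom: "R (Polynomial.monom a n) (Polynomial.monom b n)"
    if "(a, b) \<in> G" for a b n
    using that by (auto simp: R_def coeff_pCons rel_0 split: nat.split)
  have R_0: "q = 0" if "R 0 q" for q
    using that rel_zeroD by (auto simp: R_def intro!: poly_eqI)
  obtain f where f: "f \<noteq> 0" "poly (map_poly to_ac f) x = 0"
    using alg_closure_algebraic by blast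
  \<comment> \<open>The domain of \<open>G\<close> is not a type, so the minimal polynomial is
    obtained as an annihilating polynomial of least degree among those with a partner
    \<open>q\<close>.\<close>
  define P where "P d \<longleftrightarrow> (\<exists>p q. R p q \<and> p \<noteq> 0 \<and> poly p x = 0 \<and> Polynomial.degree p = d)" for d
  have "P (Polynomial.degree (map_poly to_ac f))"
    unfolding P_def R_def using f
    by (intro exI[of _ "map_poly to_ac f"]) (auto simp: coeff_map_poly rel_to_ac map_poly_eq_0_iff)
  then have "P (LEAST d. P d)" by (rule LeastI)
  moreover have least: "\<not> P d" if "d < (LEAST d. P d)" for d
    using that by (rule not_less_Least)
  ultimately obtain m0 m0' where m0: "R m0 m0'" "m0 \<noteq> 0" "poly m0 x = 0"
      "Polynomial.degree m0 = (LEAST d. P d)"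
    unfolding P_def by blast
  obtain z where z: "(inverse (Polynomial.lead_coeff m0), z) \<in> G"
    using rel_inverse[of "Polynomial.lead_coeff m0" "Polynomial.coeff m0' (Polynomial.degree m0)"] m0(1,2)
    by (auto simp: R_def)
  define m m' where "m = [:inverse (Polynomial.lead_coeff m0):] * m0" and "m' = [:z:] * m0'"
  have m: "R m m'" "poly m x = 0" "Polynomial.degree m = (LEAST d. P d)" "Polynomial.lead_coeff m = 1"
  proof -
    have nz: "Polynomial.lead_coeff m0 \<noteq> 0" using m0(2) by simp
    show "R m m'" unfolding m_def m'_def by (rule R_mult[OF R_const[OF z] m0(1)])
    show "poly m x = 0" using m0(3) by (simp add: m_def)
    have "m = Polynomial.smult (inverse (Polynomial.lead_coeff m0)) m0" by (simp add: m_def)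
    then show "Polynomial.degree m = (LEAST d. P d)" "Polynomial.lead_coeff m = 1"
      using nz m0(4)[symmetric] by (simp_all add: degree_smult_eq)
  qed
  have "Polynomial.degree m > 0"
  proof (rule ccontr)
    assume "\<not> ?thesis"
    then have "m = 1" using m(4) by (auto elim!: degree_eq_zeroE simp: one_pCons)
    then show False using m(2) by simp
  qed
  \<comment> \<open>The leading coefficient 1 must be related to 1; hence \<open>m'\<close> is not
    constant and has a root in the closure.\<close>
  moreover have c1: "Polynomial.coeff m' (Polynomial.degree m) = 1"
    using m(1,4) rel_1 rel_unique unfolding R_def by metis
  ultimately have "Polynomial.degree m' > 0"
    by (metis gr_zeroI le_degree le_zero_eq zero_neq_one)
  then obtain y where y: "poly m' y = 0"
    using alg_closed_imp_poly_has_root by blast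
  have zero: "poly q y = 0" if "R p q" "poly p x = 0" for p q
    using that
  proof (induction "Polynomial.degree p" arbitrary: p q rule: less_induct)
    case less
    show ?case
    proof (cases "p = 0")
      case True
      then have "q = 0" using R_0 less.prems(1) by simp
      then show ?thesis by simp
    next
      case False
      define d where "d = Polynomial.degree p - Polynomial.degree m"
      have "\<not> Polynomial.degree p < (LEAST d. P d)"
      proof
        assume "Polynomial.degree p < (LEAST d. P d)"
        then have "\<not> P (Polynomial.degree p)" by (rule least)
        then show False using False less.prems unfolding P_def by blast
      qed
      then have le: "Polynomial.degree p = d + Polynomial.degree m"
        using m(3) by (simp add: d_def)
      \<comment> \<open>One step of long division: \<open>g * m\<close> cancels the leading term of
        \<open>p\<close>, and \<open>g' * m'\<close> vanishes at \<open>y\<close>, so the value to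
        be computed does not change.\<close>
      define g where "g = Polynomial.monom (Polynomial.lead_coeff p) d"
      define g' where "g' = Polynomial.monom (Polynomial.coeff q (Polynomial.degree p)) d"
      have "R g g'" unfolding g_def g'_def
        using less.prems(1) by (intro R_monom) (auto simp: R_def)
      then have R': "R (p - g * m) (q - g' * m')"
        using R_diff R_mult less.prems m by blast
      have px: "poly (p - g * m) x = 0" using less.prems m by simp
      have qy: "poly (q - g' * m') y = poly q y" using y by simp
      show ?thesis
      proof (cases "p - g * m = 0")
        case True
        then show ?thesis using R' R_0 qy by fastforce
      next
        case nz: False
        have lc: "Polynomial.lead_coeff p \<noteq> 0" using False by simp
        then have g: "g \<noteq> 0" "Polynomial.degree g = d" "Polynomial.lead_coeff g = Polynomial.lead_coeff p"
          by (auto simp: g_def degree_monom_eq)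
        have "m \<noteq> 0" using m(4) by auto
        then have "Polynomial.degree (g * m) = Polynomial.degree p"
          using le g by (simp add: degree_mult_eq)
        moreover have "Polynomial.lead_coeff (g * m) = Polynomial.lead_coeff p"
          using m(4) g(3) unfolding lead_coeff_mult by simp
        ultimately have "Polynomial.degree (p - g * m) < Polynomial.degree p"
          using nz by (intro degree_diff_less_same_lead_coeff)
        then show ?thesis using less.hyps[OF _ R' px] qy by simp
      qed
    qed
  qed
  have "k_subring_rel (adjoin_rel x y)"
    unfolding k_subring_rel_def
  proof (intro conjI allI impI)
    fix a
    show "(to_ac a, to_ac a) \<in> adjoin_rel x y"
      unfolding adjoin_rel_def R_def[symmetric]
      using R_const[OF rel_to_ac[of a]] by force
  next
    fix u u' v v' assume "(u, u') \<in> adjoin_rel x y" "(v, v') \<in> adjoin_rel x y"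
    then obtain p q p' q' where *: "R p q" "R p' q'" "u = poly p x" "u' = poly q y"
      "v = poly p' x" "v' = poly q' y"
      unfolding adjoin_rel_def R_def[symmetric] by auto
    show "(u + v, u' + v') \<in> adjoin_rel x y"
      unfolding adjoin_rel_def R_def[symmetric] using R_add[OF *(1,2)] *
      by (metis (mono_tags, lifting) mem_Collect_eq poly_add)
    show "(u * v, u' * v') \<in> adjoin_rel x y"
      unfolding adjoin_rel_def R_def[symmetric] using R_mult[OF *(1,2)] *
      by (metis (mono_tags, lifting) mem_Collect_eq poly_mult)
  next
    fix v assume "(0, v) \<in> adjoin_rel x y"
    then show "v = 0"
      unfolding adjoin_rel_def R_def[symmetric] using zero by auto
  qed
  then show ?thesis ..
qed

lemma adjoin_rel_supset: "G \<subseteq> adjoin_rel x y"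
proof
  fix z assume "z \<in> G"
  then have "(poly [:fst z:] x, poly [:snd z:] y) \<in> adjoin_rel x y"
    unfolding adjoin_rel_def
    by (intro CollectI exI[of _ "[:fst z:]"] exI[of _ "[:snd z:]"])
       (auto simp: coeff_pCons rel_0 split: nat.split)
  then show "z \<in> adjoin_rel x y" by simp
qed

lemma mem_adjoin_rel: "(x, y) \<in> adjoin_rel x y"
proof -
  have "(poly [:0, 1:] x, poly [:0, 1:] y) \<in> adjoin_rel x y"
    unfolding adjoin_rel_def
    by (intro CollectI exI[of _ "[:0, 1:]"] conjI refl)
       (auto simp: coeff_pCons rel_0 rel_1 split: nat.split)
  then show ?thesis by simp
qed

end

text \<open>Every \<open>y\<close> lies in the finite root set of some polynomial over k. An
  injective k-endomorphism maps this set into itself, hence onto itself.\<close>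

lemma k_endomorphism_surj:
  fixes h :: "'a::field alg_closure \<Rightarrow> 'a alg_closure"
  assumes add: "\<And>x y. h (x + y) = h x + h y" and mult: "\<And>x y. h (x * y) = h x * h y"
    and k: "\<And>a. h (to_ac a) = to_ac a" and inj: "inj h"
  shows "surj h"
proof -
  have "y \<in> range h" for y
  proof -
    obtain p :: "'a poly" where p: "p \<noteq> 0" "poly (map_poly to_ac p) y = 0"
      using alg_closure_algebraic by blast
    let ?Z = "{x. poly (map_poly to_ac p) x = 0}"
    have "h 0 = 0" using k[of 0] by simp
    have "h (poly (map_poly to_ac q) x) = poly (map_poly to_ac q) (h x)" for q x
      by (induction q) (auto simp: map_poly_pCons add mult k \<open>h 0 = 0\<close>)
    then have "h ` ?Z \<subseteq> ?Z" using \<open>h 0 = 0\<close> by auto (metis)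
    moreover have "finite ?Z"
      using p by (intro poly_roots_finite) (auto simp: map_poly_eq_0_iff)
    ultimately have "h ` ?Z = ?Z"
      using inj by (meson card_subset_eq card_image finite_imageI inj_on_subset subset_UNIV)
    then show ?thesis using p by auto
  qed
  then show ?thesis by auto
qed

text \<open>A graph that is maximal by Zorn's lemma is defined at every \<open>x\<close>, since
  \<open>adjoin_rel\<close> would otherwise enlarge it. It is therefore the graph of an endomorphism
  of the closure, which is injective because its domain is a field and surjective by
  algebraicity.\<close>

theorem extend_to_galois_group:
  fixes G :: "('a::field alg_closure \<times> 'a alg_closure) set"
  assumes "k_subring_rel G"
  obtains \<sigma> where "\<sigma> \<in> carrier abs_galois_group" "\<And>x y. (x, y) \<in> G \<Longrightarrow> \<sigma> x = y"
proof -
  let ?A = "{H. k_subring_rel H \<and> G \<subseteq> H}"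
  have "\<exists>M\<in>?A. \<forall>Y\<in>?A. M \<subseteq> Y \<longrightarrow> Y = M"
  proof (rule subset_Zorn_nonempty)
    show "?A \<noteq> {}" using assms by auto
    fix C assume C: "C \<noteq> {}" "subset.chain ?A C"
    then obtain H0 where H0: "H0 \<in> C" by auto
    have sub: "k_subring_rel H" "G \<subseteq> H" if "H \<in> C" for H
      using C that by (auto simp: subset.chain_def)
    have common: "\<exists>H\<in>C. a \<in> H \<and> b \<in> H" if "a \<in> \<Union>C" "b \<in> \<Union>C" for a b
    proof -
      from \<open>a \<in> \<Union>C\<close> \<open>b \<in> \<Union>C\<close>
      obtain H H' where *: "H \<in> C" "a \<in> H" "H' \<in> C" "b \<in> H'" by blast
      have "H \<subseteq> H' \<or> H' \<subseteq> H" using C(2) *(1,3) unfolding subset_chain_def by blast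
      then show ?thesis using * by blast
    qed
    have "k_subring_rel (\<Union>C)"
      unfolding k_subring_rel_def
    proof (intro conjI allI impI)
      fix a show "(to_ac a, to_ac a) \<in> \<Union>C" using H0 sub(1) by (auto intro: rel_to_ac)
    next
      fix x x' y y' assume "(x, x') \<in> \<Union>C" "(y, y') \<in> \<Union>C"
      then obtain H where "H \<in> C" "(x, x') \<in> H" "(y, y') \<in> H" using common by blast
      then show "(x + y, x' + y') \<in> \<Union>C" "(x * y, x' * y') \<in> \<Union>C"
        using sub(1) by (auto intro: rel_add rel_mult)
    next
      fix y assume "(0, y) \<in> \<Union>C"
      then show "y = 0" using sub(1) rel_zeroD by blast
    qed
    then show "\<Union>C \<in> ?A" using H0 sub(2) by auto
  qed
  then obtain M where M0: "M \<in> ?A" "\<forall>Y\<in>?A. M \<subseteq> Y \<longrightarrow> Y = M" by (elim bexE)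
  then have M: "k_subring_rel M" "G \<subseteq> M" by simp_all
  have maximal: "Y = M" if "k_subring_rel Y" "M \<subseteq> Y" for Y
    using M0 that M(2) by simp
  have total: "\<exists>y. (x, y) \<in> M" for x
  proof -
    obtain y where "k_subring_rel (adjoin_rel M x y)" using k_subring_rel_adjoin[OF M(1)] by blast
    then have "adjoin_rel M x y = M" using maximal adjoin_rel_supset[OF M(1)] by blast
    then show ?thesis using mem_adjoin_rel[OF M(1)] by blast
  qed
  then obtain \<sigma> where \<sigma>: "\<And>x. (x, \<sigma> x) \<in> M" by metis
  have eq: "\<sigma> x = y" if "(x, y) \<in> M" for x y
    using rel_unique[OF M(1) \<sigma> that] .
  have add: "\<sigma> (x + y) = \<sigma> x + \<sigma> y" and mult: "\<sigma> (x * y) = \<sigma> x * \<sigma> y" for x y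
    using \<sigma> eq rel_add[OF M(1)] rel_mult[OF M(1)] by blast+
  have k: "\<sigma> (to_ac a) = to_ac a" for a using eq rel_to_ac[OF M(1)] by blast
  have "inj \<sigma>"
  proof (rule injI)
    fix x y assume xy: "\<sigma> x = \<sigma> y"
    show "x = y"
    proof (rule ccontr)
      assume "x \<noteq> y"
      then have "\<sigma> ((x - y) * inverse (x - y)) = 1" using k[of 1] by simp
      moreover have "\<sigma> (x - y) + \<sigma> y = \<sigma> x" using add[of "x - y" y] by simp
      ultimately show False using xy mult by simp
    qed
  qed
  moreover from this have "surj \<sigma>" using add mult k by (intro k_endomorphism_surj)
  ultimately have "\<sigma> \<in> carrier abs_galois_group"
    using add mult k k[of 1] by (auto simp: mem_abs_galois_group bij_def)
  then show ?thesis using that eq M(2) by blast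
qed

text \<open>The graph of a + b s \<mapsto> a - b s is extended to the whole closure. That
  \<open>s\<close> is not in k makes this map well defined: a + b s = 0 then forces b = 0.\<close>

lemma galois_moves_sqrt:
  fixes u :: "'a::field" and s :: "'a alg_closure"
  assumes s: "s ^ 2 = to_ac u" and nk: "s \<notin> range to_ac"
  obtains \<sigma> where "\<sigma> \<in> carrier abs_galois_group" "\<sigma> s = - s"
proof -
  let ?G = "{(to_ac a + to_ac b * s, to_ac a - to_ac b * s) | a b. True}"
  have ss: "s * s = to_ac u" using s by (simp add: power2_eq_square)
  have "k_subring_rel ?G"
    unfolding k_subring_rel_def
  proof (intro conjI allI impI)
    fix a show "(to_ac a, to_ac a) \<in> ?G"
      by (intro CollectI exI[of _ a] exI[of _ 0]) auto
  next
    fix x x' y y' assume "(x, x') \<in> ?G" "(y, y') \<in> ?G"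
    then obtain a b c d where *: "x = to_ac a + to_ac b * s" "x' = to_ac a - to_ac b * s"
      "y = to_ac c + to_ac d * s" "y' = to_ac c - to_ac d * s" by blast
    show "(x + y, x' + y') \<in> ?G"
      by (intro CollectI exI[of _ "a + c"] exI[of _ "b + d"]) (auto simp: * algebra_simps)
    show "(x * y, x' * y') \<in> ?G"
      by (intro CollectI exI[of _ "a * c + b * d * u"] exI[of _ "a * d + b * c"])
         (auto simp: * algebra_simps ss[symmetric])
  next
    fix y assume "(0, y) \<in> ?G"
    then obtain a b where *: "0 = to_ac a + to_ac b * s" "y = to_ac a - to_ac b * s" by blast
    have "b = 0"
    proof (rule ccontr)
      assume "b \<noteq> 0"
      then have "s = to_ac (- a / b)" using *(1)
        by (simp add: field_simps eq_neg_iff_add_eq_0)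
      then show False using nk by blast
    qed
    then show "y = 0" using * by simp
  qed
  then obtain \<sigma> where \<sigma>: "\<sigma> \<in> carrier abs_galois_group" "\<And>x y. (x, y) \<in> ?G \<Longrightarrow> \<sigma> x = y"
    by (rule extend_to_galois_group) blast
  moreover have "(s, - s) \<in> ?G" by (intro CollectI exI[of _ 0] exI[of _ 1]) auto
  ultimately show ?thesis using that by blast
qed

section \<open>Hilbert 90 and quadratic characters\<close>

lemma subfield_closure_ring:
  fixes L :: "'a::field alg_closure set"
  assumes "subfield L closure_ring"
  shows "1 \<in> L" "x \<in> L \<Longrightarrow> y \<in> L \<Longrightarrow> x + y \<in> L" "x \<in> L \<Longrightarrow> y \<in> L \<Longrightarrow> x * y \<in> L"
proof -
  interpret ring "closure_ring :: 'a alg_closure ring" by (rule ring_from_type_algebra)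
  have s: "subring L closure_ring" using assms by (rule subfieldE(1))
  show "1 \<in> L" "x \<in> L \<Longrightarrow> y \<in> L \<Longrightarrow> x + y \<in> L" "x \<in> L \<Longrightarrow> y \<in> L \<Longrightarrow> x * y \<in> L"
    using subringE(3)[OF s] subringE(7)[OF s] subringE(6)[OF s]
    by (auto simp: ring_of_type_algebra_def)
qed

section \<open>Arithmetic of Galois automorphisms\<close>

lemma galois_facts:
  fixes \<sigma> :: "'a::field alg_closure \<Rightarrow> 'a alg_closure"
  assumes "\<sigma> \<in> carrier abs_galois_group"
  shows galois_bij: "bij \<sigma>" and galois_add: "\<sigma> (x + y) = \<sigma> x + \<sigma> y"
    and galois_mult: "\<sigma> (x * y) = \<sigma> x * \<sigma> y" and galois_to_ac: "\<sigma> (to_ac a) = to_ac a"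
    and galois_1: "\<sigma> 1 = 1"
  using assms by (auto simp: mem_abs_galois_group)

lemma galois_0: "\<sigma> \<in> carrier abs_galois_group \<Longrightarrow> \<sigma> 0 = 0"
  using galois_to_ac[of \<sigma> 0] by simp

lemma galois_minus: "\<sigma> \<in> carrier abs_galois_group \<Longrightarrow> \<sigma> (- x) = - \<sigma> x"
  using galois_add[of \<sigma> x "- x"] galois_0[of \<sigma>] by (simp add: eq_neg_iff_add_eq_0 add.commute)

lemma galois_diff: "\<sigma> \<in> carrier abs_galois_group \<Longrightarrow> \<sigma> (x - y) = \<sigma> x - \<sigma> y"
  using galois_add[of \<sigma> x "- y"] galois_minus[of \<sigma> y] by simp

lemma galois_power: "\<sigma> \<in> carrier abs_galois_group \<Longrightarrow> \<sigma> (x ^ n) = \<sigma> x ^ n"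
  by (induction n) (auto simp: galois_1 galois_mult)

lemma galois_sum: "\<sigma> \<in> carrier abs_galois_group \<Longrightarrow> \<sigma> (sum f A) = (\<Sum>x\<in>A. \<sigma> (f x))"
  by (induction A rule: infinite_finite_induct) (auto simp: galois_0 galois_add)

lemma galois_eq_0_iff: "\<sigma> \<in> carrier abs_galois_group \<Longrightarrow> \<sigma> x = 0 \<longleftrightarrow> x = 0"
  using galois_bij[of \<sigma>] galois_0[of \<sigma>] by (metis bij_pointE)

lemma galois_divide:
  assumes "\<sigma> \<in> carrier abs_galois_group" shows "\<sigma> (x / y) = \<sigma> x / \<sigma> y"
proof (cases "y = 0")
  case True
  then show ?thesis using galois_0[OF assms] by simp
next
  case False
  have "\<sigma> (x / y) * \<sigma> y = \<sigma> x" using False by (simp flip: galois_mult[OF assms])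
  then show ?thesis using False galois_eq_0_iff[OF assms, of y] by (simp add: field_simps)
qed

lemma galois_comp:
  "\<sigma> \<in> carrier abs_galois_group \<Longrightarrow> \<tau> \<in> carrier abs_galois_group \<Longrightarrow> \<sigma> \<circ> \<tau> \<in> carrier abs_galois_group"
  by (auto simp: mem_abs_galois_group intro: bij_comp)

lemma galois_inv:
  assumes "\<sigma> \<in> carrier abs_galois_group" shows "inv_into UNIV \<sigma> \<in> carrier abs_galois_group"
proof -
  have b: "bij \<sigma>" using galois_bij[OF assms] .
  have eq: "inv_into UNIV \<sigma> y = x" if "y = \<sigma> x" for x y using b that by (simp add: bij_is_inj)
  have s: "\<sigma> (inv_into UNIV \<sigma> x) = x" for x using b by (simp add: bij_is_surj surj_f_inv_f)
  show ?thesis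
    unfolding mem_abs_galois_group
    using b by (auto intro!: eq bij_imp_bij_inv simp: galois_add[OF assms] galois_mult[OF assms]
        galois_1[OF assms] galois_to_ac[OF assms] s)
qed

text \<open>The last clause says that \<open>S\<close> spans \<open>L\<close> over k. Phrased as an
  induction rule, it shows that two automorphisms agreeing on \<open>S\<close> agree on
  \<open>L\<close> without any choice of coordinates.\<close>

lemma finite_dimension_span:
  fixes L :: "'a::field alg_closure set"
  assumes "ring.finite_dimension closure_ring (range to_ac) L"
  shows "\<exists>S. finite S \<and> S \<subseteq> L \<and> 0 \<in> L \<and>
    (\<forall>P. P 0 \<longrightarrow> (\<forall>c. \<forall>v\<in>S. \<forall>x. P x \<longrightarrow> P (to_ac c * v + x)) \<longrightarrow> (\<forall>x\<in>L. P x))"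
proof -
  interpret R: ring "closure_ring :: 'a alg_closure ring" by (rule ring_from_type_algebra)
  obtain n where "R.dimension n (range to_ac) L" using assms by (auto simp: R.finite_dimension_def)
  then show ?thesis
  proof (induction n "range (to_ac :: 'a \<Rightarrow> _)" L rule: R.dimension.induct)
    case zero_dim
    then show ?case by (intro exI[of _ "{}"]) (auto simp: ring_of_type_algebra_def)
  next
    case (Suc_dim v E n)
    then obtain S where S: "finite S" "S \<subseteq> E" "0 \<in> E"
      "\<And>P. P 0 \<Longrightarrow> (\<And>c v x. v \<in> S \<Longrightarrow> P x \<Longrightarrow> P (to_ac c * v + x)) \<Longrightarrow> \<forall>x\<in>E. P x"
      by metis
    have ext: "R.line_extension (range to_ac) v E = {to_ac c * v + x | c x. x \<in> E}"
      unfolding R.line_extension_def r_coset_def set_add_def set_mult_def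
      by (auto simp: ring_of_type_algebra_def)
    have vE: "v \<in> R.line_extension (range to_ac) v E" and sub: "E \<subseteq> R.line_extension (range to_ac) v E"
    proof -
      show "v \<in> R.line_extension (range to_ac) v E"
        unfolding ext using S(3) by (intro CollectI exI[of _ 1] exI[of _ 0]) auto
      show "E \<subseteq> R.line_extension (range to_ac) v E"
      proof
        fix x assume "x \<in> E"
        then show "x \<in> R.line_extension (range to_ac) v E"
          unfolding ext by (intro CollectI exI[of _ 0] exI[of _ x]) auto
      qed
    qed
    show ?case
    proof (intro exI[of _ "insert v S"] conjI allI impI)
      show "finite (insert v S)" using S by simp
      show "insert v S \<subseteq> R.line_extension (range to_ac) v E" using vE sub S(2) by blast
      show "0 \<in> R.line_extension (range to_ac) v E" using sub S(3) by blast
    next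
      fix P :: "'a alg_closure \<Rightarrow> bool"
      assume "P 0" and *: "\<forall>c. \<forall>w\<in>insert v S. \<forall>x. P x \<longrightarrow> P (to_ac c * w + x)"
      then have "\<forall>x\<in>E. P x" by (intro S(4)) auto
      then show "\<forall>x\<in>R.line_extension (range to_ac) v E. P x" unfolding ext using * by auto
    qed
  qed
qed

lemma galois_orbit_finite:
  fixes v :: "'a::field alg_closure"
  shows "finite {\<sigma> v | \<sigma>. \<sigma> \<in> carrier abs_galois_group}"
proof -
  obtain p :: "'a poly" where p: "p \<noteq> 0" "poly (map_poly to_ac p) v = 0"
    using alg_closure_algebraic by blast
  have "poly (map_poly to_ac p) (\<sigma> v) = 0" if \<sigma>: "\<sigma> \<in> carrier abs_galois_group" for \<sigma>
  proof -
    have "\<sigma> (poly (map_poly to_ac q) x) = poly (map_poly to_ac q) (\<sigma> x)" for q x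
      by (induction q)
         (auto simp: map_poly_pCons galois_0[OF \<sigma>] galois_add[OF \<sigma>] galois_mult[OF \<sigma>] galois_to_ac[OF \<sigma>])
    then show ?thesis using p(2) galois_0[OF \<sigma>] by metis
  qed
  then have "{\<sigma> v | \<sigma>. \<sigma> \<in> carrier abs_galois_group} \<subseteq> {x. poly (map_poly to_ac p) x = 0}" by auto
  moreover have "finite {x. poly (map_poly to_ac p) x = 0}"
    using p by (intro poly_roots_finite) (auto simp: map_poly_eq_0_iff)
  ultimately show ?thesis by (rule finite_subset)
qed

text \<open>Subtracting \<rho>0(y) times the relation at x from the relation at x y cancels the term
  of \<rho>0, so the induction hypothesis applies to the coefficients
  \<open>(\<rho> y - \<rho>0 y) * c \<rho>\<close>. Since the characters are extensional on
  \<open>L\<close>, two different ones are separated by some y in \<open>L\<close>.\<close>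

lemma dedekind_independence:
  fixes c :: "('b::monoid_mult \<Rightarrow> 'd::field) \<Rightarrow> 'd"
  assumes "finite S"
    and "1 \<in> L" "\<And>x y. x \<in> L \<Longrightarrow> y \<in> L \<Longrightarrow> x * y \<in> L"
    and "\<And>\<rho>. \<rho> \<in> S \<Longrightarrow> \<rho> \<in> extensional L" "\<And>\<rho>. \<rho> \<in> S \<Longrightarrow> \<rho> 1 = 1"
    and "\<And>\<rho> x y. \<rho> \<in> S \<Longrightarrow> x \<in> L \<Longrightarrow> y \<in> L \<Longrightarrow> \<rho> (x * y) = \<rho> x * \<rho> y"
    and "\<And>x. x \<in> L \<Longrightarrow> (\<Sum>\<rho>\<in>S. \<rho> x * c \<rho>) = 0"
  shows "\<forall>\<rho>\<in>S. c \<rho> = 0"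
  using assms(1,4-7)
proof (induction S arbitrary: c rule: finite_induct)
  case empty
  then show ?case by simp
next
  case (insert \<rho>0 S)
  have rel: "\<rho>0 x * c \<rho>0 + (\<Sum>\<rho>\<in>S. \<rho> x * c \<rho>) = 0" if "x \<in> L" for x
    using insert.prems(4)[OF that] insert.hyps by simp
  have *: "\<forall>\<rho>\<in>S. (\<rho> y - \<rho>0 y) * c \<rho> = 0" if y: "y \<in> L" for y
  proof (rule insert.IH)
    fix x assume x: "x \<in> L"
    have "(\<Sum>\<rho>\<in>S. \<rho> x * ((\<rho> y - \<rho>0 y) * c \<rho>)) = (\<Sum>\<rho>\<in>S. \<rho> (x * y) * c \<rho>) - \<rho>0 y * (\<Sum>\<rho>\<in>S. \<rho> x * c \<rho>)"
      unfolding sum_distrib_left sum_subtractf[symmetric]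
      using insert.prems(3) x y by (intro sum.cong refl) (simp add: algebra_simps)
    also have "\<dots> = - (\<rho>0 (x * y) * c \<rho>0) + \<rho>0 y * (\<rho>0 x * c \<rho>0)"
      using rel[OF x] rel[of "x * y"] assms(3)[OF x y] by (simp add: add_eq_0_iff)
    also have "\<dots> = 0" using insert.prems(3)[OF insertI1 x y] by (simp only: mult.left_commute mult.assoc) simp
    finally show "(\<Sum>\<rho>\<in>S. \<rho> x * ((\<rho> y - \<rho>0 y) * c \<rho>)) = 0" .
  qed (use insert.prems in auto)
  have S0: "c \<rho> = 0" if "\<rho> \<in> S" for \<rho>
  proof -
    have "\<rho> \<noteq> \<rho>0" using that insert.hyps by auto
    then obtain y where "y \<in> L" "\<rho> y \<noteq> \<rho>0 y"
      using extensionalityI[of \<rho> L \<rho>0] insert.prems(1)[of \<rho>] insert.prems(1)[of \<rho>0] \<open>\<rho> \<in> S\<close> by blast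
    then show ?thesis using *[of y] that by auto
  qed
  then have "c \<rho>0 = 0" using rel[OF assms(2)] insert.prems(2)[of \<rho>0] by simp
  then show ?case using S0 by auto
qed

text \<open>This is Gal(L/k) as a set of extensional functions: equality of its elements is
  agreement on \<open>L\<close>, which makes the set finite and its elements independent
  characters.\<close>

definition restrictions :: "'a::field alg_closure set \<Rightarrow> ('a alg_closure \<Rightarrow> 'a alg_closure) set" where
  "restrictions L = (\<lambda>\<sigma>. restrict \<sigma> L) ` carrier abs_galois_group"

lemma restrict_mem_restrictions: "\<sigma> \<in> carrier abs_galois_group \<Longrightarrow> restrict \<sigma> L \<in> restrictions L"
  unfolding restrictions_def by (rule imageI)

text \<open>Resolvents sum over Gal(L/k), while the coefficients are given on automorphisms of the
  closure. The choice of a lift is harmless for coefficients satisfying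
  \<open>factors_through\<close>.\<close>

definition galois_ext :: "'a::field alg_closure set \<Rightarrow> ('a alg_closure \<Rightarrow> 'a alg_closure) \<Rightarrow>
    'a alg_closure \<Rightarrow> 'a alg_closure" where
  "galois_ext L \<rho> = (SOME \<sigma>. \<sigma> \<in> carrier abs_galois_group \<and> restrict \<sigma> L = \<rho>)"

text \<open>The resolvent \<open>\<Sum>\<rho>\<in>Gal(L/k). \<rho>(x) B(\<rho>)\<close> of Hilbert 90.\<close>

definition twisted_trace :: "'a::field alg_closure set \<Rightarrow>
    (('a alg_closure \<Rightarrow> 'a alg_closure) \<Rightarrow> 'a alg_closure) \<Rightarrow> 'a alg_closure \<Rightarrow> 'a alg_closure" where
  "twisted_trace L B x = (\<Sum>\<rho>\<in>restrictions L. \<rho> x * B (galois_ext L \<rho>))"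

definition factors_through :: "'a::field alg_closure set \<Rightarrow> (('a alg_closure \<Rightarrow> 'a alg_closure) \<Rightarrow> 'c) \<Rightarrow> bool" where
  "factors_through L B \<longleftrightarrow> (\<forall>\<sigma>\<in>carrier abs_galois_group. \<forall>\<tau>\<in>carrier abs_galois_group.
     (\<forall>x\<in>L. \<sigma> x = \<tau> x) \<longrightarrow> B \<sigma> = B \<tau>)"

lemma galois_ext:
  assumes "\<rho> \<in> restrictions L"
  shows "galois_ext L \<rho> \<in> carrier abs_galois_group" "restrict (galois_ext L \<rho>) L = \<rho>"
  using assms someI_ex[of "\<lambda>\<sigma>. \<sigma> \<in> carrier abs_galois_group \<and> restrict \<sigma> L = \<rho>"]
  unfolding restrictions_def galois_ext_def by auto

context
  fixes L :: "'a::field alg_closure set"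
  assumes L: "finite_galois_subextension L"
begin

lemma subextension_closed: "1 \<in> L" "x \<in> L \<Longrightarrow> y \<in> L \<Longrightarrow> x + y \<in> L" "x \<in> L \<Longrightarrow> y \<in> L \<Longrightarrow> x * y \<in> L"
  using L subfield_closure_ring unfolding finite_galois_subextension_def by blast+

text \<open>An automorphism is determined on \<open>L\<close> by its values on a finite spanning
  set, and each value is one of finitely many conjugates.\<close>

lemma finite_restrictions: "finite (restrictions L)"
proof -
  have "ring.finite_dimension closure_ring (range to_ac) L"
    using L by (simp add: finite_galois_subextension_def)
  from finite_dimension_span[OF this] obtain S where S: "finite S" "S \<subseteq> L"
    "\<forall>P. P 0 \<longrightarrow> (\<forall>c. \<forall>v\<in>S. \<forall>x. P x \<longrightarrow> P (to_ac c * v + x)) \<longrightarrow> (\<forall>x\<in>L. P x)"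
    by (elim exE conjE)
  let ?O = "\<lambda>v. {\<sigma> v | \<sigma>. \<sigma> \<in> carrier abs_galois_group}"
  let ?r = "\<lambda>\<rho>. restrict \<rho> S"
  have "?r ` restrictions L \<subseteq> PiE S ?O" using S(2) by (fastforce simp: restrictions_def)
  moreover have "finite (PiE S ?O)" using S(1) galois_orbit_finite by (intro finite_PiE)
  ultimately have "finite (?r ` restrictions L)" by (rule finite_subset)
  moreover have "inj_on ?r (restrictions L)"
  proof (rule inj_onI)
    fix \<rho> \<rho>' assume "\<rho> \<in> restrictions L" "\<rho>' \<in> restrictions L" and eq: "?r \<rho> = ?r \<rho>'"
    then obtain \<sigma> \<tau> where \<sigma>: "\<sigma> \<in> carrier abs_galois_group" "\<rho> = restrict \<sigma> L"
      and \<tau>: "\<tau> \<in> carrier abs_galois_group" "\<rho>' = restrict \<tau> L" by (auto simp: restrictions_def)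
    have eqS: "\<sigma> v = \<tau> v" if "v \<in> S" for v
      using eq that S(2) \<sigma>(2) \<tau>(2) by (metis (no_types, lifting) restrict_apply' subsetD)
    have "\<forall>x\<in>L. \<sigma> x = \<tau> x"
      by (rule S(3)[THEN spec, THEN mp, THEN mp]) (auto simp: eqS galois_0 galois_add galois_mult galois_to_ac \<sigma>(1) \<tau>(1))
    then show "\<rho> = \<rho>'" using \<sigma>(2) \<tau>(2) by auto
  qed
  ultimately show ?thesis by (rule finite_imageD)
qed

text \<open>If all resolvents vanished, the values of \<open>B\<close> would be the coefficients of
  a linear relation between distinct characters of \<open>L\<close>.\<close>

lemma twisted_trace_nonzero:
  assumes "factors_through L B" "\<tau> \<in> carrier abs_galois_group" "B \<tau> \<noteq> 0"
  shows "\<exists>x\<in>L. twisted_trace L B x \<noteq> 0"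
proof (rule ccontr)
  assume *: "\<not> ?thesis"
  have "\<forall>\<rho>\<in>restrictions L. B (galois_ext L \<rho>) = 0"
  proof (rule dedekind_independence[where L = L])
    show "\<And>x. x \<in> L \<Longrightarrow> (\<Sum>\<rho>\<in>restrictions L. \<rho> x * B (galois_ext L \<rho>)) = 0"
      using * by (auto simp: twisted_trace_def)
    show "finite (restrictions L)" by (rule finite_restrictions)
  qed (auto simp: subextension_closed restrictions_def galois_1 galois_mult)
  moreover have r: "restrict \<tau> L \<in> restrictions L" using assms(2) by (auto simp: restrictions_def)
  moreover have "B (galois_ext L (restrict \<tau> L)) = B \<tau>"
  proof -
    have "\<forall>x\<in>L. galois_ext L (restrict \<tau> L) x = \<tau> x"
      using galois_ext(2)[OF r] by (metis restrict_apply')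
    then show ?thesis using assms(1,2) galois_ext(1)[OF r] unfolding factors_through_def by blast
  qed
  ultimately show False using assms(3) by auto
qed

lemma twisted_trace_add: "x \<in> L \<Longrightarrow> y \<in> L \<Longrightarrow> twisted_trace L B (x + y) = twisted_trace L B x + twisted_trace L B y"
  unfolding twisted_trace_def sum.distrib[symmetric]
  by (intro sum.cong refl) (auto simp: restrictions_def subextension_closed galois_add algebra_simps)

text \<open>Left translation by \<sigma> permutes Gal(L/k), so applying \<sigma> only reindexes the
  sum. The second coefficient function \<open>B'\<close> leaves room for the factor by which a
  cocycle changes under translation.\<close>

lemma galois_twisted_trace:
  assumes B: "factors_through L B" and B': "factors_through L B'" and x: "x \<in> L"
    and \<sigma>: "\<sigma> \<in> carrier abs_galois_group"
    and eq: "\<And>\<tau>. \<tau> \<in> carrier abs_galois_group \<Longrightarrow> \<sigma> (B \<tau>) = B' (\<sigma> \<circ> \<tau>)"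
  shows "\<sigma> (twisted_trace L B x) = twisted_trace L B' x"
proof -
  let ?h = "\<lambda>\<rho>. restrict (\<sigma> \<circ> \<rho>) L"
  have h: "?h (restrict \<tau> L) = restrict (\<sigma> \<circ> \<tau>) L" for \<tau> by auto
  have inj: "inj \<sigma>" using galois_bij[OF \<sigma>] by (rule bij_is_inj)
  have "bij_betw ?h (restrictions L) (restrictions L)"
  proof (rule bij_betwI')
    fix \<rho> \<rho>' assume "\<rho> \<in> restrictions L" "\<rho>' \<in> restrictions L"
    then obtain \<tau> \<tau>' where *: "\<rho> = restrict \<tau> L" "\<rho>' = restrict \<tau>' L" by (auto simp: restrictions_def)
    show "?h \<rho> = ?h \<rho>' \<longleftrightarrow> \<rho> = \<rho>'"
    proof
      assume "?h \<rho> = ?h \<rho>'"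
      then have "\<sigma> (\<tau> y) = \<sigma> (\<tau>' y)" if "y \<in> L" for y
        unfolding * h using that by (metis comp_apply restrict_apply')
      then show "\<rho> = \<rho>'" using * inj by (auto simp: inj_eq intro!: restrict_ext)
    qed auto
  next
    fix \<rho> assume "\<rho> \<in> restrictions L"
    then obtain \<tau> where *: "\<tau> \<in> carrier abs_galois_group" "\<rho> = restrict \<tau> L" by (auto simp: restrictions_def)
    show "?h \<rho> \<in> restrictions L"
      unfolding *(2) h by (rule restrict_mem_restrictions[OF galois_comp[OF \<sigma> *(1)]])
  next
    fix \<rho> assume "\<rho> \<in> restrictions L"
    then obtain \<tau> where *: "\<tau> \<in> carrier abs_galois_group" "\<rho> = restrict \<tau> L" by (auto simp: restrictions_def)
    have "?h (restrict (inv_into UNIV \<sigma> \<circ> \<tau>) L) = \<rho>"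
      unfolding h * using galois_bij[OF \<sigma>] by (auto simp: bij_is_surj surj_f_inv_f intro!: restrict_ext)
    then show "\<exists>\<rho>'\<in>restrictions L. \<rho> = ?h \<rho>'"
      using restrict_mem_restrictions[OF galois_comp[OF galois_inv[OF \<sigma>] *(1)]] by (metis (no_types))
  qed
  then have "twisted_trace L B' x = (\<Sum>\<rho>\<in>restrictions L. ?h \<rho> x * B' (galois_ext L (?h \<rho>)))"
    unfolding twisted_trace_def by (rule sum.reindex_bij_betw[symmetric])
  also have "\<dots> = (\<Sum>\<rho>\<in>restrictions L. \<sigma> (\<rho> x * B (galois_ext L \<rho>)))"
  proof (rule sum.cong)
    fix \<rho> assume \<rho>: "\<rho> \<in> restrictions L"
    let ?\<tau> = "galois_ext L \<rho>"
    have \<tau>: "?\<tau> \<in> carrier abs_galois_group" "restrict ?\<tau> L = \<rho>" using galois_ext[OF \<rho>] .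
    have h\<rho>: "?h \<rho> = restrict (\<sigma> \<circ> ?\<tau>) L" using h[of ?\<tau>] \<tau>(2) by simp
    have "?h \<rho> \<in> restrictions L" unfolding h\<rho> by (rule restrict_mem_restrictions[OF galois_comp[OF \<sigma> \<tau>(1)]])
    note g = galois_ext[OF this]
    have "\<forall>y\<in>L. galois_ext L (?h \<rho>) y = (\<sigma> \<circ> ?\<tau>) y"
      using g(2) unfolding h\<rho> by (metis restrict_apply')
    then have "B' (galois_ext L (?h \<rho>)) = B' (\<sigma> \<circ> ?\<tau>)"
      using B' g(1) galois_comp[OF \<sigma> \<tau>(1)] unfolding factors_through_def by blast
    then show "?h \<rho> x * B' (galois_ext L (?h \<rho>)) = \<sigma> (\<rho> x * B (galois_ext L \<rho>))"
      using x eq[OF \<tau>(1)] by (simp add: galois_mult[OF \<sigma>])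
  qed auto
  also have "\<dots> = \<sigma> (twisted_trace L B x)" by (simp add: twisted_trace_def galois_sum[OF \<sigma>])
  finally show ?thesis ..
qed

end

text \<open>The elements a + b s form a ring; closure under inversion comes from the norm a^2 - b^2
  u.\<close>

lemma adjoin_sqrt_eq:
  fixes u :: "'a::field"
  assumes s: "s ^ 2 = to_ac u"
  shows "s \<in> adjoin_sqrt u" "x \<in> adjoin_sqrt u \<Longrightarrow> \<exists>a b. x = to_ac a + to_ac b * s"
proof -
  show "s \<in> adjoin_sqrt u" unfolding adjoin_sqrt_def using s by (auto intro: generate_field.incl)
  interpret F: field "closure_ring :: 'a alg_closure ring" by (rule field_from_type_algebra)
  have ss: "s * s = to_ac u" using s by (simp add: power2_eq_square)
  have incl: "\<exists>a b. to_ac c = to_ac a + to_ac b * s" for c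
    by (intro exI[of _ c] exI[of _ 0]) auto
  assume "x \<in> adjoin_sqrt u"
  then show "\<exists>a b. x = to_ac a + to_ac b * s"
    unfolding adjoin_sqrt_def
  proof (induction x rule: generate_field.induct)
    case one
    then show ?case using incl[of 1] by (simp add: ring_of_type_algebra_def)
  next
    case (incl h)
    show ?case
    proof (cases "h \<in> range to_ac")
      case True
      then show ?thesis using \<open>\<And>c. \<exists>a b. to_ac c = to_ac a + to_ac b * s\<close> by auto
    next
      case False
      then have "h ^ 2 = s ^ 2" using incl s by auto
      then have "h = s \<or> h = - s" by (simp add: power2_eq_iff)
      then have "h = to_ac 0 + to_ac 1 * s \<or> h = to_ac 0 + to_ac (- 1) * s" by auto
      then show ?thesis by blast
    qed
  next
    case (a_inv h)
    then obtain a b where "h = to_ac a + to_ac b * s" by blast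
    moreover have "\<ominus>\<^bsub>closure_ring\<^esub> h = - h"
      by (rule F.minus_equality) (auto simp: ring_of_type_algebra_def)
    ultimately have "\<ominus>\<^bsub>closure_ring\<^esub> h = to_ac (- a) + to_ac (- b) * s" by simp
    then show ?case by blast
  next
    case (m_inv h)
    then obtain a b where h: "h = to_ac a + to_ac b * s" by blast
    have "h \<noteq> 0" using m_inv by (simp add: ring_of_type_algebra_def)
    then have "inv\<^bsub>closure_ring\<^esub> h = inverse h"
      by (intro F.inv_unique'[symmetric]) (auto simp: ring_of_type_algebra_def)
    moreover have "\<exists>a b. inverse h = to_ac a + to_ac b * s"
    proof (cases "to_ac a - to_ac b * s = 0")
      \<comment> \<open>This can occur when \<open>s\<close> itself lies in k. The norm is then
        zero, but \<open>h\<close> is the element 2a of k.\<close>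
      case True
      then have "h = to_ac (2 * a)" using h by (simp add: algebra_simps)
      then have "inverse h = to_ac (inverse (2 * a))" by (simp only: to_ac_inverse)
      then show ?thesis using \<open>\<And>c. \<exists>a b. to_ac c = to_ac a + to_ac b * s\<close> by metis
    next
      case False
      define n where "n = a * a - b * b * u"
      have n: "to_ac n = h * (to_ac a - to_ac b * s)"
        by (simp add: n_def h algebra_simps flip: ss)
      then have "to_ac n \<noteq> 0" using False \<open>h \<noteq> 0\<close> by simp
      then have "inverse h = (to_ac a - to_ac b * s) / to_ac n"
        unfolding n using False \<open>h \<noteq> 0\<close> by (simp add: divide_simps)
      then have "inverse h = to_ac (a / n) + to_ac (- b / n) * s" by (simp add: diff_divide_distrib)
      then show ?thesis by blast
    qed
    ultimately show ?case by simp
  next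
    case (eng_add x y)
    then obtain a b c d where "x = to_ac a + to_ac b * s" "y = to_ac c + to_ac d * s" by blast
    then have "x \<oplus>\<^bsub>closure_ring\<^esub> y = to_ac (a + c) + to_ac (b + d) * s"
      by (simp add: ring_of_type_algebra_def algebra_simps)
    then show ?case by blast
  next
    case (eng_mult x y)
    then obtain a b c d where "x = to_ac a + to_ac b * s" "y = to_ac c + to_ac d * s" by blast
    then have "x \<otimes>\<^bsub>closure_ring\<^esub> y = to_ac (a * c + b * d * u) + to_ac (a * d + b * c) * s"
      by (simp add: ring_of_type_algebra_def algebra_simps flip: ss)
    then show ?case by blast
  qed
qed

lemma galois_sqrt:
  fixes u :: "'a::field"
  assumes "\<sigma> \<in> carrier abs_galois_group" "s ^ 2 = to_ac u"
  shows "\<sigma> s = s \<or> \<sigma> s = - s"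
proof -
  have "(\<sigma> s) ^ 2 = s ^ 2" using assms by (metis galois_power galois_to_ac)
  then show ?thesis by (simp add: power2_eq_iff)
qed

text \<open>
  A resolvent of the sign character is an eigenvector \<open>y\<close> of the Galois group in \<open>k(\<surd>u)\<close>, which
  forces \<open>\<surd>u\<close> to be moved by everything outside \<open>H\<close>.
\<close>

lemma quadratic_character:
  fixes u :: "'a::field" and H :: "('a alg_closure \<Rightarrow> 'a alg_closure) set"
  assumes two: "(2::'a) \<noteq> 0" and L: "finite_galois_subextension L"
    and H: "H \<subseteq> carrier abs_galois_group" "factors_through L (\<lambda>\<sigma>. \<sigma> \<in> H)"
    and hom: "\<And>\<sigma> \<tau>. \<sigma> \<in> carrier abs_galois_group \<Longrightarrow> \<tau> \<in> carrier abs_galois_group \<Longrightarrow>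
        \<sigma> \<circ> \<tau> \<in> H \<longleftrightarrow> (\<sigma> \<in> H \<longleftrightarrow> \<tau> \<in> H)"
    and fixd: "fixed_field H = adjoin_sqrt u" and s: "s ^ 2 = to_ac u" and \<sigma>: "\<sigma> \<in> carrier abs_galois_group"
  shows "\<sigma> s = (if \<sigma> \<in> H then s else - s)"
proof (cases "\<sigma> \<in> H")
  case True
  have "s \<in> fixed_field H" using adjoin_sqrt_eq(1)[OF s] fixd by simp
  then show ?thesis using True by (simp add: fixed_field_def)
next
  case False
  have two': "(2::'a alg_closure) \<noteq> 0" using two by (metis to_ac_eq_0_iff to_ac_numeral)
  \<comment> \<open>The sign character with kernel \<open>H\<close>; the assumption
    \<open>hom\<close> is its multiplicativity.\<close>
  define \<epsilon> :: "('a alg_closure \<Rightarrow> 'a alg_closure) \<Rightarrow> 'a alg_closure" where "\<epsilon> \<tau> = (if \<tau> \<in> H then 1 else - 1)" for \<tau>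
  have \<epsilon>: "factors_through L \<epsilon>" and \<epsilon>': "factors_through L (\<lambda>\<tau>. c * \<epsilon> \<tau>)" for c
    using H(2) unfolding factors_through_def \<epsilon>_def by metis+
  obtain x where x: "x \<in> L" "twisted_trace L \<epsilon> x \<noteq> 0"
    using twisted_trace_nonzero[OF L \<epsilon> \<sigma>] False \<epsilon>_def by auto
  define y where "y = twisted_trace L \<epsilon> x"
  have y: "\<tau> y = \<epsilon> \<tau> * y" if \<tau>: "\<tau> \<in> carrier abs_galois_group" for \<tau>
  proof -
    have "\<tau> y = twisted_trace L (\<lambda>\<tau>'. \<epsilon> \<tau> * \<epsilon> \<tau>') x"
      unfolding y_def using \<tau>
      by (intro galois_twisted_trace[OF L \<epsilon> \<epsilon>' x(1)])
         (auto simp: \<epsilon>_def hom galois_1 galois_minus)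
    also have "\<dots> = \<epsilon> \<tau> * y" by (simp add: y_def twisted_trace_def sum_distrib_left mult.left_commute)
    finally show ?thesis .
  qed
  have "\<tau> y = y" if "\<tau> \<in> H" for \<tau> using y[of \<tau>] that H(1) by (auto simp: \<epsilon>_def)
  then have "y \<in> fixed_field H" by (simp add: fixed_field_def)
  then have "y \<in> adjoin_sqrt u" by (simp only: fixd)
  then obtain a b where ab: "y = to_ac a + to_ac b * s" using adjoin_sqrt_eq(2)[OF s] by blast
  have "\<sigma> s \<noteq> s"
  proof
    assume "\<sigma> s = s"
    then have "\<sigma> y = y" by (simp add: ab galois_add[OF \<sigma>] galois_mult[OF \<sigma>] galois_to_ac[OF \<sigma>])
    then have "2 * y = 0" using y[OF \<sigma>] False by (simp add: \<epsilon>_def neg_eq_iff_add_eq_0)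
    then show False using x(2) two' by (simp add: y_def)
  qed
  then show ?thesis using galois_sqrt[OF \<sigma> s] False by auto
qed

text \<open>An element fixed by all of the Galois group lies in particular in k(\<surd>u). If
  \<surd>u is not in k, some automorphism negates it and kills its coefficient.\<close>

lemma galois_fixed_in_base:
  fixes u :: "'a::field" and x :: "'a alg_closure"
  assumes two: "(2::'a) \<noteq> 0" and fixd: "fixed_field H = adjoin_sqrt u" and H: "H \<subseteq> carrier abs_galois_group"
    and x: "\<And>\<sigma>. \<sigma> \<in> carrier abs_galois_group \<Longrightarrow> \<sigma> x = x"
  shows "x \<in> range to_ac"
proof -
  obtain s where s: "s ^ 2 = to_ac u"
    using nth_root_exists[of 2 "to_ac u"] by auto
  have "x \<in> fixed_field H" using x H by (auto simp: fixed_field_def)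
  then have "x \<in> adjoin_sqrt u" by (simp only: fixd)
  then obtain a b where ab: "x = to_ac a + to_ac b * s" using adjoin_sqrt_eq(2)[OF s] by blast
  show ?thesis
  proof (cases "s \<in> range to_ac")
    case True
    then obtain c where "s = to_ac c" by auto
    then have "x = to_ac (a + b * c)" using ab by simp
    then show ?thesis by blast
  next
    case False
    then obtain \<sigma> where \<sigma>: "\<sigma> \<in> carrier abs_galois_group" "\<sigma> s = - s"
      using galois_moves_sqrt[OF s] by blast
    have "to_ac a - to_ac b * s = to_ac a + to_ac b * s"
      using x[OF \<sigma>(1)] \<sigma>(2) by (simp add: ab galois_add[OF \<sigma>(1)] galois_mult[OF \<sigma>(1)] galois_to_ac[OF \<sigma>(1)])
    then have "2 * (to_ac b * s) = 0" by (simp add: algebra_simps)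
    moreover have "(2::'a alg_closure) \<noteq> 0" using two by (metis to_ac_eq_0_iff to_ac_numeral)
    ultimately have "x = to_ac a" using ab by simp
    then show ?thesis by blast
  qed
qed

section \<open>Two by two matrices\<close>

text \<open>
  The product \<open>*\<close> of the type \<open>'d ^ 2 ^ 2\<close> is componentwise; a separate type makes the ring
  class available for matrix multiplication.
\<close>

datatype 'd mat2 = Mat2 (m11: 'd) (m12: 'd) (m21: 'd) (m22: 'd)

instantiation mat2 :: (comm_ring_1) ring_1
begin

definition zero_mat2 :: "'a mat2" where "0 = Mat2 0 0 0 0"
definition one_mat2 :: "'a mat2" where "1 = Mat2 1 0 0 1"
definition plus_mat2 :: "'a mat2 \<Rightarrow> 'a mat2 \<Rightarrow> 'a mat2" where
  "A + B = Mat2 (m11 A + m11 B) (m12 A + m12 B) (m21 A + m21 B) (m22 A + m22 B)"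
definition minus_mat2 :: "'a mat2 \<Rightarrow> 'a mat2 \<Rightarrow> 'a mat2" where
  "A - B = Mat2 (m11 A - m11 B) (m12 A - m12 B) (m21 A - m21 B) (m22 A - m22 B)"
definition uminus_mat2 :: "'a mat2 \<Rightarrow> 'a mat2" where
  "- A = Mat2 (- m11 A) (- m12 A) (- m21 A) (- m22 A)"
definition times_mat2 :: "'a mat2 \<Rightarrow> 'a mat2 \<Rightarrow> 'a mat2" where
  "A * B = Mat2 (m11 A * m11 B + m12 A * m21 B) (m11 A * m12 B + m12 A * m22 B)
     (m21 A * m11 B + m22 A * m21 B) (m21 A * m12 B + m22 A * m22 B)"

instance
  by standard
    (auto simp: zero_mat2_def one_mat2_def plus_mat2_def minus_mat2_def uminus_mat2_def times_mat2_def
      mat2.expand algebra_simps)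

end

lemmas mat2_defs = zero_mat2_def one_mat2_def plus_mat2_def minus_mat2_def uminus_mat2_def times_mat2_def

section \<open>Scalar matrices, trace and determinant\<close>

definition scal :: "'d::comm_ring_1 \<Rightarrow> 'd mat2" where "scal c = Mat2 c 0 0 c"
definition mtr :: "'d::comm_ring_1 mat2 \<Rightarrow> 'd" where "mtr A = m11 A + m22 A"
definition mdet :: "'d::comm_ring_1 mat2 \<Rightarrow> 'd" where "mdet A = m11 A * m22 A - m12 A * m21 A"

lemma scal_simps: "scal (a + b) = scal a + scal b" "scal (a - b) = scal a - scal b"
  "scal (a * b) = scal a * scal b" "scal (- a) = - scal a" "scal 0 = 0" "scal 1 = 1"
  by (auto simp: scal_def mat2_defs)

lemma scal_numeral: "scal (numeral n) = numeral n"
proof -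
  have "scal (of_nat k) = (of_nat k :: 'a mat2)" for k :: nat
    by (induction k) (auto simp: scal_simps)
  from this[of "numeral n"] show ?thesis by simp
qed

lemma scal_commute: "scal c * A = A * scal c"
  by (auto simp: scal_def mat2_defs)

lemma scal_left_commute: "B * (scal c * A) = scal c * (B * A)"
  by (metis mult.assoc scal_commute)

lemma mtr_simps: "mtr (A + B) = mtr A + mtr B" "mtr (A - B) = mtr A - mtr B" "mtr (- A) = - mtr A"
  "mtr (scal c * A) = c * mtr A" "mtr 1 = 2" "mtr (scal c) = 2 * c"
  by (auto simp: mtr_def scal_def mat2_defs algebra_simps)

lemma mtr_commute: "mtr (A * B) = mtr (B * A)"
  by (auto simp: mtr_def mat2_defs algebra_simps)

lemma mdet_mult: "mdet (A * B) = mdet A * mdet B"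
  by (auto simp: mdet_def mat2_defs algebra_simps)

lemma mdet_1: "mdet 1 = 1"
  by (auto simp: mdet_def mat2_defs)

lemma cayley_hamilton: "A * A = scal (mtr A) * A - scal (mdet A)"
  by (auto simp: mtr_def mdet_def scal_def mat2_defs algebra_simps)

text \<open>In other words, 1 and a nonscalar matrix are linearly independent.\<close>

lemma scal_mult_eq_scalD:
  fixes A :: "'d::field mat2"
  assumes "scal \<alpha> * A = scal \<beta>" shows "(\<alpha> = 0 \<and> \<beta> = 0) \<or> (\<exists>m. A = scal m)"
  using assms by (cases A) (auto simp: scal_def mat2_defs)

lemma scal_eq_iff: "scal a = scal b \<longleftrightarrow> a = b"
  by (simp add: scal_def)

text \<open>\<open>M\<close> is conjugate to its inverse, which pins down its determinant as 1.
  Reducing \<open>M ^ 6 = 1\<close> by Cayley-Hamilton then restricts the trace to 1 and -1, and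
  trace -1 would mean \<open>M ^ 3 = 1\<close>.\<close>

lemma dihedral_order6:
  fixes M N :: "'d::field mat2"
  assumes NN: "N * N = 1" and M6: "M ^ 6 = 1" and MN: "M * N = N * M ^ 5"
    and M2: "M ^ 2 \<noteq> 1" and M3: "M ^ 3 \<noteq> 1" and two: "(2::'d) \<noteq> 0"
  shows "M * M = M - 1"
proof -
  define P where "P = M ^ 5"
  define t d where "t = mtr M" and "d = mdet M"
  have MP: "M * P = 1" using M6 by (simp add: P_def flip: power_Suc)
  have P: "P = N * M * N" by (metis NN MN P_def mult.assoc mult_1)
  have "mtr P = mtr (M * (N * N))" unfolding P by (metis mtr_commute mult.assoc)
  then have trP: "mtr P = t" by (simp add: NN t_def)
  have dN: "mdet N * mdet N = 1" using NN mdet_1 by (metis mdet_mult)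
  have "mdet P = mdet N * mdet N * d" unfolding P mdet_mult d_def by simp
  then have "d * d = 1" using MP mdet_1 dN by (metis d_def mdet_mult mult_1)
  then have d: "d = 1 \<or> d = - 1" by (simp add: square_eq_1_iff)
  have CH: "M * M = scal t * M - scal d" unfolding t_def d_def by (rule cayley_hamilton)
  \<comment> \<open>Cayley-Hamilton times the inverse \<open>P\<close> of \<open>M\<close>; since
    \<open>P\<close> and \<open>M\<close> have the same trace, taking traces gives (1 - d) t =
    0.\<close>
  have "M * M * P = M" by (simp add: mult.assoc MP)
  then have "M = scal t - scal d * P" by (simp add: CH left_diff_distrib mult.assoc MP)
  then have "t = 2 * t - d * t" using trP mtr_simps(2,4,6) t_def by metis
  then have td: "d = 1 \<or> t = 0" by (auto simp: algebra_simps)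
  \<comment> \<open>A scalar \<open>M\<close> has d = m^2. The value d = 1 would give
    \<open>M ^ 2 = 1\<close>, while d = -1 forces the trace 2m to vanish, hence m = 0.\<close>
  have nscal: "M \<noteq> scal m" for m
  proof
    assume m: "M = scal m"
    then have "d = m * m" by (simp add: d_def mdet_def scal_def)
    then have "M * M = scal d" by (simp add: m scal_simps)
    moreover have "mtr M = 2 * m" by (simp add: m mtr_simps)
    ultimately have "d = -1" using d M2 by (auto simp: power2_eq_square scal_simps)
    then have "t = 0" using td two by auto
    then have "m = 0" using \<open>mtr M = 2 * m\<close> two by (simp add: t_def)
    then show False using \<open>d = m * m\<close> \<open>d = -1\<close> by simp
  qed
  have d1: "d = 1"
  proof (rule ccontr)
    assume "d \<noteq> 1"
    then have "d = -1" "t = 0" using d td by auto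
    then have "M * M = 1" using CH by (simp add: scal_simps)
    then show False using M2 by (simp add: power2_eq_square)
  qed
  have MM: "M * M = scal t * M - 1" using CH d1 by (simp add: scal_simps)
  have M3': "M ^ 3 = scal (t * t - 1) * M - scal t"
  proof -
    have "M ^ 3 = M * M * M" by (simp add: power3_eq_cube)
    also have "\<dots> = scal t * (M * M) - M" by (simp add: MM left_diff_distrib mult.assoc)
    also have "\<dots> = scal (t * t - 1) * M - scal t" by (simp add: MM scal_simps algebra_simps)
    finally show ?thesis .
  qed
  define \<alpha> where "\<alpha> = t * t - 1"
  have "M ^ 6 = M ^ 3 * M ^ 3" by (simp flip: power_add)
  also have "\<dots> = scal \<alpha> * M * (scal \<alpha> * M) - scal \<alpha> * M * scal t - scal t * (scal \<alpha> * M) + scal t * scal t"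
    unfolding M3' \<alpha>_def[symmetric] by (simp add: algebra_simps)
  also have "\<dots> = scal (\<alpha> * \<alpha>) * (M * M) - scal (2 * t * \<alpha>) * M + scal (t * t)"
  proof -
    have 1: "scal \<alpha> * M * (scal \<alpha> * M) = scal (\<alpha> * \<alpha>) * (M * M)"
      by (simp add: scal_simps mult.assoc scal_left_commute[of M])
    have 2: "scal \<alpha> * M * scal t = scal (t * \<alpha>) * M"
      unfolding scal_commute[of t "scal \<alpha> * M", symmetric] by (simp only: scal_simps(3) mult.assoc)
    have 3: "scal (2 * t * \<alpha>) = scal (t * \<alpha>) + scal (t * \<alpha>)"
      by (simp only: scal_simps(1)[symmetric] scal_eq_iff) (simp add: algebra_simps)
    have 4: "scal t * (scal \<alpha> * M) = scal (t * \<alpha>) * M" by (simp add: scal_simps(3) mult.assoc)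
    show ?thesis unfolding 1 2 3 4 scal_simps(3)[of t t] by (simp only: distrib_right diff_diff_eq)
  qed
  also have "\<dots> = scal (\<alpha> * \<alpha> * t - 2 * t * \<alpha>) * M - scal (\<alpha> * \<alpha> - t * t)"
    by (simp add: MM scal_simps algebra_simps)
  finally have "scal (\<alpha> * \<alpha> * t - 2 * t * \<alpha>) * M = scal (1 + \<alpha> * \<alpha> - t * t)"
    by (simp add: M6 scal_simps algebra_simps)
  \<comment> \<open>As \<open>M\<close> is not scalar, both coefficients vanish. After substituting
    \<alpha> = t^2 - 1, the constant term reads \<alpha> (\<alpha> - 1) = 0.\<close>
  then have "\<alpha> * \<alpha> * t - 2 * t * \<alpha> = 0" "1 + \<alpha> * \<alpha> - t * t = 0"
    using scal_mult_eq_scalD nscal by blast+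
  then have e1: "t * \<alpha> * (\<alpha> - 2) = 0" and e2: "\<alpha> * (\<alpha> - 1) = 0"
    by (simp_all add: \<alpha>_def algebra_simps)
  have "\<alpha> = 0"
  proof (rule ccontr)
    assume "\<alpha> \<noteq> 0"
    then have "\<alpha> = 1" using e2 by simp
    then have "t = 0" using e1 by simp
    then have "(2::'d) = 0" using \<open>\<alpha> = 1\<close> unfolding \<alpha>_def by (metis add_diff_cancel_left' diff_0 mult_zero_left one_add_one add.right_inverse)
    then show False using two by simp
  qed
  then have "t = 1 \<or> t = - 1" by (simp add: \<alpha>_def square_eq_1_iff)
  moreover have "t \<noteq> - 1" using M3' M3 \<open>\<alpha> = 0\<close> by (auto simp: \<alpha>_def scal_simps)
  ultimately show ?thesis using MM by (auto simp: scal_simps)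
qed

text \<open>Conjugation by \<open>D\<close> negates \<open>E\<close> but preserves its
  trace.\<close>

lemma mtr_anticommuting:
  fixes E D :: "'d::field mat2"
  assumes two: "(2::'d) \<noteq> 0" and DD: "D * D = scal w" and ED: "E * D = - (D * E)" and "w \<noteq> 0"
  shows "mtr E = 0"
proof -
  have "D * E = - (E * D)" using ED by simp
  then have "D * E * D = - (scal w * E)" by (simp add: mult.assoc DD scal_commute)
  then have 1: "mtr (D * E * D) = - (w * mtr E)" by (simp add: mtr_simps)
  have "mtr (D * E * D) = mtr (E * D * D)" using mtr_commute[of D "E * D"] by (simp add: mult.assoc)
  also have "E * D * D = scal w * E" by (simp add: mult.assoc DD scal_commute)
  also have "mtr \<dots> = w * mtr E" by (simp add: mtr_simps)
  finally have "2 * (w * mtr E) = 0" using 1 by (simp add: eq_neg_iff_add_eq_0)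
  then show ?thesis using two \<open>w \<noteq> 0\<close> by simp
qed

text \<open>The form factors as (a - p b) (a + p b); the witnesses solve a - p b = 1, a + p b =
  u.\<close>

lemma norm_from_split:
  fixes u p :: "'d::field"
  assumes "(2::'d) \<noteq> 0" "p \<noteq> 0" "w = p\<^sup>2"
  shows "\<exists>a b. u = a\<^sup>2 - w * b\<^sup>2"
proof -
  have "(2::'d) * 2 \<noteq> 0" using assms(1) by (simp only: mult_eq_0_iff) simp
  then have four: "(4::'d) \<noteq> 0" by simp
  have "u = ((u + 1) / 2)\<^sup>2 - w * ((u - 1) / (2 * p))\<^sup>2"
    using assms four by (simp add: power2_eq_square divide_simps) (simp add: algebra_simps)
  then show ?thesis by blast
qed

text \<open>Both matrices are traceless. A combination E - x D squares to u + w x^2 by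
  anticommutation; choosing x to make it triangular turns that value into the square of a diagonal
  entry.\<close>

lemma anticommuting_imp_norm:
  fixes E D :: "'d::field mat2"
  assumes two: "(2::'d) \<noteq> 0" and "E * E = scal u" "D * D = scal w" "E * D = - (D * E)" "w \<noteq> 0" "u \<noteq> 0"
  shows "\<exists>a b. u = a\<^sup>2 - w * b\<^sup>2"
proof -
  have "D * E = - (E * D)" using assms(4) by simp
  then have DED: "mtr E = 0" "mtr D = 0" using mtr_anticommuting assms by blast+
  obtain a b c where E: "E = Mat2 a b c (- a)"
    using DED(1) by (cases E) (auto simp: mtr_def add_eq_0_iff)
  obtain p q r where D: "D = Mat2 p q r (- p)"
    using DED(2) by (cases D) (auto simp: mtr_def add_eq_0_iff)
  have eu: "a * a + b * c = u" and ew: "p * p + q * r = w"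
    using assms(2,3) by (auto simp: E D mat2_defs scal_def)
  have "a * p + b * r = - (p * a + q * c)"
    using assms(4) by (auto simp: E D mat2_defs)
  then have ac: "2 * (p * a) = - (b * r) - q * c" by (simp add: algebra_simps eq_neg_iff_add_eq_0)
  show ?thesis
  proof (cases "r = 0")
    case True
    then have "w = p\<^sup>2" "p \<noteq> 0" using ew assms(5) by (auto simp: power2_eq_square)
    then show ?thesis using norm_from_split two by blast
  next
    case False
    \<comment> \<open>x = c / r cancels the lower left entry of E - x D and leaves a - c p / r on
      the diagonal.\<close>
    have "r * r * ((a - c * p / r)\<^sup>2 - w * (c / r)\<^sup>2) = (a * r - c * p)\<^sup>2 - w * c\<^sup>2"
      using False by (simp add: power2_eq_square field_simps)
    also have "\<dots> = r * (a * a * r - c * (2 * (p * a)) - q * c * c)"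
      unfolding ew[symmetric] by (simp add: power2_eq_square algebra_simps)
    also have "\<dots> = r * r * u" unfolding ac eu[symmetric] by (simp add: algebra_simps)
    finally have "u = (a - c * p / r)\<^sup>2 - w * (c / r)\<^sup>2" using False by simp
    then show ?thesis by blast
  qed
qed

section \<open>Split quaternion algebras\<close>

lemma finsum_eq_sum:
  fixes R :: "('d::comm_monoid_add, 'm) ring_scheme"
  assumes "carrier R = UNIV" "add R = (+)" "ring.zero R = 0" "finite A"
  shows "finsum R f A = sum f A"
proof -
  interpret abelian_monoid R
    using assms by unfold_locales (auto simp: algebra_simps)
  show ?thesis using assms(4)
    by (induction A rule: finite_induct) (auto simp: assms(1-3))
qed

section \<open>Matrix algebras over the quaternions and over k in coordinates\<close>

abbreviation qmult :: "'a::field \<Rightarrow> 'a \<Rightarrow> 'a \<times> 'a \<times> 'a \<times> 'a \<Rightarrow> 'a \<times> 'a \<times> 'a \<times> 'a \<Rightarrow> 'a \<times> 'a \<times> 'a \<times> 'a" where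
  "qmult u w \<equiv> monoid.mult (quaternion_algebra u w)"

lemma qmult_0: "qmult u w 0 x = 0" "qmult u w x 0 = 0"
  by (cases x; simp add: quaternion_algebra_def zero_prod_def)+

lemma finsum_quaternion: "finite A \<Longrightarrow> finsum (quaternion_algebra u w) f A = sum f A"
  by (rule finsum_eq_sum) (auto simp: quaternion_algebra_def zero_prod_def fun_eq_iff)

lemma finsum_base: "finite A \<Longrightarrow> finsum base_algebra f A = sum f A"
  by (rule finsum_eq_sum) (auto simp: base_algebra_def)

lemma carrier_matrix_algebra: "carrier (matrix_algebra n M) = ({..<n} \<times> {..<n}) \<rightarrow>\<^sub>E carrier M"
  and smult_matrix_algebra: "module.smult (matrix_algebra n M) c S = (\<lambda>p\<in>{..<n} \<times> {..<n}. module.smult M c (S p))"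
  and add_matrix_algebra: "ring.add (matrix_algebra n M) S Y = (\<lambda>p\<in>{..<n} \<times> {..<n}. ring.add M (S p) (Y p))"
  and one_matrix_algebra: "monoid.one (matrix_algebra n M) =
    restrict (\<lambda>(i, j). if i = j then \<one>\<^bsub>M\<^esub> else \<zero>\<^bsub>M\<^esub>) ({..<n} \<times> {..<n})"
  by (simp_all add: matrix_algebra_def Let_def)

lemma mult_matrix_quaternion:
  "S \<otimes>\<^bsub>matrix_algebra n (quaternion_algebra u w)\<^esub> Y =
     restrict (\<lambda>(i, j). \<Sum>l<n. qmult u w (S (i, l)) (Y (l, j))) ({..<n} \<times> {..<n})"
  by (simp add: matrix_algebra_def Let_def finsum_quaternion)

lemma mult_matrix_base:
  "S \<otimes>\<^bsub>matrix_algebra n base_algebra\<^esub> Y =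
     restrict (\<lambda>(i, j). \<Sum>l<n. S (i, l) * Y (l, j)) ({..<n} \<times> {..<n})"
  by (simp add: matrix_algebra_def Let_def finsum_base) (simp add: base_algebra_def)

text \<open>The vanishing norm form says that x0^2 - w x2^2 equals u times x1^2 - w x3^2. So u is a
  quotient of norms from k(\<surd>w), hence a norm, unless both norms vanish; in that case w is a
  square.\<close>

lemma isotropic_quaternion:
  fixes u w :: "'a::field"
  assumes two: "(2::'a) \<noteq> 0" and "u \<noteq> 0" "w \<noteq> 0" and x: "(x0, x1, x2, x3) \<noteq> (0, 0, 0, 0)"
    and n: "x0\<^sup>2 - u * x1\<^sup>2 - w * x2\<^sup>2 + u * w * x3\<^sup>2 = 0"
  shows "\<exists>a b. u = a\<^sup>2 - w * b\<^sup>2"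
proof (cases "x1\<^sup>2 - w * x3\<^sup>2 = 0")
  case False
  define d where "d = x1\<^sup>2 - w * x3\<^sup>2"
  have "d \<noteq> 0" using False by (simp add: d_def)
  \<comment> \<open>Multiplicativity of the norm for (x0 + x2 \<surd>w) (x1 - x3 \<surd>w).\<close>
  have "(x0 * x1 - w * x2 * x3)\<^sup>2 - w * (x2 * x1 - x0 * x3)\<^sup>2 = (x0\<^sup>2 - w * x2\<^sup>2) * d"
    by (simp add: d_def power2_eq_square algebra_simps)
  also have "x0\<^sup>2 - w * x2\<^sup>2 = u * d" using n by (simp add: d_def algebra_simps)
  finally have "u = ((x0 * x1 - w * x2 * x3) / d)\<^sup>2 - w * ((x2 * x1 - x0 * x3) / d)\<^sup>2"
    using \<open>d \<noteq> 0\<close> by (simp add: power_divide divide_simps) (simp add: power2_eq_square)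
  then show ?thesis by blast
next
  case True
  then have *: "x1\<^sup>2 = w * x3\<^sup>2" by simp
  have **: "x0\<^sup>2 = w * x2\<^sup>2" using n * by (simp add: algebra_simps)
  have "\<exists>p. w = p\<^sup>2"
  proof (cases "x3 = 0")
    case True
    then have "x2 \<noteq> 0" using x * ** by auto
    then have "w = (x0 / x2)\<^sup>2" using ** by (simp add: power_divide divide_simps)
    then show ?thesis by blast
  next
    case False
    then have "w = (x1 / x3)\<^sup>2" using * by (simp add: power_divide divide_simps)
    then show ?thesis by blast
  qed
  then show ?thesis using norm_from_split two \<open>w \<noteq> 0\<close> by fastforce
qed

text \<open>If the norm n of s were nonzero, multiplying s q s = c s by the conjugate
  \<open>t\<close> on both sides would give n^2 q = c n t. Every quaternion would then be a multiple
  of \<open>t\<close>, although 1 and i are not proportional.\<close>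

lemma sandwich_isotropic:
  fixes u w :: "'a::field"
  assumes two: "(2::'a) \<noteq> 0" and "u \<noteq> 0" "w \<noteq> 0" and s: "s \<noteq> 0"
    and sand: "\<And>q. \<exists>c. qmult u w (qmult u w s q) s = module.smult (quaternion_algebra u w) c s"
  shows "\<exists>a b. u = a\<^sup>2 - w * b\<^sup>2"
proof (rule ccontr)
  assume no: "\<not> ?thesis"
  obtain x0 x1 x2 x3 where sx: "s = (x0, x1, x2, x3)" by (cases s)
  define n where "n = x0\<^sup>2 - u * x1\<^sup>2 - w * x2\<^sup>2 + u * w * x3\<^sup>2"
  define t where "t = (x0, - x1, - x2, - x3)"
  have n: "n \<noteq> 0" using isotropic_quaternion[OF two assms(2,3), of x0 x1 x2 x3] no s
    by (auto simp: n_def sx zero_prod_def)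
  have t: "\<exists>c. module.smult (quaternion_algebra u w) (n * n) q = module.smult (quaternion_algebra u w) (c * n) t" for q
  proof -
    obtain c where c: "qmult u w (qmult u w s q) s = module.smult (quaternion_algebra u w) c s" using sand by blast
    have ts: "qmult u w t (qmult u w s x) = module.smult (quaternion_algebra u w) n x" for x
      by (cases x) (simp add: t_def sx n_def quaternion_algebra_def power2_eq_square algebra_simps)
    have st: "qmult u w (qmult u w x s) t = module.smult (quaternion_algebra u w) n x" for x
      by (cases x) (simp add: t_def sx n_def quaternion_algebra_def power2_eq_square algebra_simps)
    have "qmult u w (qmult u w t (qmult u w (qmult u w s q) s)) t = module.smult (quaternion_algebra u w) (n * n) q"
      unfolding quaternion_algebra_assoc ts
      by (cases q) (simp add: t_def sx n_def quaternion_algebra_def power2_eq_square algebra_simps)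
    moreover have "qmult u w (qmult u w t (module.smult (quaternion_algebra u w) c s)) t =
        module.smult (quaternion_algebra u w) (c * n) t"
      by (simp add: t_def sx n_def quaternion_algebra_def power2_eq_square algebra_simps)
    ultimately show ?thesis using c by metis
  qed
  obtain c where c: "(n * n, 0, 0, 0) = module.smult (quaternion_algebra u w) (c * n) t"
    using t[of "(1, 0, 0, 0)"] by (auto simp: quaternion_algebra_def)
  obtain c' where c': "(0, n * n, 0, 0) = module.smult (quaternion_algebra u w) (c' * n) t"
    using t[of "(0, 1, 0, 0)"] by (auto simp: quaternion_algebra_def)
  show False using c c' n by (auto simp: t_def quaternion_algebra_def)
qed

text \<open>
  Pulling back the idempotent \<open>e\<close> with \<open>e Mat\<^sub>n(k) e = k e\<close> gives a matrix \<open>S\<close> over the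
  quaternions with \<open>S Y S \<in> k S\<close> for all \<open>Y\<close>; its nonzero entries are isotropic.
\<close>

lemma quaternion_class_trivial_imp_norm:
  fixes u w :: "'a::field"
  assumes two: "(2::'a) \<noteq> 0" and "u \<noteq> 0" "w \<noteq> 0" and "quaternion_class_trivial u w"
  shows "\<exists>a b. u = a\<^sup>2 - w * b\<^sup>2"
proof -
  obtain m n where mn: "m \<ge> 1" "n \<ge> 1"
    and "algebra_isomorphic (matrix_algebra m (quaternion_algebra u w)) (matrix_algebra n (base_algebra :: ('a, 'a) module))"
    using assms(4) unfolding quaternion_class_trivial_def brauer_equivalent_def by blast
  define Q where "Q = matrix_algebra m (quaternion_algebra u w)"
  define K where "K = matrix_algebra n (base_algebra :: ('a, 'a) module)"
  obtain f where f: "f \<in> ring_iso Q K" and fs: "\<And>c x. x \<in> carrier Q \<Longrightarrow> f (c \<odot>\<^bsub>Q\<^esub> x) = c \<odot>\<^bsub>K\<^esub> f x"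
    using \<open>algebra_isomorphic _ _\<close> unfolding algebra_isomorphic_def Q_def K_def by blast
  have bij: "bij_betw f (carrier Q) (carrier K)"
    and fm: "\<And>x y. x \<in> carrier Q \<Longrightarrow> y \<in> carrier Q \<Longrightarrow> f (x \<otimes>\<^bsub>Q\<^esub> y) = f x \<otimes>\<^bsub>K\<^esub> f y"
    using f by (auto simp: ring_iso_def ring_hom_def)
  have cQ: "carrier Q = ({..<m} \<times> {..<m}) \<rightarrow>\<^sub>E UNIV" and cK: "carrier K = ({..<n} \<times> {..<n}) \<rightarrow>\<^sub>E UNIV"
    by (simp_all add: Q_def K_def carrier_matrix_algebra quaternion_algebra_def base_algebra_def)
  define e :: "nat \<times> nat \<Rightarrow> 'a" where "e = restrict (\<lambda>(i, j). if i = 0 \<and> j = 0 then 1 else 0) ({..<n} \<times> {..<n})"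
  have e: "e \<in> carrier K" by (auto simp: cK e_def)
  then have "e \<in> f ` carrier Q" using bij by (simp only: bij_betw_imp_surj_on)
  then obtain S where S: "S \<in> carrier Q" "f S = e" by (elim imageE) simp
  have mQ: "x \<otimes>\<^bsub>Q\<^esub> y \<in> carrier Q" "c \<odot>\<^bsub>Q\<^esub> x \<in> carrier Q" for x y c
    unfolding cQ by (auto simp: Q_def smult_matrix_algebra mult_matrix_quaternion)
  have sand: "\<exists>c. S \<otimes>\<^bsub>Q\<^esub> Y \<otimes>\<^bsub>Q\<^esub> S = c \<odot>\<^bsub>Q\<^esub> S" if Y: "Y \<in> carrier Q" for Y
  proof -
    define c where "c = f Y (0, 0)"
    have 1: "(\<Sum>l<n. e (i, l) * g l) = (if i = 0 then g 0 else 0)" if "i < n" for i and g :: "nat \<Rightarrow> 'a"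
    proof -
      have "(\<Sum>l<n. e (i, l) * g l) = (\<Sum>l<n. if l = 0 then (if i = 0 then g 0 else 0) else 0)"
        using that by (intro sum.cong) (auto simp: e_def)
      also have "\<dots> = (if i = 0 then g 0 else 0)" using mn by (subst sum.delta) auto
      finally show ?thesis .
    qed
    have 2: "(\<Sum>l<n. g l * e (l, j)) = (if j = 0 then g 0 else 0)" if "j < n" for j and g :: "nat \<Rightarrow> 'a"
    proof -
      have "(\<Sum>l<n. g l * e (l, j)) = (\<Sum>l<n. if l = 0 then (if j = 0 then g 0 else 0) else 0)"
        using that by (intro sum.cong) (auto simp: e_def)
      also have "\<dots> = (if j = 0 then g 0 else 0)" using mn by (subst sum.delta) auto
      finally show ?thesis .
    qed
    have "e \<otimes>\<^bsub>K\<^esub> f Y \<otimes>\<^bsub>K\<^esub> e = c \<odot>\<^bsub>K\<^esub> e"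
      unfolding K_def mult_matrix_base smult_matrix_algebra
      using mn by (auto intro!: restrict_ext simp: 1 2 c_def) (auto simp: e_def base_algebra_def)
    then have "f (S \<otimes>\<^bsub>Q\<^esub> Y \<otimes>\<^bsub>Q\<^esub> S) = f (c \<odot>\<^bsub>Q\<^esub> S)"
      using S Y mQ by (simp add: fm fs)
    then have "S \<otimes>\<^bsub>Q\<^esub> Y \<otimes>\<^bsub>Q\<^esub> S = c \<odot>\<^bsub>Q\<^esub> S"
      using inj_onD[OF bij_betw_imp_inj_on[OF bij] _ mQ(1) mQ(2)] by blast
    then show ?thesis ..
  qed
  have "\<exists>a<m. \<exists>b<m. S (a, b) \<noteq> 0"
  proof (rule ccontr)
    assume "\<not> ?thesis"
    then have "0 \<odot>\<^bsub>Q\<^esub> S = S"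
      using S(1) unfolding Q_def smult_matrix_algebra carrier_matrix_algebra
      by (intro extensionalityI[where A = "{..<m} \<times> {..<m}"])
         (auto simp: quaternion_algebra_def zero_prod_def PiE_def)
    then have "0 \<odot>\<^bsub>K\<^esub> e = e" using fs[OF S(1), of 0] S(2) by simp
    then have "(0 \<odot>\<^bsub>K\<^esub> e) (0, 0) = e (0, 0)" by simp
    then show False using mn by (simp add: K_def smult_matrix_algebra e_def base_algebra_def)
  qed
  then obtain a b where ab: "a < m" "b < m" "S (a, b) \<noteq> 0" by blast
  have "\<exists>c. qmult u w (qmult u w (S (a, b)) q) (S (a, b)) = module.smult (quaternion_algebra u w) c (S (a, b))" for q
  proof -
    \<comment> \<open>With the single entry \<open>q\<close> in position (b, a), the (a, b) entry of
      \<open>S Y S\<close> is S(a, b) q S(a, b).\<close>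
    define Y where "Y = restrict (\<lambda>(i, j). if i = b \<and> j = a then q else 0) ({..<m} \<times> {..<m})"
    have "Y \<in> carrier Q" by (auto simp: Y_def cQ)
    then obtain c where c: "S \<otimes>\<^bsub>Q\<^esub> Y \<otimes>\<^bsub>Q\<^esub> S = c \<odot>\<^bsub>Q\<^esub> S" using sand by blast
    have 1: "(\<Sum>l<m. qmult u w (S (a, l)) (Y (l, j))) = (if j = a then qmult u w (S (a, b)) q else 0)" if "j < m" for j
    proof -
      have "(\<Sum>l<m. qmult u w (S (a, l)) (Y (l, j))) =
          (\<Sum>l<m. if l = b then (if j = a then qmult u w (S (a, b)) q else 0) else 0)"
        using that by (intro sum.cong) (auto simp: Y_def qmult_0)
      also have "\<dots> = (if j = a then qmult u w (S (a, b)) q else 0)" using ab by (subst sum.delta) auto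
      finally show ?thesis .
    qed
    have "(S \<otimes>\<^bsub>Q\<^esub> Y \<otimes>\<^bsub>Q\<^esub> S) (a, b) =
        (\<Sum>j<m. qmult u w (\<Sum>l<m. qmult u w (S (a, l)) (Y (l, j))) (S (j, b)))"
      unfolding Q_def mult_matrix_quaternion using ab by simp
    also have "\<dots> = (\<Sum>l<m. if l = a then qmult u w (qmult u w (S (a, b)) q) (S (a, b)) else 0)"
      by (intro sum.cong refl) (auto simp: 1 qmult_0)
    also have "\<dots> = qmult u w (qmult u w (S (a, b)) q) (S (a, b))" using ab by (subst sum.delta) auto
    finally have "qmult u w (qmult u w (S (a, b)) q) (S (a, b)) = (c \<odot>\<^bsub>Q\<^esub> S) (a, b)" using c by simp
    then show ?thesis using ab by (auto simp: Q_def smult_matrix_algebra)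
  qed
  then show ?thesis using sandwich_isotropic[OF two assms(2,3) ab(3)] by blast
qed

text \<open>An explicit isomorphism onto the 2 by 2 matrices: \<open>g\<close> sends i to the matrix
  with rows (a, -w b), (b, -a), and j to the one with rows (0, w), (1, 0). The norm equation says
  that the first has square u.\<close>

lemma norm_imp_quaternion_class_trivial:
  fixes u w :: "'a::field"
  assumes two: "(2::'a) \<noteq> 0" and u: "u \<noteq> 0" and w: "w \<noteq> 0" and uab: "u = a\<^sup>2 - w * b\<^sup>2"
  shows "quaternion_class_trivial u w"
proof -
  define Q where "Q = matrix_algebra 1 (quaternion_algebra u w)"
  define K where "K = matrix_algebra 2 (base_algebra :: ('a, 'a) module)"
  have uu: "u = a * a - w * (b * b)" using uab by (simp add: power2_eq_square)
  define g :: "'a \<times> 'a \<times> 'a \<times> 'a \<Rightarrow> nat \<Rightarrow> nat \<Rightarrow> 'a" where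
    "g = (\<lambda>(x0, x1, x2, x3) i j.
       if i = 0 then (if j = 0 then x0 + a * x1 - w * b * x3 else - w * b * x1 + w * x2 + a * w * x3)
       else (if j = 0 then b * x1 + x2 - a * x3 else x0 - a * x1 + b * w * x3))"
  define f where "f S = restrict (\<lambda>(i, j). g (S (0, 0)) i j) ({..<2::nat} \<times> {..<2})"
    for S :: "nat \<times> nat \<Rightarrow> 'a \<times> 'a \<times> 'a \<times> 'a"
  \<comment> \<open>\<open>P\<close> and \<open>R\<close> recover a x1 - w b x3 and b x1 - a x3.
    This linear system has determinant -u, which explains the division by \<open>u\<close>.\<close>
  define h :: "(nat \<times> nat \<Rightarrow> 'a) \<Rightarrow> nat \<times> nat \<Rightarrow> 'a \<times> 'a \<times> 'a \<times> 'a" where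
    "h Y = (let P = (Y (0, 0) - Y (1, 1)) / 2; R = (Y (1, 0) - Y (0, 1) / w) / 2 in
       restrict (\<lambda>_. ((Y (0, 0) + Y (1, 1)) / 2, (a * P - w * b * R) / u,
          (Y (0, 1) / w + Y (1, 0)) / 2, (b * P - a * R) / u)) ({..<1::nat} \<times> {..<1}))" for Y
  have cQ: "carrier Q = ({..<1} \<times> {..<1}) \<rightarrow>\<^sub>E UNIV" and cK: "carrier K = ({..<2} \<times> {..<2}) \<rightarrow>\<^sub>E UNIV"
    by (simp_all add: Q_def K_def carrier_matrix_algebra quaternion_algebra_def base_algebra_def)
  have ind: "i = 0 \<or> i = 1" if "i < 2" for i :: nat using that by auto
  have bij: "bij_betw f (carrier Q) (carrier K)"
  proof (rule bij_betw_byWitness[where f' = h])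
    show "\<forall>S\<in>carrier Q. h (f S) = S"
    proof
      fix S assume S: "S \<in> carrier Q"
      obtain x0 x1 x2 x3 where x: "S (0, 0) = (x0, x1, x2, x3)" by (cases "S (0, 0)")
      have P: "(x0 + a * x1 - w * b * x3 - (x0 - a * x1 + b * w * x3)) / 2 = a * x1 - w * b * x3"
        using two by (simp add: field_simps)
      have R: "(b * x1 + x2 - a * x3 - (- w * b * x1 + w * x2 + a * w * x3) / w) / 2 = b * x1 - a * x3"
        using two w by (simp add: field_simps)
      have fS: "f S (0, 0) = x0 + a * x1 - w * b * x3" "f S (1, 1) = x0 - a * x1 + b * w * x3"
        "f S (0, 1) = - w * b * x1 + w * x2 + a * w * x3" "f S (1, 0) = b * x1 + x2 - a * x3"
        by (simp_all add: f_def g_def x)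
      have T: "(x0 + a * x1 - w * b * x3 + (x0 - a * x1 + b * w * x3)) / 2 = x0"
        "((- w * b * x1 + w * x2 + a * w * x3) / w + (b * x1 + x2 - a * x3)) / 2 = x2"
        using two w by (simp_all add: field_simps)
      have U: "(a * (a * x1 - w * b * x3) - w * b * (b * x1 - a * x3)) / u = x1"
        "(b * (a * x1 - w * b * x3) - a * (b * x1 - a * x3)) / u = x3"
        using u by (simp_all add: divide_simps) (simp_all add: uu algebra_simps)
      have "h (f S) (0, 0) = S (0, 0)"
        unfolding h_def Let_def fS P R U T x by simp
      then have "h (f S) p = S p" if "p \<in> {..<1} \<times> {..<1}" for p using that by auto
      moreover have "S \<in> extensional ({..<1} \<times> {..<1})" using S unfolding cQ PiE_def by blast
      moreover have "h (f S) \<in> extensional ({..<1} \<times> {..<1})" unfolding h_def Let_def by (rule restrict_extensional)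
      ultimately show "h (f S) = S" by (intro extensionalityI)
    qed
    show "\<forall>Y\<in>carrier K. f (h Y) = Y"
    proof
      fix Y assume Y: "Y \<in> carrier K"
      define P R where "P = (Y (0, 0) - Y (1, 1)) / 2" and "R = (Y (1, 0) - Y (0, 1) / w) / 2"
      define T0 T2 where "T0 = (Y (0, 0) + Y (1, 1)) / 2" and "T2 = (Y (0, 1) / w + Y (1, 0)) / 2"
      define A1 A3 where "A1 = (a * P - w * b * R) / u" and "A3 = (b * P - a * R) / u"
      have h: "h Y (0, 0) = (T0, A1, T2, A3)"
        by (simp add: h_def Let_def P_def R_def T0_def T2_def A1_def A3_def)
      have uA: "u * A1 = a * P - w * b * R" "u * A3 = b * P - a * R"
        using u by (simp_all add: A1_def A3_def)
      have "u * (a * A1 - w * b * A3) = a * (u * A1) - w * b * (u * A3)" by (simp only: algebra_simps)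
      also have "\<dots> = u * P" unfolding uA by (simp add: uu algebra_simps)
      finally have P: "a * A1 - w * b * A3 = P" using u by simp
      have "u * (b * A1 - a * A3) = b * (u * A1) - a * (u * A3)" by (simp only: algebra_simps)
      also have "\<dots> = u * R" unfolding uA by (simp add: uu algebra_simps)
      finally have R: "b * A1 - a * A3 = R" using u by simp
      have half: "(x + y) / 2 + (x - y) / 2 = x" "(x + y) / 2 - (x - y) / 2 = y" for x y :: 'a
        using two by (simp_all flip: add_divide_distrib diff_divide_distrib)
      have "f (h Y) (0, 0) = T0 + (a * A1 - w * b * A3)" by (simp add: f_def h g_def)
      then have f00: "f (h Y) (0, 0) = Y (0, 0)" unfolding P T0_def P_def half .
      have "f (h Y) (1, 1) = T0 - (a * A1 - w * b * A3)" by (simp add: f_def h g_def)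
      then have f11: "f (h Y) (1, 1) = Y (1, 1)" unfolding P T0_def P_def half .
      have "f (h Y) (1, 0) = T2 + (b * A1 - a * A3)" by (simp add: f_def h g_def)
      then have f10: "f (h Y) (1, 0) = Y (1, 0)"
        unfolding R T2_def R_def add.commute[of "Y (0, 1) / w"] half .
      have "f (h Y) (0, 1) = w * (T2 - (b * A1 - a * A3))" by (simp add: f_def h g_def algebra_simps)
      then have "f (h Y) (0, 1) = w * (Y (0, 1) / w)"
        unfolding R T2_def R_def add.commute[of "Y (0, 1) / w"] half .
      then have f01: "f (h Y) (0, 1) = Y (0, 1)" using w by simp
      have "f (h Y) (i, j) = Y (i, j)" if "i < 2" "j < 2" for i j
        using that[THEN ind] f00 f01 f10 f11 by auto
      then have "f (h Y) p = Y p" if "p \<in> {..<2} \<times> {..<2}" for p using that by auto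
      moreover have "Y \<in> extensional ({..<2} \<times> {..<2})" using Y unfolding cK PiE_def by blast
      moreover have "f (h Y) \<in> extensional ({..<2} \<times> {..<2})" unfolding f_def by (rule restrict_extensional)
      ultimately show "f (h Y) = Y" by (intro extensionalityI)
    qed
    show "f ` carrier Q \<subseteq> carrier K"
      unfolding cK f_def by (intro image_subsetI restrict_PiE_iff[THEN iffD2] ballI UNIV_I)
    show "h ` carrier K \<subseteq> carrier Q"
      unfolding cQ h_def Let_def by (intro image_subsetI restrict_PiE_iff[THEN iffD2] ballI UNIV_I)
  qed
  have "f \<in> ring_hom Q K"
  proof (rule ring_hom_memI)
    show "f S \<in> carrier K" if "S \<in> carrier Q" for S
      using bij that by (rule bij_betwE[THEN bspec])
    fix S Y :: "nat \<times> nat \<Rightarrow> 'a \<times> 'a \<times> 'a \<times> 'a"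
    obtain x0 x1 x2 x3 where x: "S (0, 0) = (x0, x1, x2, x3)" by (cases "S (0, 0)")
    obtain y0 y1 y2 y3 where y: "Y (0, 0) = (y0, y1, y2, y3)" by (cases "Y (0, 0)")
    have s2: "(\<Sum>l<2. F l) = F 0 + F 1" for F :: "nat \<Rightarrow> 'a" by (simp add: numeral_2_eq_2)
    show "f (S \<otimes>\<^bsub>Q\<^esub> Y) = f S \<otimes>\<^bsub>K\<^esub> f Y"
      unfolding Q_def K_def mult_matrix_quaternion mult_matrix_base f_def
      by (rule restrict_ext)
         (auto simp: x y s2 g_def quaternion_algebra_def uu algebra_simps dest!: ind)
    show "f (S \<oplus>\<^bsub>Q\<^esub> Y) = f S \<oplus>\<^bsub>K\<^esub> f Y"
      unfolding Q_def K_def add_matrix_algebra f_def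
      by (rule restrict_ext)
         (auto simp: x y g_def quaternion_algebra_def base_algebra_def algebra_simps)
  next
    show "f \<one>\<^bsub>Q\<^esub> = \<one>\<^bsub>K\<^esub>"
      unfolding Q_def K_def one_matrix_algebra f_def
      by (rule restrict_ext) (auto simp: g_def quaternion_algebra_def base_algebra_def dest!: ind)
  qed
  then have "f \<in> ring_iso Q K" using bij by (simp add: ring_iso_def)
  moreover have "f (c \<odot>\<^bsub>Q\<^esub> S) = c \<odot>\<^bsub>K\<^esub> f S" for c S
  proof -
    obtain x0 x1 x2 x3 where x: "S (0, 0) = (x0, x1, x2, x3)" by (cases "S (0, 0)")
    show ?thesis
      unfolding Q_def K_def smult_matrix_algebra f_def
      by (rule restrict_ext) (auto simp: x g_def quaternion_algebra_def base_algebra_def algebra_simps)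
  qed
  ultimately have "algebra_isomorphic Q K" unfolding algebra_isomorphic_def by blast
  then show ?thesis
    unfolding quaternion_class_trivial_def brauer_equivalent_def Q_def K_def
    by (intro exI[of _ 1] conjI exI[of _ 2]) auto
qed

section \<open>The dihedral group\<close>

text \<open>A symmetry is determined by its values at 0 and 1: the first yields c, and the second
  then yields s because 1 and -1 differ modulo 6.\<close>

lemma card_D12: "card (carrier D12) = 12"
proof -
  define g :: "int \<times> int \<Rightarrow> int \<Rightarrow> int" where "g = (\<lambda>(s, c). \<lambda>x\<in>{0..<6}. (s * x + c) mod 6)"
  have "carrier D12 = {g (s, c) | s c. s \<in> {1, -1} \<and> c \<in> {0..<6}}"
    by (simp add: D12_def g_def)
  also have "\<dots> = g ` ({1, -1} \<times> {0..<6})" by blast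
  finally have "carrier D12 = g ` ({1, -1} \<times> {0..<6})" .
  moreover have "inj_on g ({1, -1} \<times> {0..<6})"
  proof (rule inj_onI, clarify)
    fix s c s' c' :: int
    assume *: "s \<in> {1, -1}" "s' \<in> {1, -1}" "c \<in> {0..<6}" "c' \<in> {0..<6}" and eq: "g (s, c) = g (s', c')"
    have "g (s, c) 0 = g (s', c') 0" "g (s, c) 1 = g (s', c') 1" using eq by simp_all
    then have c: "c mod 6 = c' mod 6" and sc: "(s + c) mod 6 = (s' + c') mod 6" by (simp_all add: g_def)
    from c *(3,4) have cc: "c = c'" by simp
    have "s = s'"
    proof (rule ccontr)
      assume "s \<noteq> s'"
      then have "s = 1 \<and> s' = - 1 \<or> s = - 1 \<and> s' = 1" using *(1,2) by blast
      then have "(1 + c) mod 6 = (- 1 + c) mod 6" using sc cc by (elim disjE conjE) simp_all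
      then show False by presburger
    qed
    with cc show "s = s' \<and> c = c'" by blast
  qed
  ultimately show ?thesis by (simp add: card_image card_cartesian_product)
qed

lemma even_cong_mod6: "(a::nat) mod 6 = b mod 6 \<Longrightarrow> even a \<longleftrightarrow> even b"
  by presburger

locale d12_group = group A for A :: "('b, 'c) monoid_scheme" (structure) +
  fixes U V :: 'b
  assumes iso_D12: "A \<cong> D12" and gens: "dihedral_generators A U V"
begin

lemma UV_carrier [simp]: "U \<in> carrier A" "V \<in> carrier A"
  and U2: "U [^] (2::nat) = \<one>" and V6: "V [^] (6::nat) = \<one>"
  and VU: "V \<otimes> U = U \<otimes> V [^] (5::nat)" and gen: "generate A {U, V} = carrier A"
  using gens by (auto simp: dihedral_generators_def)

text \<open>The normal form of a group element. Exponents are natural numbers without reduction, so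
  that products are computed by plain addition, and the exponent 5 plays the role of -1.\<close>

definition wd :: "nat \<Rightarrow> nat \<Rightarrow> 'b" where "wd e i = U [^] e \<otimes> V [^] i"

lemma wd_carrier [simp]: "wd e i \<in> carrier A" by (simp add: wd_def)

lemma V_pow_U: "V [^] (i::nat) \<otimes> U = U \<otimes> V [^] (5 * i)"
proof (induction i)
  case 0 then show ?case by simp
next
  case (Suc i)
  have "V [^] Suc i \<otimes> U = V [^] i \<otimes> (V \<otimes> U)" by (simp add: m_assoc)
  also have "\<dots> = V [^] i \<otimes> U \<otimes> V [^] (5::nat)" by (simp add: VU m_assoc)
  also have "\<dots> = U \<otimes> V [^] (5 * Suc i)" by (simp add: Suc m_assoc nat_pow_mult add.commute)
  finally show ?case .
qed

lemma V_pow_U_pow: "V [^] (i::nat) \<otimes> U [^] (e::nat) = U [^] e \<otimes> V [^] (5 ^ e * i)"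
proof (induction e)
  case 0 then show ?case by simp
next
  case (Suc e)
  have "V [^] i \<otimes> U [^] Suc e = V [^] i \<otimes> U [^] e \<otimes> U" by (simp add: m_assoc)
  also have "\<dots> = U [^] e \<otimes> (V [^] (5 ^ e * i) \<otimes> U)" by (simp add: Suc m_assoc)
  also have "\<dots> = U [^] Suc e \<otimes> V [^] (5 ^ Suc e * i)" by (simp add: V_pow_U m_assoc mult.assoc)
  finally show ?case .
qed

lemma wd_mult: "wd e i \<otimes> wd e' i' = wd (e + e') (5 ^ e' * i + i')"
proof -
  have "wd e i \<otimes> wd e' i' = U [^] e \<otimes> (V [^] i \<otimes> U [^] e') \<otimes> V [^] i'" by (simp add: wd_def m_assoc)
  also have "\<dots> = wd (e + e') (5 ^ e' * i + i')"
    unfolding V_pow_U_pow wd_def by (simp add: m_assoc nat_pow_mult[symmetric])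
  finally show ?thesis .
qed

lemma wd_mod: "wd (e mod 2) (i mod 6) = wd e i"
proof -
  have "U [^] (e mod 2) = U [^] e"
  proof -
    have "U [^] e = U [^] (2 * (e div 2) + e mod 2)" by simp
    also have "\<dots> = U [^] (e mod 2)" unfolding nat_pow_mult[OF UV_carrier(1), symmetric]
      by (simp add: nat_pow_pow[symmetric] U2)
    finally show ?thesis ..
  qed
  moreover have "V [^] (i mod 6) = V [^] i"
  proof -
    have "V [^] i = V [^] (6 * (i div 6) + i mod 6)" by simp
    also have "\<dots> = V [^] (i mod 6)" unfolding nat_pow_mult[OF UV_carrier(2), symmetric]
      by (simp add: nat_pow_pow[symmetric] V6)
    finally show ?thesis ..
  qed
  ultimately show ?thesis by (simp add: wd_def)
qed

lemma U_wd: "U = wd 1 0" and V_wd: "V = wd 0 1" and one_wd: "\<one> = wd 0 0" and V_pow_wd: "V [^] i = wd 0 i"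
  by (simp_all add: wd_def)

lemma carrier_wd: "x \<in> carrier A \<Longrightarrow> \<exists>e i. x = wd e i"
proof -
  assume "x \<in> carrier A"
  then have "x \<in> generate A {U, V}" by (simp add: gen)
  then show ?thesis
  proof (induction rule: generate.induct)
    case one then show ?case using one_wd by blast
  next
    case (incl h) then show ?case using U_wd V_wd by blast
  next
    case (inv h)
    have "inv U = U" by (rule inv_equality) (use U2 in \<open>simp_all add: numeral_2_eq_2\<close>)
    moreover have "inv V = V [^] (5::nat)"
    proof (rule inv_equality)
      have "V [^] (5::nat) \<otimes> V = V [^] (6::nat)" by (simp flip: nat_pow_Suc)
      then show "V [^] (5::nat) \<otimes> V = \<one>" by (simp add: V6)
    qed simp_all
    ultimately have "inv h = wd 1 0 \<or> inv h = wd 0 5" using inv U_wd V_pow_wd[of 5] by auto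
    then show ?case by blast
  next
    case (eng x y) then show ?case using wd_mult by blast
  qed
qed

text \<open>Twelve normal forms exhaust a group of order 12, so they are distinct.\<close>

lemma wd_eq_iff: "wd e i = wd e' i' \<longleftrightarrow> e mod 2 = e' mod 2 \<and> i mod 6 = i' mod 6"
proof -
  define w where "w = (\<lambda>(e, i). wd e i)"
  let ?I = "{..<2::nat} \<times> {..<6::nat}"
  have "w ` ?I = carrier A"
  proof
    show "w ` ?I \<subseteq> carrier A" by (auto simp: w_def)
    show "carrier A \<subseteq> w ` ?I"
    proof
      fix x assume "x \<in> carrier A"
      then obtain e i where "x = wd e i" using carrier_wd by blast
      then have "x = w (e mod 2, i mod 6)" by (simp add: w_def wd_mod)
      then show "x \<in> w ` ?I" by (rule image_eqI) auto
    qed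
  qed
  moreover have "card (carrier A) = 12"
  proof -
    obtain f where "f \<in> iso A D12" using iso_D12 by (auto simp: is_iso_def)
    then have "bij_betw f (carrier A) (carrier D12)" by (simp add: iso_def)
    then show ?thesis using card_D12 by (simp add: bij_betw_same_card)
  qed
  ultimately have "card (w ` ?I) = card ?I" by (simp add: card_cartesian_product)
  then have inj: "inj_on w ?I" by (intro eq_card_imp_inj_on) auto
  show ?thesis
  proof
    assume "wd e i = wd e' i'"
    then have "w (e mod 2, i mod 6) = w (e' mod 2, i' mod 6)" by (simp add: w_def wd_mod)
    then have "(e mod 2, i mod 6) = (e' mod 2, i' mod 6)" by (rule inj_onD[OF inj]) auto
    then show "e mod 2 = e' mod 2 \<and> i mod 6 = i' mod 6" by simp
  qed (metis wd_mod)
qed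

lemma wd_pow: "wd 1 i [^] (2::nat) = \<one>"
proof -
  have "wd 1 i [^] (2::nat) = wd 1 i \<otimes> wd 1 i" by (simp add: numeral_2_eq_2)
  also have "\<dots> = \<one>" unfolding wd_mult one_wd wd_eq_iff by simp
  finally show ?thesis .
qed

lemma auto_pow: "f \<in> hom A A \<Longrightarrow> x \<in> carrier A \<Longrightarrow> f (x [^] (n::nat)) = f x [^] n"
  using group_hom.hom_nat_pow[of A A f x n] group_axioms by (simp add: group_hom_def group_hom_axioms_def)

text \<open>An automorphism preserves the order 6 of \<open>V\<close>. Every element outside the
  powers of \<open>V\<close> is an involution, and among these powers only \<open>V\<close> and its
  inverse have order 6.\<close>

lemma auto_V:
  assumes "f \<in> auto A"
  shows "f V = wd 0 1 \<or> f V = wd 0 5"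
proof -
  have f: "f \<in> hom A A" "inj_on f (carrier A)" using assms by (auto simp: auto_def Bij_def bij_betw_def)
  have fc: "f V \<in> carrier A" using f(1) by (auto simp: hom_def)
  have ord: "f V [^] n \<noteq> \<one>" if "0 < n" "n < 6" for n :: nat
  proof
    assume "f V [^] n = \<one>"
    then have "f (V [^] n) = f \<one>"
      using f(1) hom_one[OF f(1) group_axioms group_axioms] by (simp add: auto_pow)
    then have "V [^] n = \<one>" using f(2) by (auto dest: inj_onD)
    then show False using that unfolding V_pow_wd one_wd wd_eq_iff by simp
  qed
  obtain e i where ei: "f V = wd (e mod 2) (i mod 6)" using carrier_wd[OF fc] wd_mod by metis
  have "e mod 2 = 0"
  proof (rule ccontr)
    assume "e mod 2 \<noteq> 0"
    then have "f V = wd 1 (i mod 6)" using ei by (simp add: mod2_eq_if split: if_splits)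
    then show False using ord[of 2] wd_pow by simp
  qed
  moreover define m where "m = i mod 6"
  ultimately have fV: "f V = wd 0 m" using ei by simp
  have pw: "f V [^] n = wd 0 (m * n)" for n
    unfolding fV by (simp add: wd_def nat_pow_pow)
  have "(m * 2) mod 6 \<noteq> 0" "(m * 3) mod 6 \<noteq> 0"
    using ord[of 2] ord[of 3] unfolding pw one_wd wd_eq_iff by auto
  moreover have "m = 0 \<or> m = 1 \<or> m = 2 \<or> m = 3 \<or> m = 4 \<or> m = 5" unfolding m_def by auto
  ultimately have "m = 1 \<or> m = 5" by auto
  then show ?thesis using fV by auto
qed

text \<open>If the image of \<open>U\<close> were a power of \<open>V\<close>, it would commute with
  the image of \<open>V\<close>, so \<open>U\<close> and \<open>V\<close> would commute.\<close>

lemma auto_U: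
  assumes "f \<in> auto A"
  shows "\<exists>c<6. f U = wd 1 c"
proof -
  have f: "f \<in> hom A A" "inj_on f (carrier A)" using assms by (auto simp: auto_def Bij_def bij_betw_def)
  have fc: "f U \<in> carrier A" using f(1) by (auto simp: hom_def)
  obtain e i where ei: "f U = wd (e mod 2) (i mod 6)" using carrier_wd[OF fc] wd_mod by metis
  have "e mod 2 \<noteq> 0"
  proof
    assume "e mod 2 = 0"
    then have "f U = wd 0 (i mod 6)" using ei by simp
    then have "f V \<otimes> f U = f U \<otimes> f V" using auto_V[OF assms] by (auto simp: wd_mult add.commute)
    then have "f (V \<otimes> U) = f (U \<otimes> V)" using f(1) by (simp add: hom_mult)
    then have "V \<otimes> U = U \<otimes> V" using f(2) by (auto dest: inj_onD)
    then have "wd 0 1 \<otimes> wd 1 0 = wd 1 0 \<otimes> wd 0 1" using U_wd V_wd by simp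
    then show False unfolding wd_mult wd_eq_iff by simp
  qed
  then have "f U = wd 1 (i mod 6)" using ei by (simp add: mod2_eq_if split: if_splits)
  then show ?thesis by (intro exI[of _ "i mod 6"]) auto
qed

lemma hom_wd: "f \<in> hom A A \<Longrightarrow> f (wd e i) = f U [^] e \<otimes> f V [^] i"
  by (simp add: wd_def hom_mult auto_pow)

lemma generate_V: "generate A {V [^] (n::nat)} = {wd 0 (n * i) | i. True}"
proof
  have "\<exists>i. x = wd 0 (n * i)" if "x \<in> generate A {V [^] n}" for x
    using that
  proof (induction rule: generate.induct)
    case one then show ?case by (intro exI[of _ 0]) (simp add: one_wd)
  next
    case (incl h) then show ?case by (intro exI[of _ 1]) (simp add: V_pow_wd)
  next
    case (inv h)
    have "inv (V [^] n) = wd 0 (n * 5)"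
    proof (rule inv_equality)
      show "wd 0 (n * 5) \<otimes> V [^] n = \<one>" unfolding V_pow_wd wd_mult one_wd wd_eq_iff by simp
    qed simp_all
    then show ?case using inv by blast
  next
    case (eng x y)
    then obtain i j where "x = wd 0 (n * i)" "y = wd 0 (n * j)" by blast
    then have "x \<otimes> y = wd 0 (n * (i + j))" by (simp add: wd_mult distrib_left)
    then show ?case by blast
  qed
  then show "generate A {V [^] n} \<subseteq> {wd 0 (n * i) | i. True}" by blast
  have "wd 0 (n * i) \<in> generate A {V [^] n}" for i
  proof (induction i)
    case 0 then show ?case by (simp add: one_wd[symmetric] generate.one)
  next
    case (Suc i)
    have "wd 0 (n * Suc i) = wd 0 (n * i) \<otimes> V [^] n" by (simp add: V_pow_wd wd_mult add.commute)
    then show ?case using generate.eng[OF Suc generate.incl] by simp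
  qed
  then show "{wd 0 (n * i) | i. True} \<subseteq> generate A {V [^] n}" by blast
qed

lemma coset_wd: "generate A {V [^] (2::nat)} #> wd e i = {wd e i' | i'. i' mod 2 = i mod 2}"
proof -
  have *: "wd 0 (2 * j) \<otimes> wd e i = wd e (5 ^ e * 2 * j + i)" for j by (simp add: wd_mult mult.assoc)
  show ?thesis
    unfolding r_coset_def generate_V
  proof (intro equalityI subsetI)
    fix x assume "x \<in> (\<Union>h\<in>{wd 0 (2 * i) |i. True}. {h \<otimes> wd e i})"
    then obtain j where "x = wd e (5 ^ e * 2 * j + i)" using * by auto
    then show "x \<in> {wd e i' | i'. i' mod 2 = i mod 2}"
      by (intro CollectI exI[of _ "5 ^ e * 2 * j + i"]) (simp add: mult.assoc mult.left_commute)
  next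
    fix x assume "x \<in> {wd e i' | i'. i' mod 2 = i mod 2}"
    then obtain i' where i': "x = wd e i'" "i' mod 2 = i mod 2" by blast
    \<comment> \<open>\<open>i' + 5 * i\<close> represents i' - i modulo 6 without subtraction. The
      factor \<open>5 ^ e\<close> in \<open>k\<close> undoes the twist from moving \<open>V\<close>
      past \<open>wd e i\<close>, since 25 is 1 modulo 6.\<close>
    obtain j where j: "(i' + 5 * i) = 2 * j" using i'(2) by (metis dvd_def even_add even_mult_iff odd_numeral even_iff_mod_2_eq_zero)
    define k where "k = 5 ^ e * j"
    have "(5 ^ e :: nat) * 5 ^ e = 25 ^ e" by (simp flip: power_mult_distrib)
    then have "5 ^ e * 2 * k = 25 ^ e * (2 * j)" by (simp add: k_def algebra_simps)
    then have "wd 0 (2 * k) \<otimes> wd e i = wd e (25 ^ e * (2 * j) + i)" by (simp only: *)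
    also have "\<dots> = x"
    proof -
      have "(25 ^ e :: nat) mod 6 = 1"
        using power_mod[of "25::nat" 6 e] by simp
      then have "(25 ^ e * (2 * j) + i) mod 6 = (1 * (2 * j) + i) mod 6"
        by (metis mod_add_left_eq mod_mult_left_eq)
      also have "1 * (2 * j) + i = i' + 6 * i" using j by simp
      also have "(i' + 6 * i) mod 6 = i' mod 6" by simp
      finally show ?thesis using i'(1) by (simp add: wd_eq_iff)
    qed
    finally show "x \<in> (\<Union>h\<in>{wd 0 (2 * i) |i. True}. {h \<otimes> wd e i})" by blast
  qed
qed

end

section \<open>The Galois action on the dihedral group and its cocycle\<close>

locale galois_d12 = d12_group A U V for A :: "('b, 'c) monoid_scheme" (structure) and U V :: 'b +
  fixes \<phi> :: "('a::field alg_closure \<Rightarrow> 'a alg_closure) \<Rightarrow> 'b \<Rightarrow> 'b" and L :: "'a alg_closure set"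
  assumes hom\<phi>: "\<phi> \<in> hom abs_galois_group (AutoGroup A)"
    and L: "finite_galois_subextension L" and fact\<phi>: "factors_through L \<phi>"
begin

lemma \<phi>_auto: "\<sigma> \<in> carrier abs_galois_group \<Longrightarrow> \<phi> \<sigma> \<in> auto A"
  using hom\<phi> by (auto simp: hom_def AutoGroup_def)

lemma \<phi>_hom: "\<sigma> \<in> carrier abs_galois_group \<Longrightarrow> \<phi> \<sigma> \<in> hom A A"
  using \<phi>_auto by (auto simp: auto_def)

lemma \<phi>_closed: "\<sigma> \<in> carrier abs_galois_group \<Longrightarrow> x \<in> carrier A \<Longrightarrow> \<phi> \<sigma> x \<in> carrier A"
  using \<phi>_hom by (auto simp: hom_def)

lemma \<phi>_comp:
  assumes "\<sigma> \<in> carrier abs_galois_group" "\<tau> \<in> carrier abs_galois_group" "x \<in> carrier A"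
  shows "\<phi> (\<sigma> \<circ> \<tau>) x = \<phi> \<sigma> (\<phi> \<tau> x)"
proof -
  have "\<phi> (\<sigma> \<otimes>\<^bsub>abs_galois_group\<^esub> \<tau>) = \<phi> \<sigma> \<otimes>\<^bsub>AutoGroup A\<^esub> \<phi> \<tau>" using hom_mult[OF hom\<phi>] assms by blast
  moreover have "\<phi> \<sigma> \<in> Bij (carrier A)" "\<phi> \<tau> \<in> Bij (carrier A)" using \<phi>_auto assms by (auto simp: auto_def)
  ultimately show ?thesis
    using assms(3) by (simp add: abs_galois_group_def AutoGroup_def BijGroup_def compose_def)
qed

text \<open>The representative is chosen from \<open>\<phi> \<sigma>\<close> alone, so that it
  inherits \<open>factors_through\<close>.\<close>

definition cocycle :: "('a alg_closure \<Rightarrow> 'a alg_closure) \<Rightarrow> nat" where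
  "cocycle \<sigma> = (SOME c. c < 6 \<and> \<phi> \<sigma> U = wd 1 c)"

lemma \<phi>_U: "\<sigma> \<in> carrier abs_galois_group \<Longrightarrow> \<phi> \<sigma> U = wd 1 (cocycle \<sigma>)"
  using someI_ex[OF auto_U[OF \<phi>_auto]] unfolding cocycle_def by blast

lemma \<phi>_V: "\<sigma> \<in> carrier abs_galois_group \<Longrightarrow> \<phi> \<sigma> V = (if \<phi> \<sigma> V = V then V else V [^] (5::nat))"
  using auto_V[OF \<phi>_auto, of \<sigma>] unfolding V_pow_wd V_wd[symmetric] by auto

lemma \<phi>_V_pow: "\<sigma> \<in> carrier abs_galois_group \<Longrightarrow> \<phi> \<sigma> (wd 0 i) = wd 0 (if \<phi> \<sigma> V = V then i else 5 * i)"
  unfolding V_pow_wd[symmetric]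
  by (subst auto_pow[OF \<phi>_hom], simp_all, subst \<phi>_V, simp_all add: nat_pow_pow)

lemma \<phi>_wd0: "\<sigma> \<in> carrier abs_galois_group \<Longrightarrow> \<phi> \<sigma> (wd 1 i) = wd 1 (cocycle \<sigma> + (if \<phi> \<sigma> V = V then i else 5 * i))"
proof -
  assume \<sigma>: "\<sigma> \<in> carrier abs_galois_group"
  have "wd 1 i = U \<otimes> wd 0 i" by (simp add: wd_def)
  then have "\<phi> \<sigma> (wd 1 i) = wd 1 (cocycle \<sigma>) \<otimes> wd 0 (if \<phi> \<sigma> V = V then i else 5 * i)"
    using hom_mult[OF \<phi>_hom[OF \<sigma>]] by (simp add: \<phi>_U[OF \<sigma>] \<phi>_V_pow[OF \<sigma>])
  then show ?thesis by (simp add: wd_mult)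
qed

text \<open>The 1-cocycle identity in Z/6: \<sigma> acts on exponents of \<open>V\<close> by a sign,
  and \<open>5 *\<close> stands for negation.\<close>

lemma cocycle_comp:
  assumes "\<sigma> \<in> carrier abs_galois_group" "\<tau> \<in> carrier abs_galois_group"
  shows "cocycle (\<sigma> \<circ> \<tau>) mod 6 = (cocycle \<sigma> + (if \<phi> \<sigma> V = V then cocycle \<tau> else 5 * cocycle \<tau>)) mod 6"
proof -
  have "wd 1 (cocycle (\<sigma> \<circ> \<tau>)) = \<phi> \<sigma> (\<phi> \<tau> U)"
    using \<phi>_U[OF galois_comp[OF assms]] \<phi>_comp[OF assms, of U] by simp
  also have "\<dots> = wd 1 (cocycle \<sigma> + (if \<phi> \<sigma> V = V then cocycle \<tau> else 5 * cocycle \<tau>))"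
    using \<phi>_U[OF assms(2)] \<phi>_wd0[OF assms(1)] by simp
  finally show ?thesis unfolding wd_eq_iff by simp
qed

lemma factors_cocycle: "factors_through L cocycle" 
  using fact\<phi> unfolding factors_through_def cocycle_def by metis

lemma \<phi>_V_comp:
  assumes "\<sigma> \<in> carrier abs_galois_group" "\<tau> \<in> carrier abs_galois_group"
  shows "\<phi> (\<sigma> \<circ> \<tau>) V = V \<longleftrightarrow> (\<phi> \<sigma> V = V \<longleftrightarrow> \<phi> \<tau> V = V)"
proof -
  have "wd 0 5 \<noteq> wd 0 1" unfolding wd_eq_iff by simp
  then have V5: "V [^] (5::nat) \<noteq> V" unfolding V_pow_wd[symmetric] by simp
  have "\<phi> (\<sigma> \<circ> \<tau>) V = \<phi> \<sigma> (\<phi> \<tau> V)" using \<phi>_comp[OF assms] by simp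
  moreover have "\<phi> \<sigma> (V [^] (5::nat)) = (if \<phi> \<sigma> V = V then V [^] (5::nat) else V)"
  proof -
    have "wd 0 (5 * 5) = wd 0 1" unfolding wd_eq_iff by simp
    then have "wd 0 (5 * 5) = V" by (simp only: V_wd[symmetric])
    then show ?thesis unfolding V_pow_wd[of 5] \<phi>_V_pow[OF assms(1)] by simp
  qed
  ultimately show ?thesis using V5 \<phi>_V[OF assms(1)] \<phi>_V[OF assms(2)] by metis
qed

lemma kernel_subgroup:
  "kernel_on_subgroup A \<phi> (generate A {V}) = {\<sigma> \<in> carrier abs_galois_group. \<phi> \<sigma> V = V}"
proof -
  have gV: "generate A {V} = {wd 0 i | i. True}" using generate_V[of 1] by simp
  have "restrict (\<phi> \<sigma>) (generate A {V}) = (\<lambda>x\<in>generate A {V}. x) \<longleftrightarrow> \<phi> \<sigma> V = V"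
    if \<sigma>: "\<sigma> \<in> carrier abs_galois_group" for \<sigma>
  proof
    have "V \<in> generate A {V}" by (simp add: generate.incl)
    moreover assume "restrict (\<phi> \<sigma>) (generate A {V}) = (\<lambda>x\<in>generate A {V}. x)"
    ultimately show "\<phi> \<sigma> V = V" by (metis restrict_apply')
  next
    assume "\<phi> \<sigma> V = V"
    then show "restrict (\<phi> \<sigma>) (generate A {V}) = (\<lambda>x\<in>generate A {V}. x)"
      unfolding gV using \<phi>_V_pow[OF \<sigma>] by (intro restrict_ext) auto
  qed
  then show ?thesis
    unfolding kernel_on_subgroup_def kernel_def AutoGroup_def BijGroup_def by auto
qed

text \<open>The coset of \<open>U\<close> is preserved exactly for even c. Inverting
  \<open>V\<close> does not change the parity of an exponent, so the other cosets impose no further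
  condition.\<close>

lemma kernel_quotient:
  "kernel_on_quotient A \<phi> (generate A {V [^] (2::nat)}) = {\<sigma> \<in> carrier abs_galois_group. even (cocycle \<sigma>)}"
proof -
  let ?N = "generate A {V [^] (2::nat)}"
  let ?C = "\<lambda>e i. {wd e i' | i'. i' mod 2 = i mod 2}"
  have cosets: "carrier (A Mod ?N) = {?C e i | e i. True}"
  proof -
    have "carrier (A Mod ?N) = {?N #> x | x. x \<in> carrier A}"
      by (auto simp: FactGroup_def RCOSETS_def)
    also have "\<dots> = {?N #> wd e i | e i. True}" using carrier_wd wd_carrier by blast
    finally show ?thesis unfolding coset_wd .
  qed
  have *: "(\<lambda>C\<in>carrier (A Mod ?N). \<phi> \<sigma> ` C) = (\<lambda>C\<in>carrier (A Mod ?N). C) \<longleftrightarrow> even (cocycle \<sigma>)"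
    if \<sigma>: "\<sigma> \<in> carrier abs_galois_group" for \<sigma>
  proof
    assume eq: "(\<lambda>C\<in>carrier (A Mod ?N). \<phi> \<sigma> ` C) = (\<lambda>C\<in>carrier (A Mod ?N). C)"
    have "?C 1 0 \<in> carrier (A Mod ?N)" unfolding cosets by blast
    then have img: "\<phi> \<sigma> ` ?C 1 0 = ?C 1 0" using fun_cong[OF eq, of "?C 1 0"] by simp
    have "U \<in> ?C 1 0" using U_wd by auto
    then have "\<phi> \<sigma> U \<in> \<phi> \<sigma> ` ?C 1 0" by (rule imageI)
    then have "wd 1 (cocycle \<sigma>) \<in> ?C 1 0" by (simp only: img \<phi>_U[OF \<sigma>])
    then obtain i' where i': "wd 1 (cocycle \<sigma>) = wd 1 i'" "i' mod 2 = 0" by auto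
    have "cocycle \<sigma> mod 6 = i' mod 6" using i'(1) by (simp only: wd_eq_iff)
    from even_cong_mod6[OF this] show "even (cocycle \<sigma>)" using i'(2) by (simp add: even_iff_mod_2_eq_zero)
  next
    assume ev: "even (cocycle \<sigma>)"
    have sub: "\<phi> \<sigma> ` ?C e i \<subseteq> ?C e i" for e i
    proof
      fix x assume "x \<in> \<phi> \<sigma> ` ?C e i"
      then obtain i' where i': "x = \<phi> \<sigma> (wd e i')" "i' mod 2 = i mod 2" by blast
      have i5: "(5 * i') mod 2 = i mod 2" using i'(2) by presburger
      have ev2: "(n + m) mod 2 = m mod 2" if "even n" for n m :: nat using that by presburger
      show "x \<in> ?C e i"
      proof (cases "e mod 2 = 0")
        case True
        then have "x = \<phi> \<sigma> (wd 0 i')" "wd 0 j = wd e j" for j using i' by (metis wd_mod mod_0)+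
        then have "x = wd e (if \<phi> \<sigma> V = V then i' else 5 * i')" using \<phi>_V_pow[OF \<sigma>] by simp
        moreover have "(if \<phi> \<sigma> V = V then i' else 5 * i') mod 2 = i mod 2" using i'(2) i5 by simp
        ultimately show ?thesis by blast
      next
        case False
        then have "e mod 2 = 1 mod 2" by simp
        then have "x = \<phi> \<sigma> (wd 1 i')" "wd 1 j = wd e j" for j using i' by (metis wd_mod)+
        then have "x = wd e (cocycle \<sigma> + (if \<phi> \<sigma> V = V then i' else 5 * i'))" using \<phi>_wd0[OF \<sigma>] by simp
        moreover have "(cocycle \<sigma> + (if \<phi> \<sigma> V = V then i' else 5 * i')) mod 2 = i mod 2"
          using i'(2) i5 unfolding ev2[OF ev] by simp
        ultimately show ?thesis by blast
      qed
    qed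
    \<comment> \<open>The inclusion is an equality because an injective map preserves the
      cardinality of the finite coset.\<close>
    have img: "\<phi> \<sigma> ` ?C e i = ?C e i" for e i
    proof (rule card_subset_eq[OF _ sub])
      have "?C e i \<subseteq> wd e ` {..<6}"
      proof
        fix x assume "x \<in> ?C e i"
        then obtain j where "x = wd e j" by blast
        then have "x = wd e (j mod 6)" by (simp add: wd_eq_iff)
        then show "x \<in> wd e ` {..<6}" by (rule image_eqI) auto
      qed
      then show "finite (?C e i)" by (rule finite_subset) auto
      have "inj_on (\<phi> \<sigma>) (carrier A)" using \<phi>_auto[OF \<sigma>] by (auto simp: auto_def Bij_def bij_betw_def)
      then show "card (\<phi> \<sigma> ` ?C e i) = card (?C e i)" by (intro card_image) (auto elim: inj_on_subset)
    qed
    show "(\<lambda>C\<in>carrier (A Mod ?N). \<phi> \<sigma> ` C) = (\<lambda>C\<in>carrier (A Mod ?N). C)"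
    proof (rule restrict_ext)
      fix C assume "C \<in> carrier (A Mod ?N)"
      then obtain e i where "C = ?C e i" unfolding cosets by blast
      then show "\<phi> \<sigma> ` C = C" by (simp only: img)
    qed
  qed
  then show ?thesis
    unfolding kernel_on_quotient_def kernel_def AutoGroup_def BijGroup_def by auto
qed

text \<open>Modulo 2 the sign twist of the cocycle disappears, so its parity is an honest character
  and \<open>quadratic_character\<close> applies.\<close>

lemma quotient_character:
  assumes "(2::'a) \<noteq> 0" "fixed_field (kernel_on_quotient A \<phi> (generate A {V [^] (2::nat)})) = adjoin_sqrt u"
    and "s ^ 2 = to_ac u" "\<sigma> \<in> carrier abs_galois_group"
  shows "\<sigma> s = (if even (cocycle \<sigma>) then s else - s)"
proof -
  let ?H = "{\<sigma> \<in> carrier abs_galois_group. even (cocycle \<sigma>)}"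
  have "\<sigma> s = (if \<sigma> \<in> ?H then s else - s)"
  proof (rule quadratic_character[OF assms(1) L])
    show "factors_through L (\<lambda>\<sigma>. \<sigma> \<in> ?H)"
      unfolding factors_through_def
    proof (intro ballI impI)
      fix \<sigma> \<tau> :: "'a alg_closure \<Rightarrow> 'a alg_closure"
      assume st: "\<sigma> \<in> carrier abs_galois_group" "\<tau> \<in> carrier abs_galois_group" "\<forall>x\<in>L. \<sigma> x = \<tau> x"
      then have "cocycle \<sigma> = cocycle \<tau>" using factors_cocycle unfolding factors_through_def by blast
      then show "(\<sigma> \<in> ?H) = (\<tau> \<in> ?H)" using st by simp
    qed
    fix \<sigma> \<tau> :: "'a alg_closure \<Rightarrow> 'a alg_closure"
    assume st: "\<sigma> \<in> carrier abs_galois_group" "\<tau> \<in> carrier abs_galois_group"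
    have "even (cocycle (\<sigma> \<circ> \<tau>)) \<longleftrightarrow> (even (cocycle \<sigma>) \<longleftrightarrow> even (cocycle \<tau>))" 
      using even_cong_mod6[OF cocycle_comp[OF st]] by simp
    then show "\<sigma> \<circ> \<tau> \<in> ?H \<longleftrightarrow> (\<sigma> \<in> ?H \<longleftrightarrow> \<tau> \<in> ?H)" using st galois_comp[OF st] by simp
  next
    show "fixed_field ?H = adjoin_sqrt u" using assms(2) by (simp only: kernel_quotient)
  qed (use assms(3,4) in simp_all)
  then show ?thesis using assms by simp
qed

lemma subgroup_character:
  assumes "(2::'a) \<noteq> 0" "fixed_field (kernel_on_subgroup A \<phi> (generate A {V})) = adjoin_sqrt v"
    and "s ^ 2 = to_ac v" "\<sigma> \<in> carrier abs_galois_group"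
  shows "\<sigma> s = (if \<phi> \<sigma> V = V then s else - s)"
proof -
  let ?H = "{\<sigma> \<in> carrier abs_galois_group. \<phi> \<sigma> V = V}"
  have "\<sigma> s = (if \<sigma> \<in> ?H then s else - s)"
  proof (rule quadratic_character[OF assms(1) L])
    show "factors_through L (\<lambda>\<sigma>. \<sigma> \<in> ?H)"
      unfolding factors_through_def
    proof (intro ballI impI)
      fix \<sigma> \<tau> :: "'a alg_closure \<Rightarrow> 'a alg_closure"
      assume st: "\<sigma> \<in> carrier abs_galois_group" "\<tau> \<in> carrier abs_galois_group" "\<forall>x\<in>L. \<sigma> x = \<tau> x"
      then have "\<phi> \<sigma> = \<phi> \<tau>" using fact\<phi> unfolding factors_through_def by blast
      then show "(\<sigma> \<in> ?H) = (\<tau> \<in> ?H)" using st by simp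
    qed
    fix \<sigma> \<tau> :: "'a alg_closure \<Rightarrow> 'a alg_closure"
    assume st: "\<sigma> \<in> carrier abs_galois_group" "\<tau> \<in> carrier abs_galois_group"
    show "\<sigma> \<circ> \<tau> \<in> ?H \<longleftrightarrow> (\<sigma> \<in> ?H \<longleftrightarrow> \<tau> \<in> ?H)" using \<phi>_V_comp[OF st] st galois_comp[OF st] by simp
  next
    show "fixed_field ?H = adjoin_sqrt v" using assms(2) by (simp only: kernel_subgroup)
  qed (use assms(3,4) in simp_all)
  then show ?thesis using assms by simp
qed

end

section \<open>From embeddings to split quaternion algebras\<close>

definition madj :: "'d::comm_ring_1 mat2 \<Rightarrow> 'd mat2" where "madj A = Mat2 (m22 A) (- m12 A) (- m21 A) (m11 A)"
definition mmap :: "('d \<Rightarrow> 'e) \<Rightarrow> 'd mat2 \<Rightarrow> 'e mat2" where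
  "mmap f A = Mat2 (f (m11 A)) (f (m12 A)) (f (m21 A)) (f (m22 A))"

lemma madj_eq: "madj A = scal (mtr A) - A"
  by (simp add: madj_def scal_def mtr_def mat2_defs)

lemma mult_madj: "A * madj A = scal (mdet A)" "madj A * A = scal (mdet A)"
  by (auto simp: madj_def scal_def mdet_def mat2_defs algebra_simps)

lemma madj_mult: "madj (A * B) = madj B * madj A"
  by (auto simp: madj_def mat2_defs algebra_simps)

lemma madj_1: "madj 1 = 1"
  by (auto simp: madj_def mat2_defs)

lemma mmap_galois:
  assumes "\<sigma> \<in> carrier abs_galois_group"
  shows "mmap \<sigma> (A + B) = mmap \<sigma> A + mmap \<sigma> B" "mmap \<sigma> (A - B) = mmap \<sigma> A - mmap \<sigma> B"
    "mmap \<sigma> (A * B) = mmap \<sigma> A * mmap \<sigma> B"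
    "mmap \<sigma> (- A) = - mmap \<sigma> A" "mmap \<sigma> (scal x) = scal (\<sigma> x)" "mmap \<sigma> 1 = 1"
    "mdet (mmap \<sigma> A) = \<sigma> (mdet A)"
  using assms
  by (auto simp: mmap_def mat2_defs scal_def mdet_def galois_add galois_mult galois_diff galois_minus galois_0 galois_1)

lemma mmap_galois_power: "\<sigma> \<in> carrier abs_galois_group \<Longrightarrow> mmap \<sigma> (A ^ n) = mmap \<sigma> A ^ n"
  by (induction n) (auto simp: mmap_galois)

lemma mmap_to_ac:
  "mmap to_ac (A * B) = mmap to_ac A * mmap to_ac B" "mmap to_ac (- A) = - mmap to_ac A"
  "mmap to_ac (scal x) = scal (to_ac x)" "mmap to_ac A = mmap to_ac B \<longleftrightarrow> A = B"
  by (auto simp: mmap_def mat2_defs scal_def mat2.expand)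

definition mtrace :: "'a::field alg_closure set \<Rightarrow> (('a alg_closure \<Rightarrow> 'a alg_closure) \<Rightarrow> 'a alg_closure mat2) \<Rightarrow>
    'a alg_closure \<Rightarrow> 'a alg_closure mat2" where
  "mtrace L B x = Mat2 (twisted_trace L (\<lambda>\<sigma>. m11 (B \<sigma>)) x) (twisted_trace L (\<lambda>\<sigma>. m12 (B \<sigma>)) x)
     (twisted_trace L (\<lambda>\<sigma>. m21 (B \<sigma>)) x) (twisted_trace L (\<lambda>\<sigma>. m22 (B \<sigma>)) x)"

lemma twisted_trace_linear:
  "twisted_trace L (\<lambda>\<sigma>. f \<sigma> + g \<sigma>) x = twisted_trace L f x + twisted_trace L g x"
  "twisted_trace L (\<lambda>\<sigma>. f \<sigma> - g \<sigma>) x = twisted_trace L f x - twisted_trace L g x"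
  "twisted_trace L (\<lambda>\<sigma>. a * f \<sigma>) x = a * twisted_trace L f x"
  "twisted_trace L (\<lambda>\<sigma>. f \<sigma> * a) x = twisted_trace L f x * a"
  "twisted_trace L (\<lambda>\<sigma>. - f \<sigma>) x = - twisted_trace L f x"
  by (simp_all add: twisted_trace_def sum_distrib_left sum_distrib_right distrib_left right_diff_distrib
      sum.distrib sum_subtractf mult.left_commute mult.assoc sum_negf)

lemma mtrace_mult: "mtrace L (\<lambda>\<sigma>. C * B \<sigma>) x = C * mtrace L B x" "mtrace L (\<lambda>\<sigma>. B \<sigma> * C) x = mtrace L B x * C"
  by (simp_all add: mtrace_def times_mat2_def twisted_trace_linear)

lemma mtrace_madj: "mtrace L (\<lambda>\<sigma>. madj (B \<sigma>)) x = madj (mtrace L B x)"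
  by (simp add: mtrace_def madj_def twisted_trace_linear)

lemma galois_mtrace:
  assumes "finite_galois_subextension L" "factors_through L B" "factors_through L B'" "x \<in> L"
    and "\<sigma> \<in> carrier abs_galois_group"
    and "\<And>\<tau>. \<tau> \<in> carrier abs_galois_group \<Longrightarrow> mmap \<sigma> (B \<tau>) = B' (\<sigma> \<circ> \<tau>)"
  shows "mmap \<sigma> (mtrace L B x) = mtrace L B' x"
proof -
  have ft: "factors_through L (\<lambda>\<sigma>. h (B \<sigma>))" "factors_through L (\<lambda>\<sigma>. h (B' \<sigma>))" for h :: "_ \<Rightarrow> 'a alg_closure"
    using assms(2,3) unfolding factors_through_def by fastforce+
  have "\<sigma> (h (B \<tau>)) = h (B' (\<sigma> \<circ> \<tau>))" if "\<tau> \<in> carrier abs_galois_group" "h \<in> {m11, m12, m21, m22}" for h \<tau>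
    using assms(6)[OF that(1)] that(2) by (auto simp: mmap_def dest: sym)
  then show ?thesis
    unfolding mtrace_def mmap_def mat2.sel
    by (intro arg_cong4[where f = Mat2] galois_twisted_trace[OF assms(1) ft assms(4,5)]) auto
qed

text \<open>
  If the determinant vanished on all resolvents, so would its polarization \<open>b\<close>; two applications of
  Dedekind's independence then give \<open>2 det (B \<tau>) = b (B \<tau>) (B \<tau>) = 0\<close>.
\<close>

lemma mtrace_nonsingular:
  fixes B :: "('a::field alg_closure \<Rightarrow> 'a alg_closure) \<Rightarrow> 'a alg_closure mat2"
  assumes two: "(2::'a) \<noteq> 0" and L: "finite_galois_subextension L" and B: "factors_through L B"
    and \<tau>: "\<tau> \<in> carrier abs_galois_group" "mdet (B \<tau>) \<noteq> 0"
  shows "\<exists>x\<in>L. mdet (mtrace L B x) \<noteq> 0"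
proof (rule ccontr)
  assume "\<not> ?thesis"
  then have zero: "mdet (mtrace L B x) = 0" if "x \<in> L" for x using that by blast
  define b where "b P Q = m11 P * m22 Q + m22 P * m11 Q - m12 P * m21 Q - m21 P * m12 Q"
    for P Q :: "'a alg_closure mat2"
  have add: "mtrace L B (x + y) = mtrace L B x + mtrace L B y" if "x \<in> L" "y \<in> L" for x y
    using that by (simp add: mtrace_def plus_mat2_def twisted_trace_add[OF L])
  have polar: "b P Q = mdet (P + Q) - mdet P - mdet Q" for P Q
    by (simp add: b_def mdet_def plus_mat2_def algebra_simps)
  have bzero: "b (mtrace L B x) (mtrace L B y) = 0" if "x \<in> L" "y \<in> L" for x y
    using that by (simp add: polar add[symmetric] zero subextension_closed[OF L])
  have tr: "twisted_trace L (\<lambda>\<sigma>. b (B \<sigma>) Q) x = b (mtrace L B x) Q" for Q x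
    by (simp add: b_def mtrace_def twisted_trace_linear)
  have ft: "factors_through L (\<lambda>\<sigma>. b (B \<sigma>) Q)" for Q
    using B unfolding factors_through_def by fastforce
  \<comment> \<open>Independence in the first argument: for fixed \<open>y\<close>, all resolvents
    of the scalar function b (B \<sigma>) (mtrace L B y) of \<sigma> vanish.\<close>
  have 1: "b (B \<tau>) (mtrace L B y) = 0" if "y \<in> L" for y
    using twisted_trace_nonzero[OF L ft \<tau>(1)] bzero that unfolding tr by blast
  have sym: "b P Q = b Q P" for P Q by (simp add: b_def algebra_simps)
  have "b (B \<tau>) (B \<tau>) = 0"
  proof (rule ccontr)
    assume "b (B \<tau>) (B \<tau>) \<noteq> 0"
    from twisted_trace_nonzero[OF L ft \<tau>(1), OF this]
    obtain y where y: "y \<in> L" "b (mtrace L B y) (B \<tau>) \<noteq> 0" unfolding tr by blast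
    show False using 1[OF y(1)] y(2) unfolding sym[of "B \<tau>" "mtrace L B y"] by contradiction
  qed
  then have "2 * mdet (B \<tau>) = 0" by (simp add: b_def mdet_def algebra_simps)
  moreover have "(2::'a alg_closure) \<noteq> 0" using two by (metis to_ac_eq_0_iff to_ac_numeral)
  ultimately show False using \<tau>(2) by simp
qed

section \<open>Transfer between the two encodings of matrices\<close>

definition mat_of :: "'d ^ 2 ^ 2 \<Rightarrow> 'd mat2" where
  "mat_of A = Mat2 (A $ 1 $ 1) (A $ 1 $ 2) (A $ 2 $ 1) (A $ 2 $ 2)"
definition to_mat :: "'d mat2 \<Rightarrow> 'd ^ 2 ^ 2" where
  "to_mat A = (\<chi> i j. if i = 1 then (if j = 1 then m11 A else m12 A) else (if j = 1 then m21 A else m22 A))"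

lemma mat_of_to_mat: "mat_of (to_mat A) = A"
  by (simp add: mat_of_def to_mat_def)

lemma to_mat_of: "to_mat (mat_of A) = A"
  by (simp add: mat_of_def to_mat_def vec_eq_iff forall_2)

lemma mat_of_mult: "mat_of (A ** B) = mat_of A * mat_of B"
  by (simp add: mat_of_def matrix_matrix_mult_def times_mat2_def sum_2)

lemma mat_of_1: "mat_of (mat 1) = 1"
  by (simp add: mat_of_def mat_def one_mat2_def)

lemma mat_of_inj: "mat_of A = mat_of B \<longleftrightarrow> A = B"
  by (metis to_mat_of)

lemma mat_of_map_matrix: "mat_of (map_matrix f A) = mmap f (mat_of A)"
  by (simp add: mat_of_def mmap_def map_matrix_def)

lemma scal_mult_scal: "(scal a * P) * (scal b * Q) = scal (a * b) * (P * Q)"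
  by (simp add: scal_simps mult.assoc scal_left_commute[of P])

text \<open>The hypothesis is the sixth cyclotomic equation; \<open>1 - M\<close> is the inverse of
  \<open>M\<close>.\<close>

lemma order6_facts:
  fixes M :: "'d::comm_ring_1 mat2"
  assumes "M * M = M - 1"
  shows "M ^ 3 = - 1" "M ^ 6 = 1" "(1 - M) * M = 1" "M * (1 - M) = 1" "M ^ 5 = 1 - M"
proof -
  show 3: "M ^ 3 = - 1" by (simp add: power3_eq_cube assms left_diff_distrib)
  have "M ^ 6 = M ^ 3 * M ^ 3" by (simp flip: power_add)
  then show "M ^ 6 = 1" by (simp add: 3)
  show "(1 - M) * M = 1" "M * (1 - M) = 1" by (simp_all add: algebra_simps assms)
  have "M ^ 5 = M ^ 3 * (M * M)" by (simp flip: power_add power2_eq_square)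
  then show "M ^ 5 = 1 - M" by (simp add: 3 assms)
qed

text \<open>\<open>M\<close> is inverted by passing \<open>n\<close> and again by passing
  \<open>S\<close>, hence commutes with \<open>S * n\<close>. The three copies of \<open>M\<close>
  therefore meet at the right end as \<open>M ^ 3 = - 1\<close>.\<close>

lemma twist_cube:
  fixes M n S :: "'d::comm_ring_1 mat2"
  assumes MM: "M * M = M - 1" and nM: "n * M = (1 - M) * n" and SM: "S * M = (1 - M) * S"
  shows "(n * M) * S * (n * M) * S * (n * M) = - (n * S * n * S * n)"
proof -
  have MS: "M * S = S * (1 - M)" using SM by (simp add: algebra_simps)
  have Pn: "(1 - M) * n = n * M" using nM ..
  have "(n * M) * S * (n * M) * S * (n * M) = n * (M * S) * n * (M * S) * (n * M)" by (simp add: mult.assoc)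
  also have "\<dots> = n * S * ((1 - M) * n) * S * ((1 - M) * n) * M" unfolding MS by (simp add: mult.assoc)
  also have "\<dots> = n * S * n * (M * S) * n * M * M" unfolding Pn by (simp add: mult.assoc)
  also have "\<dots> = n * S * n * S * ((1 - M) * n) * M * M" unfolding MS by (simp add: mult.assoc)
  also have "\<dots> = n * S * n * S * n * M ^ 3" unfolding Pn by (simp add: mult.assoc power3_eq_cube)
  finally show ?thesis using order6_facts(1)[OF MM] by simp
qed

lemma twist_cube_pow:
  fixes M n S :: "'d::comm_ring_1 mat2"
  assumes MM: "M * M = M - 1" and nM: "n * M = (1 - M) * n" and SM: "S * M = (1 - M) * S"
  shows "(n * M ^ k) * S * (n * M ^ k) * S * (n * M ^ k) = (if even k then 1 else - 1) * (n * S * n * S * n)"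
proof (induction k)
  case 0 then show ?case by simp
next
  case (Suc k)
  have *: "n * M ^ Suc k = n * M ^ k * M" by (simp add: mult.assoc power_commutes)
  have "n * M ^ k * M = n * M * M ^ k" by (simp add: mult.assoc power_commutes)
  also have "\<dots> = (1 - M) * (n * M ^ k)" using nM by (simp add: mult.assoc)
  finally have nk: "n * M ^ k * M = (1 - M) * (n * M ^ k)" .
  show ?case unfolding * twist_cube[OF MM nk SM] Suc by simp
qed

context galois_d12
begin

theorem embedding_imp_norm:
  fixes u v :: 'a
  assumes two: "(2::'a) \<noteq> 0" and three: "(3::'a) \<noteq> 0" and u0: "u \<noteq> 0" and v0: "v \<noteq> 0"
    and fu: "fixed_field (kernel_on_quotient A \<phi> (generate A {V [^] (2::nat)})) = adjoin_sqrt u"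
    and fv: "fixed_field (kernel_on_subgroup A \<phi> (generate A {V})) = adjoin_sqrt v"
    and emb: "embeds_stably_in_GL2 A \<phi>"
  shows "\<exists>a b. u = a\<^sup>2 - (- 3 * v) * b\<^sup>2"
proof -
  have two': "(2::'a alg_closure) \<noteq> 0" using two by (metis to_ac_eq_0_iff to_ac_numeral)
  have three': "(3::'a alg_closure) \<noteq> 0" using three by (metis to_ac_eq_0_iff to_ac_numeral)
  obtain s t where s: "s ^ 2 = to_ac u" and t: "t ^ 2 = to_ac v"
    using nth_root_exists[of 2 "to_ac u"] nth_root_exists[of 2 "to_ac v"] by auto
  obtain B f where "f \<in> iso A (GL2\<lparr>carrier := B\<rparr>)"
    and equiv: "\<And>\<sigma> x. \<sigma> \<in> carrier abs_galois_group \<Longrightarrow> x \<in> carrier A \<Longrightarrow> f (\<phi> \<sigma> x) = map_matrix \<sigma> (f x)"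
    and B: "subgroup B (GL2 :: ('a alg_closure ^ 2 ^ 2) monoid)"
    using emb unfolding embeds_stably_in_GL2_def by blast
  then have f: "f \<in> hom A (GL2\<lparr>carrier := B\<rparr>)" "inj_on f (carrier A)" by (auto simp: iso_def bij_betw_def)
  define g where "g x = mat_of (f x)" for x
  have gm: "g (x \<otimes> y) = g x * g y" if "x \<in> carrier A" "y \<in> carrier A" for x y
    using hom_mult[OF f(1) that] by (simp add: g_def GL2_def mat_of_mult)
  have g1: "g \<one> = 1"
  proof -
    have "f \<one> ** f \<one> = f \<one>" using hom_mult[OF f(1), of \<one> \<one>] by (simp add: GL2_def)
    moreover have "invertible (f \<one>)"
      using f(1) subgroup.subset[OF B] by (auto simp: hom_def GL2_def)
    ultimately have "f \<one> = mat 1"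
      unfolding invertible_def by (metis matrix_mul_assoc matrix_mul_lid)
    then show ?thesis by (simp add: g_def mat_of_1)
  qed
  have ginj: "g x = g y \<longleftrightarrow> x = y" if "x \<in> carrier A" "y \<in> carrier A" for x y
    using f(2) that by (auto simp: g_def mat_of_inj dest: inj_onD)
  have gpow: "g (x [^] (n::nat)) = g x ^ n" if "x \<in> carrier A" for x n
    using that by (induction n) (simp_all add: g1 gm power_commutes)
  have geq: "g (\<phi> \<sigma> x) = mmap \<sigma> (g x)" if "\<sigma> \<in> carrier abs_galois_group" "x \<in> carrier A" for \<sigma> x
    using equiv[OF that] by (simp add: g_def mat_of_map_matrix)
  define M N where "M = g V" and "N = g U"
  have gwd: "g (wd e i) = N ^ e * M ^ i" for e i by (simp add: wd_def gm gpow M_def N_def)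
  have M6: "M ^ 6 = 1" using gpow[of V 6] V6 by (simp add: M_def g1)
  have NN: "N * N = 1" using gpow[of U 2] U2 by (simp add: N_def g1 power2_eq_square)
  have MN: "M * N = N * M ^ 5" using arg_cong[OF VU, of g] by (simp add: gm gpow M_def N_def)
  have "wd 0 n \<noteq> \<one>" if "0 < n" "n < 6" for n using that unfolding one_wd wd_eq_iff by simp
  then have Mn: "M ^ n \<noteq> 1" if "0 < n" "n < 6" for n
    using that ginj[of "wd 0 n" \<one>] gwd[of 0 n] g1 by simp
  have MM: "M * M = M - 1"
    using NN M6 MN Mn[of 2] Mn[of 3] two' by (intro dihedral_order6) auto
  note o6 = order6_facts[OF MM]
  have NM: "N * M = (1 - M) * N"
  proof -
    have "N * M = N * (M * N) * N" by (simp add: mult.assoc NN)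
    also have "\<dots> = (N * N) * M ^ 5 * N" unfolding MN by (simp add: mult.assoc)
    finally show ?thesis by (simp add: NN o6)
  qed
  define D where "D = M + M - 1"
  have DD: "D * D = scal (- 3)"
    by (simp add: D_def scal_simps scal_numeral MM algebra_simps)
  have anti: "n * D = - (D * n)" if "n * M = (1 - M) * n" for n
    using that by (simp add: D_def algebra_simps)
  have \<phi>D: "mmap \<sigma> D = (if \<phi> \<sigma> V = V then D else - D)" if \<sigma>: "\<sigma> \<in> carrier abs_galois_group" for \<sigma>
  proof -
    have "mmap \<sigma> M = (if \<phi> \<sigma> V = V then M else 1 - M)"
      using geq[OF \<sigma>, of V] \<phi>_V[OF \<sigma>] gpow[of V 5] o6(5) unfolding M_def by (metis UV_carrier(2))
    then show ?thesis by (simp add: D_def mmap_galois[OF \<sigma>])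
  qed
  define D' where "D' = scal t * D"
  have D'fix: "mmap \<sigma> D' = D'" if \<sigma>: "\<sigma> \<in> carrier abs_galois_group" for \<sigma>
    using subgroup_character[OF two fv t \<sigma>] by (simp add: D'_def mmap_galois[OF \<sigma>] \<phi>D[OF \<sigma>] scal_simps)
  have "D' * D' = scal t * scal t * (D * D)" unfolding D'_def by (simp add: mult.assoc scal_left_commute[of D])
  also have "\<dots> = scal (t ^ 2 * (- 3))" unfolding DD by (simp add: power2_eq_square flip: scal_simps)
  finally have D'D': "D' * D' = scal (to_ac (- 3 * v))" by (simp add: t mult.commute)
  define b where "b \<tau> = g (\<phi> \<tau> U)" for \<tau>
  have b: "b \<tau> = N * M ^ cocycle \<tau>" if "\<tau> \<in> carrier abs_galois_group" for \<tau>
    using \<phi>_U[OF that] gwd[of 1 "cocycle \<tau>"] by (simp add: b_def)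
  have bb: "b \<tau> * b \<tau> = 1" if "\<tau> \<in> carrier abs_galois_group" for \<tau>
    using \<phi>_U[OF that] gpow[of "wd 1 (cocycle \<tau>)" 2] wd_pow[of "cocycle \<tau>"] g1 by (simp add: b_def power2_eq_square)
  have bft: "factors_through L b"
    using fact\<phi> unfolding factors_through_def b_def by metis
  have id: "id \<in> carrier abs_galois_group" by (auto simp: mem_abs_galois_group)
  have "mdet (b id) * mdet (b id) = 1" using bb[OF id] by (metis mdet_mult mdet_1)
  then have "mdet (b id) \<noteq> 0" by auto
  then obtain x where x: "x \<in> L" "mdet (mtrace L b x) \<noteq> 0"
    using mtrace_nonsingular[OF two L bft id] by blast
  define S where "S = mtrace L b x"
  have Sfix: "mmap \<sigma> S = S" if \<sigma>: "\<sigma> \<in> carrier abs_galois_group" for \<sigma>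
    unfolding S_def
  proof (rule galois_mtrace[OF L bft bft x(1) \<sigma>])
    fix \<tau> :: "'a alg_closure \<Rightarrow> 'a alg_closure" assume \<tau>: "\<tau> \<in> carrier abs_galois_group"
    show "mmap \<sigma> (b \<tau>) = b (\<sigma> \<circ> \<tau>)"
      using geq[OF \<sigma>, of "\<phi> \<tau> U"] \<phi>_comp[OF \<sigma> \<tau>, of U] \<phi>_closed[OF \<tau>] by (simp add: b_def)
  qed
  \<comment> \<open>The relation is linear in the conjugates of \<open>N\<close> and its coefficient
    \<open>M\<close> does not depend on \<tau>, so it passes to the resolvent.\<close>
  have SM: "S * M = (1 - M) * S"
  proof -
    have "b \<tau> * M = (1 - M) * b \<tau>" if "\<tau> \<in> carrier abs_galois_group" for \<tau>
    proof -
      have "N * M ^ cocycle \<tau> * M = N * M * M ^ cocycle \<tau>" by (simp add: mult.assoc power_commutes)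
      then show ?thesis unfolding b[OF that] NM by (simp add: mult.assoc)
    qed
    then have "mtrace L (\<lambda>\<tau>. b \<tau> * M) x = mtrace L (\<lambda>\<tau>. (1 - M) * b \<tau>) x"
      unfolding mtrace_def twisted_trace_def by (simp add: galois_ext)
    then show ?thesis unfolding mtrace_mult S_def .
  qed
  have SD: "S * D = - (D * S)" and ND: "N * D = - (D * N)" using anti SM NM by blast+
  have "mtr S = 0"
    by (rule mtr_anticommuting[OF two' DD SD]) (use three' in simp)
  define \<xi> where "\<xi> = - mdet S"
  have SS: "S * S = scal \<xi>" using cayley_hamilton[of S] \<open>mtr S = 0\<close> by (simp add: \<xi>_def scal_simps)
  have \<xi>: "\<xi> \<noteq> 0" "\<sigma> \<xi> = \<xi>" if "\<sigma> \<in> carrier abs_galois_group" for \<sigma>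
    using x(2) mmap_galois(7)[OF that, of S] Sfix[OF that] galois_minus[OF that] by (simp_all add: \<xi>_def S_def)
  \<comment> \<open>The word has square \<open>\<xi> * \<xi>\<close>, so this factor makes
    \<open>E * E\<close> equal to u; the sign of \<sigma> on \<open>s\<close> cancels the sign
    supplied by \<open>twist_cube_pow\<close>.\<close>
  define E where "E = scal (s / \<xi>) * (N * S * N * S * N)"
  have Efix: "mmap \<sigma> E = E" if \<sigma>: "\<sigma> \<in> carrier abs_galois_group" for \<sigma>
  proof -
    have "mmap \<sigma> N = N * M ^ cocycle \<sigma>" using geq[OF \<sigma>, of U] b[OF \<sigma>] by (simp add: N_def b_def)
    then have "mmap \<sigma> E = scal (\<sigma> s / \<xi>) * ((N * M ^ cocycle \<sigma>) * S * (N * M ^ cocycle \<sigma>) * S * (N * M ^ cocycle \<sigma>))"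
      by (simp add: E_def mmap_galois[OF \<sigma>] galois_divide[OF \<sigma>] \<xi>(2)[OF \<sigma>] Sfix[OF \<sigma>])
    then show ?thesis
      unfolding twist_cube_pow[OF MM NM SM] quotient_character[OF two fu s \<sigma>]
      by (auto simp: E_def scal_simps)
  qed
  \<comment> \<open>The word is a palindrome in letters with scalar squares, so its square collapses
    from the middle.\<close>
  have "(N * S * N * S * N) * (N * S * N * S * N) = N * S * N * S * (N * N) * S * N * S * N" by (simp add: mult.assoc)
  also have "\<dots> = N * S * N * (S * S) * N * S * N" by (simp add: NN mult.assoc)
  also have "\<dots> = scal \<xi> * (N * S * (N * N) * S * N)"
    unfolding SS by (simp add: mult.assoc scal_left_commute[of N] scal_left_commute[of S])
  also have "\<dots> = scal \<xi> * (N * (S * S) * N)" by (simp add: NN mult.assoc)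
  also have "\<dots> = scal (\<xi> * \<xi>)"
    unfolding SS by (simp add: mult.assoc scal_left_commute[of N] NN scal_simps)
  finally have F2: "(N * S * N * S * N) * (N * S * N * S * N) = scal (\<xi> * \<xi>)" .
  have "E * E = scal (s / \<xi> * (s / \<xi>)) * scal (\<xi> * \<xi>)" unfolding E_def scal_mult_scal F2 ..
  also have "\<dots> = scal (s ^ 2)"
    using \<xi>(1)[OF id] by (simp add: power2_eq_square flip: scal_simps)
  finally have EE: "E * E = scal (to_ac u)" by (simp add: s)
  \<comment> \<open>Five letters, each anticommuting with \<open>D\<close>: the number is odd and
    the sign survives.\<close>
  have "N * S * N * S * N * D = - (D * (N * S * N * S * N))"
    by (simp add: mult.assoc ND SD) (simp add: ND SD flip: mult.assoc)
  then have ED: "E * D' = - (D' * E)" unfolding E_def D'_def scal_mult_scal by (simp add: mult.commute[of t])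
  have in_k: "\<exists>P0. P = mmap to_ac P0" if "\<And>\<sigma>. \<sigma> \<in> carrier abs_galois_group \<Longrightarrow> mmap \<sigma> P = P" for P :: "'a alg_closure mat2"
  proof -
    note P = that
    have k: "z \<in> range to_ac" if "\<And>\<sigma>. \<sigma> \<in> carrier abs_galois_group \<Longrightarrow> \<sigma> z = z" for z :: "'a alg_closure"
    proof (rule galois_fixed_in_base[OF two fu])
      show "kernel_on_quotient A \<phi> (generate A {V [^] (2::nat)}) \<subseteq> carrier abs_galois_group"
        unfolding kernel_quotient by blast
    qed (rule that)
    have "\<sigma> (m11 P) = m11 P" "\<sigma> (m12 P) = m12 P" "\<sigma> (m21 P) = m21 P" "\<sigma> (m22 P) = m22 P"
      if "\<sigma> \<in> carrier abs_galois_group" for \<sigma>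
      using arg_cong[OF P[OF that], of m11] arg_cong[OF P[OF that], of m12]
        arg_cong[OF P[OF that], of m21] arg_cong[OF P[OF that], of m22] by (simp_all add: mmap_def)
    then have "m11 P \<in> range to_ac" "m12 P \<in> range to_ac" "m21 P \<in> range to_ac" "m22 P \<in> range to_ac"
      by (simp_all add: k)
    then obtain p q r z where "m11 P = to_ac p" "m12 P = to_ac q" "m21 P = to_ac r" "m22 P = to_ac z" by blast
    then have "P = mmap to_ac (Mat2 p q r z)" by (simp add: mmap_def mat2.expand)
    then show ?thesis ..
  qed
  obtain E0 D0 where 0: "E = mmap to_ac E0" "D' = mmap to_ac D0" using in_k Efix D'fix by metis
  have "E0 * E0 = scal u" "D0 * D0 = scal (- 3 * v)" "E0 * D0 = - (D0 * E0)"
    using EE D'D' ED unfolding 0 mmap_to_ac(1-3)[symmetric] by (simp_all only: mmap_to_ac(4))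
  moreover have "- 3 * v \<noteq> 0" using three v0 by simp
  ultimately show ?thesis using anticommuting_imp_norm[OF two] u0 by blast
qed

end

section \<open>From split quaternion algebras to embeddings\<close>

lemma group_GL2: "group (GL2 :: ('d::field ^ 2 ^ 2) monoid)"
proof (rule groupI)
  fix x y :: "'d ^ 2 ^ 2"
  assume "x \<in> carrier GL2" "y \<in> carrier GL2"
  then show "x \<otimes>\<^bsub>GL2\<^esub> y \<in> carrier GL2" by (simp add: GL2_def invertible_mult)
next
  show "\<one>\<^bsub>GL2\<^esub> \<in> carrier (GL2 :: ('d ^ 2 ^ 2) monoid)"
    unfolding GL2_def invertible_def by (auto intro!: exI[of _ "mat 1"])
next
  fix x :: "'d ^ 2 ^ 2" assume "x \<in> carrier GL2"
  then obtain y where "x ** y = mat 1" "y ** x = mat 1" by (auto simp: GL2_def invertible_def)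
  then show "\<exists>y\<in>carrier GL2. y \<otimes>\<^bsub>GL2\<^esub> x = \<one>\<^bsub>GL2\<^esub>"
    by (intro bexI[of _ y]) (auto simp: GL2_def invertible_def)
qed (simp_all add: GL2_def matrix_mul_assoc)

text \<open>Conjugation by \<open>E\<close> inverts \<open>M\<close>, but inversion is not additive.
  The adjugate agrees with it in determinant 1 and is linear, so in this form the relation survives
  the summation in a resolvent.\<close>

lemma conj_power:
  fixes E M :: "'d::comm_ring_1 mat2"
  assumes "E * M = madj M * E"
  shows "E * M ^ k = madj (M ^ k) * E"
proof (induction k)
  case 0 then show ?case by (simp add: madj_1)
next
  case (Suc k)
  have "E * M ^ Suc k = madj M * (E * M ^ k)" by (simp add: assms flip: mult.assoc)
  also have "\<dots> = madj (M ^ k * M) * E" unfolding Suc madj_mult by (simp add: mult.assoc)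
  finally show ?case by (simp add: power_commutes)
qed

context galois_d12
begin

definition rep :: "'d::comm_ring_1 mat2 \<Rightarrow> 'd mat2 \<Rightarrow> 'b \<Rightarrow> 'd mat2" where
  "rep N M x = (let p = SOME p. x = wd (fst p) (snd p) in N ^ fst p * M ^ snd p)"

text \<open>The exponents picked by \<open>SOME\<close> in \<open>rep\<close> are determined modulo
  2 and 6, and the hypotheses make the matrix product depend on nothing more.\<close>

lemma rep_wd:
  assumes "N * N = 1" "M ^ 6 = 1"
  shows "rep N M (wd e i) = N ^ e * M ^ i"
proof -
  define p where "p = (SOME p. wd e i = wd (fst p) (snd p))"
  have "wd e i = wd (fst p) (snd p)"
    unfolding p_def by (rule someI[of _ "(e, i)"]) simp
  then have m: "e mod 2 = fst p mod 2" "i mod 6 = snd p mod 6" by (simp_all add: wd_eq_iff)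
  have N: "N ^ k = N ^ (k mod 2)" for k
    using power_add[of N "2 * (k div 2)" "k mod 2"] assms(1) by (simp add: power_mult power2_eq_square)
  have M: "M ^ k = M ^ (k mod 6)" for k
    using power_add[of M "6 * (k div 6)" "k mod 6"] assms(2) by (simp add: power_mult)
  have "N ^ e * M ^ i = N ^ fst p * M ^ snd p"
    by (metis N M m)
  then show ?thesis by (simp add: rep_def Let_def p_def)
qed

text \<open>The relations reproduce the multiplication of normal forms, and equivariance is
  inherited from the generators. Faithfulness is where characteristic different from 2 and 3
  enters.\<close>

lemma embedding_of_matrices:
  fixes N M :: "'a alg_closure mat2"
  assumes two: "(2::'a) \<noteq> 0" and three: "(3::'a) \<noteq> 0"
    and NN: "N * N = 1" and MM: "M * M = M - 1" and MN: "M * N = N * M ^ 5"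
    and \<phi>M: "\<And>\<sigma>. \<sigma> \<in> carrier abs_galois_group \<Longrightarrow> mmap \<sigma> M = (if \<phi> \<sigma> V = V then M else 1 - M)"
    and \<phi>N: "\<And>\<sigma>. \<sigma> \<in> carrier abs_galois_group \<Longrightarrow> mmap \<sigma> N = N * M ^ cocycle \<sigma>"
  shows "embeds_stably_in_GL2 A \<phi>"
proof -
  have two': "(2::'a alg_closure mat2) \<noteq> 0"
    using two scal_eq_iff[of "2::'a alg_closure" 0] by (simp add: scal_simps scal_numeral) (metis to_ac_eq_0_iff to_ac_numeral)
  have three': "(3::'a alg_closure mat2) \<noteq> 0"
    using three scal_eq_iff[of "3::'a alg_closure" 0] by (simp add: scal_simps scal_numeral) (metis to_ac_eq_0_iff to_ac_numeral)
  note o6 = order6_facts[OF MM]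
  let ?g = "rep N M"
  note gwd = rep_wd[OF NN o6(2)]
  have MN': "M ^ i * N ^ e = N ^ e * M ^ (5 ^ e * i)" for i e
  proof (induction e)
    case 0 then show ?case by simp
  next
    case (Suc e)
    have *: "M ^ j * N = N * M ^ (5 * j)" for j
    proof (induction j)
      case 0 then show ?case by simp
    next
      case (Suc j)
      have "M ^ Suc j * N = M * (M ^ j * N)" by (simp add: mult.assoc)
      also have "\<dots> = M * N * M ^ (5 * j)" unfolding Suc by (simp add: mult.assoc)
      also have "\<dots> = N * M ^ (5 * Suc j)" unfolding MN by (simp add: mult.assoc flip: power_add)
      finally show ?case .
    qed
    have "M ^ i * N ^ Suc e = (M ^ i * N ^ e) * N" by (simp add: mult.assoc power_commutes)
    also have "\<dots> = N ^ e * N * M ^ (5 ^ Suc e * i)" unfolding Suc by (simp add: mult.assoc *)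
    finally show ?case by (simp add: power_commutes)
  qed
  have gm: "?g (x \<otimes> y) = ?g x * ?g y" if xy: "x \<in> carrier A" "y \<in> carrier A" for x y
  proof -
    obtain e i e' i' where x: "x = wd e i" and y: "y = wd e' i'" using carrier_wd xy by metis
    have "?g x * ?g y = N ^ e * (M ^ i * N ^ e') * M ^ i'" unfolding x y gwd by (simp add: mult.assoc)
    also have "\<dots> = N ^ (e + e') * M ^ (5 ^ e' * i + i')" unfolding MN' by (simp add: power_add mult.assoc)
    finally show ?thesis unfolding x y wd_mult gwd by simp
  qed
  have g1: "?g \<one> = 1" unfolding one_wd gwd by simp
  have gpow: "?g (x [^] (n::nat)) = ?g x ^ n" if "x \<in> carrier A" for x n
    using that by (induction n) (simp_all add: g1 gm power_commutes)
  have M2: "M ^ 2 \<noteq> 1"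
  proof
    assume "M ^ 2 = 1"
    \<comment> \<open>M - 1 = 1 makes \<open>M\<close> the scalar 2, at which X^2 - X + 1 takes the
      value 3.\<close>
    then have "M = 2" using MM by (simp add: power2_eq_square algebra_simps)
    then have "M * M - (M - 1) = 3" by simp
    then have "(3::'a alg_closure mat2) = 0" by (simp add: MM)
    then show False using three' by simp
  qed
  have M3: "M ^ 3 \<noteq> 1"
  proof
    assume "M ^ 3 = 1"
    then have "(1::'a alg_closure mat2) + 1 = 1 + - 1" using o6(1) by simp
    then show False using two' by simp
  qed
  have ker: "x = \<one>" if x: "x \<in> carrier A" "?g x = 1" for x
  proof -
    obtain e i where "x = wd e i" using carrier_wd x(1) by blast
    then have xe: "x = wd (e mod 2) (i mod 6)" by (simp add: wd_eq_iff)
    define k where "k = i mod 6"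
    have k: "k = 0 \<or> k = 1 \<or> k = 2 \<or> k = 3 \<or> k = 4 \<or> k = 5" unfolding k_def by auto
    show ?thesis
    proof (cases "e mod 2 = 0")
      case True
      then have Mk: "M ^ k = 1" using x(2) unfolding xe gwd k_def by simp
      \<comment> \<open>Every k from 1 to 5 has a multiple congruent to 2 or 3 modulo 6, so
        \<open>M ^ k = 1\<close> would contradict \<open>M2\<close> or \<open>M3\<close>.\<close>
      have "(M ^ k) ^ 2 = 1" "(M ^ k) ^ 3 = 1" "(M ^ k) ^ 4 = 1" by (simp_all add: Mk)
      then have p: "M ^ (k * 2) = 1" "M ^ (k * 3) = 1" "M ^ (k * 4) = 1" by (simp_all flip: power_mult)
      have 8: "M ^ 8 = M ^ 6 * M ^ 2" "M ^ 20 = M ^ 6 * (M ^ 6 * (M ^ 6 * M ^ 2))" by (simp_all flip: power_add)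
      have "k = 0" using k
      proof (elim disjE)
        assume "k = 1" then show ?thesis using p(1) M2 by simp
      next
        assume "k = 2" then show ?thesis using Mk M2 by simp
      next
        assume "k = 3" then show ?thesis using Mk M3 by simp
      next
        assume "k = 4" then show ?thesis using p(1) M2 8 o6(2) by simp
      next
        assume "k = 5" then show ?thesis using p(3) M2 8 o6(2) by simp
      qed simp
      then show ?thesis using xe True by (simp add: k_def one_wd)
    next
      case False
      then have "N * M ^ k = 1" using x(2) unfolding xe gwd k_def by (simp add: mod2_eq_if split: if_splits)
      then have Mk: "M ^ k = N" by (metis NN mult.assoc mult_1 mult_1_right)
      \<comment> \<open>\<open>N\<close> would be a power of \<open>M\<close>, and commuting with
        \<open>N\<close> makes \<open>M\<close> equal to its own inverse.\<close>
      have "M * N = N * M" unfolding Mk[symmetric] by (rule power_commutes[symmetric])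
      then have "N * (N * M ^ 5) = N * (N * M)" using MN by simp
      then have "M ^ 5 = M" by (simp add: NN flip: mult.assoc)
      then have "M ^ 5 * M = M * M" by simp
      then have "M ^ 6 = M ^ 2" by (simp add: power2_eq_square power_Suc2[symmetric] del: power_Suc)
      then show ?thesis using M2 o6(2) by simp
    qed
  qed
  define f where "f x = to_mat (?g x)" for x
  have fm: "f (x \<otimes> y) = f x ** f y" if "x \<in> carrier A" "y \<in> carrier A" for x y
    using gm[OF that] by (simp add: f_def mat_of_mult mat_of_to_mat flip: mat_of_inj)
  have f1: "f \<one> = mat 1" by (simp add: f_def g1 mat_of_1 mat_of_to_mat flip: mat_of_inj)
  have finv: "invertible (f x)" if "x \<in> carrier A" for x
    unfolding invertible_def using that fm[of x "inv x"] fm[of "inv x" x] f1 by (intro exI[of _ "f (inv x)"]) simp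
  have hom: "f \<in> hom A GL2" using fm finv by (auto simp: hom_def GL2_def)
  interpret gh: group_hom A GL2 f
    using hom group_GL2 group_axioms by (simp add: group_hom_def group_hom_axioms_def)
  have "inj_on f (carrier A)"
    unfolding gh.inj_on_one_iff
  proof (intro allI impI)
    fix x assume "x \<in> carrier A" "f x = \<one>\<^bsub>GL2\<^esub>"
    then have "?g x = 1" by (metis f_def GL2_def mat_of_1 mat_of_to_mat monoid.select_convs(2))
    then show "x = \<one>" using ker \<open>x \<in> carrier A\<close> by blast
  qed
  then have iso: "f \<in> iso A (GL2\<lparr>carrier := f ` carrier A\<rparr>)"
    using fm by (auto simp: iso_def hom_def bij_betw_def GL2_def)
  have equiv: "f (\<phi> \<sigma> x) = map_matrix \<sigma> (f x)" if \<sigma>: "\<sigma> \<in> carrier abs_galois_group" and x: "x \<in> carrier A" for \<sigma> x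
  proof -
    obtain e i where xe: "x = wd e i" using carrier_wd x by blast
    have \<phi>V: "\<phi> \<sigma> V = (if \<phi> \<sigma> V = V then wd 0 1 else wd 0 5)"
      using \<phi>_V[OF \<sigma>] unfolding V_pow_wd V_wd[symmetric] .
    have "\<phi> \<sigma> x = wd 1 (cocycle \<sigma>) [^] e \<otimes> (if \<phi> \<sigma> V = V then wd 0 1 else wd 0 5) [^] i"
      unfolding xe hom_wd[OF \<phi>_hom[OF \<sigma>]] \<phi>_U[OF \<sigma>] \<phi>V[symmetric] ..
    then have "?g (\<phi> \<sigma> x) = (N * M ^ cocycle \<sigma>) ^ e * (M ^ (if \<phi> \<sigma> V = V then 1 else 5)) ^ i"
      by (simp add: gm gpow gwd)
    also have "\<dots> = mmap \<sigma> (?g x)"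
      unfolding xe gwd by (simp add: mmap_galois[OF \<sigma>] mmap_galois_power[OF \<sigma>] \<phi>M[OF \<sigma>] \<phi>N[OF \<sigma>] o6(5))
    finally show ?thesis by (simp add: f_def mat_of_map_matrix mat_of_to_mat flip: mat_of_inj)
  qed
  have "map_matrix \<sigma> ` (f ` carrier A) \<subseteq> f ` carrier A" if \<sigma>: "\<sigma> \<in> carrier abs_galois_group" for \<sigma>
  proof
    fix z assume "z \<in> map_matrix \<sigma> ` (f ` carrier A)"
    then obtain x where x: "x \<in> carrier A" "z = map_matrix \<sigma> (f x)" by (elim imageE) simp
    show "z \<in> f ` carrier A"
      unfolding x(2) equiv[OF \<sigma> x(1), symmetric] by (rule imageI[OF \<phi>_closed[OF \<sigma> x(1)]])
  qed
  then show ?thesis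
    unfolding embeds_stably_in_GL2_def
    using gh.img_is_subgroup iso equiv by (intro exI[of _ "f ` carrier A"] conjI bexI[of _ f] ballI)
qed

theorem norm_imp_embedding:
  fixes u v :: 'a
  assumes two: "(2::'a) \<noteq> 0" and three: "(3::'a) \<noteq> 0" and u0: "u \<noteq> 0" and v0: "v \<noteq> 0"
    and fu: "fixed_field (kernel_on_quotient A \<phi> (generate A {V [^] (2::nat)})) = adjoin_sqrt u"
    and fv: "fixed_field (kernel_on_subgroup A \<phi> (generate A {V})) = adjoin_sqrt v"
    and uab: "u = a\<^sup>2 - (- 3 * v) * b\<^sup>2"
  shows "embeds_stably_in_GL2 A \<phi>"
proof -
  have two': "(2::'a alg_closure) \<noteq> 0" using two by (metis to_ac_eq_0_iff to_ac_numeral)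
  obtain s t where s: "s ^ 2 = to_ac u" and t: "t ^ 2 = to_ac v"
    using nth_root_exists[of 2 "to_ac u"] nth_root_exists[of 2 "to_ac v"] by auto
  have s0: "s \<noteq> 0" and t0: "t \<noteq> 0" using s t u0 v0 by auto
  define w where "w = - 3 * v"
  \<comment> \<open>\<open>D'\<close> and \<open>E\<close> are the images of j and i under the
    splitting of the quaternion algebra given by the norm equation.\<close>
  define D' where "D' = mmap to_ac (Mat2 0 w 1 0)"
  define E where "E = mmap to_ac (Mat2 a (- w * b) b (- a))"
  have D'D': "D' * D' = scal (to_ac w)"
    unfolding D'_def mmap_to_ac(1,3)[symmetric] mmap_to_ac(4) by (simp add: times_mat2_def scal_def)
  have EE: "E * E = scal (to_ac u)"
    unfolding E_def mmap_to_ac(1,3)[symmetric] mmap_to_ac(4)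
    by (simp add: times_mat2_def scal_def uab w_def power2_eq_square algebra_simps)
  have ED': "E * D' = - (D' * E)"
    unfolding E_def D'_def mmap_to_ac(1,2)[symmetric] mmap_to_ac(4)
    by (simp add: times_mat2_def uminus_mat2_def)
  have fixk: "mmap \<sigma> (mmap to_ac P) = mmap to_ac P" if "\<sigma> \<in> carrier abs_galois_group" for \<sigma> and P :: "'a mat2"
    by (simp add: mmap_def galois_to_ac[OF that])
  define D where "D = scal (1 / t) * D'"
  have "D * D = scal (1 / t * (1 / t) * to_ac w)"
    unfolding D_def scal_mult_scal D'D' by (simp only: scal_simps)
  also have "1 / t * (1 / t) * to_ac w = - 3"
    using t t0 v0 by (simp add: w_def power2_eq_square flip: t)
  finally have DD: "D * D = - 3" by (simp add: scal_simps scal_numeral)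
  have ED: "E * D = - (D * E)" using ED' by (simp add: D_def scal_left_commute mult.assoc)
  \<comment> \<open>Halving by a scalar matrix, since \<open>mat2\<close> is a ring without
    division.\<close>
  define h where "h = (scal (1 / 2) :: 'a alg_closure mat2)"
  have hh: "h + h = 1" using two' by (simp add: h_def flip: scal_simps)
  have hc: "h * P = P * h" for P by (simp add: h_def scal_commute)
  define M where "M = h * (1 + D)"
  have D: "D = M + M - 1"
  proof -
    have "M + M = (h + h) * (1 + D)" by (simp add: M_def distrib_right)
    then show ?thesis by (simp add: hh)
  qed
  have MM: "M * M = M - 1"
  proof -
    have "M * M = h * h * ((1 + D) * (1 + D))" unfolding M_def using hc by (metis mult.assoc)
    also have "(1 + D) * (1 + D) = (D - 1) + (D - 1)" by (simp add: DD algebra_simps)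
    also have "h * h * ((D - 1) + (D - 1)) = (h + h) * (h * (D - 1))" by (simp add: distrib_left distrib_right mult.assoc)
    also have "\<dots> = h * (1 + D) - (h + h)" by (simp add: hh algebra_simps)
    finally show ?thesis by (simp add: M_def hh)
  qed
  note o6 = order6_facts[OF MM]
  have trD: "mtr D = 0" by (simp add: D_def D'_def mmap_def mtr_def scal_def times_mat2_def)
  have "2 * mtr M = 2" using trD unfolding D by (simp add: mtr_simps)
  then have "mtr M = 1" using two' by simp
  then have adjM: "madj M = 1 - M" by (simp add: madj_eq scal_simps)
  have "scal (mdet M) = scal 1" using mult_madj(1)[of M] o6(4) by (simp add: adjM scal_simps)
  then have detM: "mdet M = 1" by (simp add: scal_eq_iff)
  have detMk: "mdet (M ^ k) = 1" for k by (induction k) (simp_all add: mdet_1 mdet_mult detM)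
  have EM: "E * M = madj M * E"
  proof -
    have "E * D = - (D * E)" by (rule ED)
    then have *: "E * M + E * M = ((1 - M) + (1 - M)) * E" unfolding D by (simp add: algebra_simps mult_2)
    have "h * (P + P) = P" for P using hh by (metis distrib_left distrib_right mult_1)
    then have "E * M = h * (E * M + E * M)" "(1 - M) * E = h * (((1 - M) + (1 - M)) * E)"
      by (simp_all add: distrib_right)
    then show ?thesis using * adjM by simp
  qed
  have \<phi>M: "mmap \<sigma> M = (if \<phi> \<sigma> V = V then M else 1 - M)" if \<sigma>: "\<sigma> \<in> carrier abs_galois_group" for \<sigma>
  proof -
    have "\<sigma> 2 = 2" using galois_to_ac[OF \<sigma>, of 2] by simp
    then have "mmap \<sigma> h = h" by (simp add: h_def mmap_galois[OF \<sigma>] galois_divide[OF \<sigma>] galois_1[OF \<sigma>])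
    moreover have "mmap \<sigma> D = (if \<phi> \<sigma> V = V then D else - D)"
      using subgroup_character[OF two fv t \<sigma>] fixk[OF \<sigma>]
      by (simp add: D_def D'_def mmap_galois[OF \<sigma>] galois_divide[OF \<sigma>] galois_1[OF \<sigma>] scal_simps)
    moreover have "h * (1 - D) = 1 - M"
    proof -
      have "h * (1 - D) = (h + h) - M" by (simp add: M_def algebra_simps)
      then show ?thesis by (simp add: hh)
    qed
    ultimately show ?thesis by (simp add: M_def mmap_galois[OF \<sigma>])
  qed
  have Mmod: "M ^ i = M ^ j" if "i mod 6 = j mod 6" for i j
  proof -
    have "M ^ k = M ^ (k mod 6)" for k
      using power_add[of M "6 * (k div 6)" "k mod 6"] o6(2) by (simp add: power_mult)
    then show ?thesis using that by metis
  qed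
  \<comment> \<open>The exponent 4c is -2c modulo 6. By the cocycle identity, translation of the
    summation index by \<sigma> produces exactly the factor
    \<open>M ^ (2 * cocycle \<sigma>)\<close>.\<close>
  define b where "b \<tau> = M ^ (4 * cocycle \<tau>)" for \<tau>
  have bft: "factors_through L b" and bft': "factors_through L (\<lambda>\<tau>. b \<tau> * Q)" for Q
    using factors_cocycle unfolding factors_through_def b_def by metis+
  have id: "id \<in> carrier abs_galois_group" by (auto simp: mem_abs_galois_group)
  have "mdet (b id) \<noteq> 0" by (simp add: b_def detMk)
  then obtain x where x: "x \<in> L" "mdet (mtrace L b x) \<noteq> 0"
    using mtrace_nonsingular[OF two L bft id] by blast
  define \<beta> where "\<beta> = mtrace L b x"
  define d where "d = mdet \<beta>"
  have d0: "d \<noteq> 0" using x(2) by (simp add: d_def \<beta>_def)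
  have \<phi>\<beta>: "mmap \<sigma> \<beta> = \<beta> * M ^ (2 * cocycle \<sigma>)" if \<sigma>: "\<sigma> \<in> carrier abs_galois_group" for \<sigma>
    unfolding \<beta>_def mtrace_mult(2)[symmetric]
  proof (rule galois_mtrace[OF L bft bft' x(1) \<sigma>])
    fix \<tau> :: "'a alg_closure \<Rightarrow> 'a alg_closure" assume \<tau>: "\<tau> \<in> carrier abs_galois_group"
    define k where "k = (if \<phi> \<sigma> V = V then cocycle \<tau> else 5 * cocycle \<tau>)"
    have "mmap \<sigma> (b \<tau>) = M ^ (4 * k)"
      unfolding b_def mmap_galois_power[OF \<sigma>] \<phi>M[OF \<sigma>] k_def
      using o6(5)[symmetric] by (simp add: mult.left_commute flip: power_mult)
    also have "\<dots> = M ^ (4 * cocycle (\<sigma> \<circ> \<tau>) + 2 * cocycle \<sigma>)"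
    proof (rule Mmod)
      have "cocycle (\<sigma> \<circ> \<tau>) mod 6 = (cocycle \<sigma> + k) mod 6" using cocycle_comp[OF \<sigma> \<tau>] by (simp only: k_def)
      then have "(4 * cocycle (\<sigma> \<circ> \<tau>) + 2 * cocycle \<sigma>) mod 6 = (4 * (cocycle \<sigma> + k) + 2 * cocycle \<sigma>) mod 6"
        by (metis mod_add_left_eq mod_mult_right_eq)
      also have "4 * (cocycle \<sigma> + k) + 2 * cocycle \<sigma> = 4 * k + 6 * cocycle \<sigma>" by simp
      also have "(4 * k + 6 * cocycle \<sigma>) mod 6 = 4 * k mod 6" by simp
      finally show "4 * k mod 6 = (4 * cocycle (\<sigma> \<circ> \<tau>) + 2 * cocycle \<sigma>) mod 6" ..
    qed
    finally show "mmap \<sigma> (b \<tau>) = b (\<sigma> \<circ> \<tau>) * M ^ (2 * cocycle \<sigma>)" by (simp add: b_def power_add)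
  qed
  have M\<beta>: "M * \<beta> = \<beta> * M"
    unfolding \<beta>_def mtrace_mult[symmetric] b_def by (simp add: power_commutes)
  have E\<beta>: "E * \<beta> = madj \<beta> * E"
    unfolding \<beta>_def mtrace_madj[symmetric] mtrace_mult[symmetric] b_def by (simp only: conj_power[OF EM])
  \<comment> \<open>The twist of \<beta> has determinant 1, so dividing by \<open>d\<close> does not
    disturb the Galois action.\<close>
  have \<phi>d: "\<sigma> d = d" if \<sigma>: "\<sigma> \<in> carrier abs_galois_group" for \<sigma>
    unfolding d_def mmap_galois(7)[OF \<sigma>, symmetric] \<phi>\<beta>[OF \<sigma>] mdet_mult detMk by simp
  define N where "N = scal (1 / (s * d)) * (E * \<beta> * \<beta>)"
  have "(E * \<beta> * \<beta>) * (E * \<beta> * \<beta>) = E * \<beta> * (\<beta> * E) * \<beta> * \<beta>" by (simp add: mult.assoc)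
  also have "\<dots> = E * E * (madj \<beta> * madj \<beta> * \<beta> * \<beta>)"
  proof -
    have "E * madj \<beta> = \<beta> * E"
    proof -
      have "madj (madj \<beta>) = \<beta>" by (simp add: madj_def)
      moreover have "E * madj \<beta> = madj (madj \<beta>) * E"
        using E\<beta> unfolding madj_eq[of \<beta>] by (simp add: madj_eq mtr_simps scal_simps algebra_simps scal_commute)
      ultimately show ?thesis by simp
    qed
    then have \<beta>E: "\<beta> * E = E * madj \<beta>" ..
    have "\<beta> * (\<beta> * E) = \<beta> * (E * madj \<beta>)" by (simp only: \<beta>E)
    also have "\<dots> = \<beta> * E * madj \<beta>" by (simp only: mult.assoc)
    also have "\<dots> = E * (madj \<beta> * madj \<beta>)" by (simp only: \<beta>E mult.assoc)
    finally have *: "\<beta> * (\<beta> * E) = E * (madj \<beta> * madj \<beta>)" .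
    have "E * \<beta> * (\<beta> * E) * \<beta> * \<beta> = E * (\<beta> * (\<beta> * E)) * \<beta> * \<beta>" by (simp only: mult.assoc)
    also have "\<dots> = E * E * (madj \<beta> * madj \<beta> * \<beta> * \<beta>)" unfolding * by (simp only: mult.assoc)
    finally show ?thesis .
  qed
  also have "madj \<beta> * madj \<beta> * \<beta> * \<beta> = madj \<beta> * (madj \<beta> * \<beta>) * \<beta>" by (simp add: mult.assoc)
  also have "\<dots> = scal (d * d)"
    unfolding mult_madj(2) d_def[symmetric] by (simp add: mult.assoc scal_left_commute[of "madj \<beta>"] mult_madj scal_simps d_def)
  finally have "N * N = scal (1 / (s * d) * (1 / (s * d)) * (to_ac u * (d * d)))"
    unfolding N_def scal_mult_scal EE by (simp only: scal_simps)
  also have "1 / (s * d) * (1 / (s * d)) * (to_ac u * (d * d)) = 1"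
    using s0 d0 by (simp add: power2_eq_square flip: s)
  finally have NN: "N * N = 1" by (simp add: scal_simps)
  have P\<beta>: "(1 - M) * \<beta> = \<beta> * (1 - M)" using M\<beta> by (simp add: algebra_simps)
  have ME: "M * E = E * (1 - M)" using EM by (simp add: adjM algebra_simps)
  have "M * (E * \<beta> * \<beta>) = E * ((1 - M) * \<beta>) * \<beta>" using ME by (metis mult.assoc)
  also have "\<dots> = E * \<beta> * \<beta> * (1 - M)" using P\<beta> by (metis mult.assoc)
  finally have MN: "M * N = N * M ^ 5"
    unfolding N_def o6(5) by (simp add: scal_left_commute[of M] mult.assoc)
  have \<phi>N: "mmap \<sigma> N = N * M ^ cocycle \<sigma>" if \<sigma>: "\<sigma> \<in> carrier abs_galois_group" for \<sigma>
  proof -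
    have comm: "M ^ k * \<beta> = \<beta> * M ^ k" for k
      by (induction k) (simp_all add: mult.assoc M\<beta>, simp add: M\<beta> flip: mult.assoc)
    have "mmap \<sigma> N = scal (1 / (\<sigma> s * d)) * (E * (\<beta> * M ^ (2 * cocycle \<sigma>)) * (\<beta> * M ^ (2 * cocycle \<sigma>)))"
      using fixk[OF \<sigma>]
      by (simp add: N_def E_def mmap_galois[OF \<sigma>] galois_divide[OF \<sigma>] galois_mult[OF \<sigma>] galois_1[OF \<sigma>] \<phi>d[OF \<sigma>] \<phi>\<beta>[OF \<sigma>])
    also have "E * (\<beta> * M ^ (2 * cocycle \<sigma>)) * (\<beta> * M ^ (2 * cocycle \<sigma>)) = E * \<beta> * (M ^ (2 * cocycle \<sigma>) * \<beta>) * M ^ (2 * cocycle \<sigma>)"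
      by (simp add: mult.assoc)
    also have "\<dots> = E * \<beta> * \<beta> * M ^ (4 * cocycle \<sigma>)" unfolding comm by (simp add: mult.assoc flip: power_add)
    also have "1 / (\<sigma> s * d) = (if even (cocycle \<sigma>) then 1 else - 1) * (1 / (s * d))"
      using quotient_character[OF two fu s \<sigma>] by simp
    also have "scal ((if even (cocycle \<sigma>) then 1 else - 1) * (1 / (s * d))) = (- 1) ^ cocycle \<sigma> * scal (1 / (s * d))"
      by (simp add: scal_simps)
    \<comment> \<open>Writing the sign as a power of \<open>M\<close> reduces the claim to
      arithmetic of exponents: 3c + 4c = 7c.\<close>
    also have "(- 1) ^ cocycle \<sigma> = M ^ (3 * cocycle \<sigma>)" by (simp add: power_mult o6(1))
    also have "M ^ (3 * cocycle \<sigma>) * scal (1 / (s * d)) * (E * \<beta> * \<beta> * M ^ (4 * cocycle \<sigma>)) =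
        M ^ (3 * cocycle \<sigma>) * N * M ^ (4 * cocycle \<sigma>)" by (simp add: N_def mult.assoc)
    also have "M ^ (3 * cocycle \<sigma>) * N = N * M ^ (3 * cocycle \<sigma>)"
      by (simp add: power_mult o6(1) minus_one_power_iff)
    also have "N * M ^ (3 * cocycle \<sigma>) * M ^ (4 * cocycle \<sigma>) = N * M ^ (7 * cocycle \<sigma>)" by (simp add: mult.assoc flip: power_add)
    also have "M ^ (7 * cocycle \<sigma>) = M ^ cocycle \<sigma>"
    proof (rule Mmod)
      have "7 * cocycle \<sigma> = cocycle \<sigma> + 6 * cocycle \<sigma>" by simp
      then show "7 * cocycle \<sigma> mod 6 = cocycle \<sigma> mod 6" by (metis mod_mult_self2)
    qed
    finally show ?thesis .
  qed
  show ?thesis by (rule embedding_of_matrices[OF two three NN MM MN \<phi>M \<phi>N])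
qed

end

theorem theorem3p6:
  fixes A :: "('b, 'c) monoid_scheme"
    and \<phi> :: "('a::field alg_closure \<Rightarrow> 'a alg_closure) \<Rightarrow> 'b \<Rightarrow> 'b"
    and U V :: 'b
    and u v :: 'a
  assumes "perfect_field TYPE('a)"
    and "CHAR('a) \<noteq> 2" and "CHAR('a) \<noteq> 3"
    and "galois_group_action A \<phi>"
    and "A \<cong> D12"
    and "dihedral_generators A U V"
    and "u \<noteq> 0" and "v \<noteq> 0"
    and "fixed_field (kernel_on_quotient A \<phi> (generate A {V [^]\<^bsub>A\<^esub> (2::nat)})) = adjoin_sqrt u"
    and "fixed_field (kernel_on_subgroup A \<phi> (generate A {V})) = adjoin_sqrt v"
  shows "embeds_stably_in_GL2 A \<phi> \<longleftrightarrow> quaternion_class_trivial u (- 3 * v)"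
proof -
  obtain L where "group A" "\<phi> \<in> hom abs_galois_group (AutoGroup A)" "finite_galois_subextension L"
      "factors_through L \<phi>"
    using assms(4) unfolding galois_group_action_def factors_through_def by blast
  then interpret galois_d12 A U V \<phi> L
    using assms(5,6) by (simp add: galois_d12_def d12_group_def d12_group_axioms_def galois_d12_axioms_def)
  \<comment> \<open>The characteristic of a field is never 1, so a prime vanishes only if it is the
    characteristic.\<close>
  have no: "of_nat p \<noteq> (0::'a)" if "Factorial_Ring.prime p" "CHAR('a) \<noteq> p" for p :: nat
    using that CHAR_not_1[where ?'a = 'a] by (auto simp: of_nat_eq_0_iff_char_dvd prime_nat_iff)
  have two: "(2::'a) \<noteq> 0" and three: "(3::'a) \<noteq> 0" using no[of 2] no[of 3] assms(2,3) by auto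
  then have w: "- 3 * v \<noteq> 0" using assms(8) by simp
  \<comment> \<open>Both sides are equivalent to the norm equation
    \<open>u = a ^ 2 - (- 3 * v) * b ^ 2\<close>.\<close>
  show ?thesis
    using embedding_imp_norm[OF two three assms(7-10)] norm_imp_embedding[OF two three assms(7-10)]
      quaternion_class_trivial_imp_norm[OF two assms(7) w] norm_imp_quaternion_class_trivial[OF two assms(7) w]
    by blast
qed

end
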